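(* Let $n\ge 2$, let $\Omega\subset\mathbb{R}^n$ be a bounded domain and let $h\colon\mathbb{R}\to\mathbb{R}$ be continuous. Let $p\ge n-1$, $\bar p=\frac{p}{p+1-n}$, and let $u\in W^{1,p}_{loc}(\Omega;\mathbb{R}^n)$ be a weak solution of the equation $$\operatorname{div}\big(h(\det Du)\operatorname{cof} Du\big)=0\quad\text{in }\Omega$$ such that $h(\det Du)\in W^{1,\bar p}_{loc}(\Omega)$. Then $h(\det Du)$ is constant almost everywhere on $\Omega$.
   Context: $\mathbb{M}^{n\times n}$ is the space of real $n\times n$ matrices with inner product $A:B=\sum_{i,j}A^i_jB^i_j$; $\operatorname{cof}A$ is the cofactor matrix, so that $A^T\operatorname{cof}A=(\operatorname{cof}A)A^T=(\det A)I$. $Du$ is the Jacobian matrix, $(Du)^i_j=\partial u^i/\partial x_j$. A function $u\in W^{1,1}_{loc}(\Omega;\mathbb{R}^n)$ is a weak solution of $\operatorname{div}(h(\det Du)\operatorname{cof}Du)=0$ in $\Omega$ if $h(\det Du)\operatorname{cof}Du\in L^1_{loc}(\Omega;\mathbb{M}^{n\times n})$ and $\int_\Omega h(\det Du)\operatorname{cof}Du:D\zeta\,dx=0$ for all $\zeta\in C^1_c(\Omega;\mathbb{R}^n)$. Convention: $\bar p=\infty$ if $p=n-1$, and $\bar p=1$ if $p=\infty$. *)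

theory Defs
  imports "HOL-Analysis.Analysis"
begin

text \<open>Throughout, the space of real $n \times n$ matrices is the type \<open>real^'n^'n\<close>, whose inner
  product \<open>A \<bullet> B\<close> is the sum of the products of the entries of \<open>A\<close> and \<open>B\<close>.\<close>

section \<open>The cofactor matrix\<close>

text \<open>The index type \<open>'n\<close> carries no order, so the signed minor with sign $(-1)^{i+j}$ is written
  as the determinant of the matrix obtained from \<open>A\<close> by clearing row \<open>i\<close> and column \<open>j\<close> and
  placing \<open>1\<close> in position \<open>(i, j)\<close>.\<close>

definition cof :: "real^'n^'n \<Rightarrow> real^'n^'n" where
  "cof A = (\<chi> i j. det (\<chi> k l. if k = i \<and> l = j then 1
                                else if k = i \<or> l = j then 0 else A $ k $ l))"

lemma cof_eq_det_replace_row: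
  fixes A :: "real^'n^'n"
  shows "cof A $ i $ j = det (\<chi> k. if k = i then axis j 1 else A $ k)"
proof -
  define M where "M S = (\<chi> k. if k = i then axis j 1
      else if k \<in> S then A $ k - A $ k $ j *s axis j 1 else A $ k)" for S :: "'n set"
  have "det (M S) = det (M {})" if "finite S" for S
    using that
  proof (induction S rule: finite_induct)
    case (insert m S)
    show ?case
    proof (cases "m = i")
      case True
      have "M (insert m S) = M S"
        using True by (auto simp: M_def vec_eq_iff)
      then show ?thesis
        using insert by simp
    next
      case False
      have "M (insert m S) = (\<chi> k. if k = m then row m (M S) + (- A $ m $ j) *s row i (M S)
              else row k (M S))"
        using False insert.hyps by (auto simp: M_def vec_eq_iff row_def)
      then show ?thesis
        using det_row_operation[OF False, of "M S"] insert by simp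
    qed
  qed simp
  then have "det (M UNIV) = det (M {})"
    by simp
  moreover have "M UNIV = (\<chi> k l. if k = i \<and> l = j then 1
                                else if k = i \<or> l = j then 0 else A $ k $ l)"
    by (auto simp: M_def vec_eq_iff axis_def)
  moreover have "M {} = (\<chi> k. if k = i then axis j 1 else A $ k)"
    by (auto simp: M_def vec_eq_iff)
  ultimately show ?thesis
    by (simp add: cof_def)
qed

lemma cof_mult_transpose: "cof A ** transpose A = mat (det A)"
  for A :: "real^'n^'n"
proof -
  have "(\<Sum>j\<in>UNIV. cof A $ i $ j * A $ m $ j) = (if i = m then det A else 0)" for i m
  proof -
    have "(\<Sum>j\<in>UNIV. cof A $ i $ j * A $ m $ j)
        = (\<Sum>j\<in>UNIV. det (\<chi> k. if k = i then A $ m $ j *s axis j 1 else A $ k))"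
      by (simp add: cof_eq_det_replace_row det_row_mul[of i "A $ m $ _" "\<lambda>_. axis _ 1"] mult.commute)
    also have "\<dots> = det (\<chi> k. if k = i then (\<Sum>j\<in>UNIV. A $ m $ j *s axis j 1) else A $ k)"
      by (rule det_linear_row_sum[symmetric]) simp
    also have "(\<Sum>j\<in>UNIV. A $ m $ j *s axis j 1) = A $ m"
      by (rule basis_expansion)
    also have "det (\<chi> k. if k = i then A $ m else A $ k) = (if i = m then det A else 0)"
    proof (cases "i = m")
      case True
      then have "(\<chi> k. if k = i then A $ m else A $ k) = A"
        by (auto simp: vec_eq_iff)
      then show ?thesis
        using True by simp
    next
      case False
      then show ?thesis
        by (simp add: det_identical_rows[OF False] row_def)
    qed
    finally show ?thesis .
  qed
  then show ?thesis
    by (auto simp: vec_eq_iff matrix_matrix_mult_def transpose_def mat_def)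
qed

lemma cof_transpose: "cof (transpose A) = transpose (cof A)"
  for A :: "real^'n^'n"
proof -
  have "cof (transpose A) $ i $ j = cof A $ j $ i" for i j
    unfolding cof_def vec_lambda_beta
    by (subst det_transpose[symmetric], rule arg_cong[of _ _ det]) (auto simp: vec_eq_iff transpose_def)
  then show ?thesis
    by (simp add: vec_eq_iff transpose_def)
qed

lemma transpose_mult_cof: "transpose A ** cof A = mat (det A)"
  for A :: "real^'n^'n"
proof -
  have "transpose (transpose A ** cof A) = mat (det A)"
    using cof_mult_transpose[of "transpose A"]
    by (simp add: cof_transpose matrix_transpose_mul)
  then show ?thesis
    by (metis transpose_mat transpose_transpose)
qed


section \<open>Test functions\<close>

text \<open>\<open>n\<close> times continuously differentiable on the whole space: all iterated directional
  derivatives up to order \<open>n\<close> exist and are continuous.\<close>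

primrec Ck :: "nat \<Rightarrow> ('a::real_normed_vector \<Rightarrow> 'b::real_normed_vector) \<Rightarrow> bool" where
  "Ck 0 f \<longleftrightarrow> continuous_on UNIV f"
| "Ck (Suc n) f \<longleftrightarrow> (\<forall>x. f differentiable (at x)) \<and>
     (\<forall>v. Ck n (\<lambda>x. frechet_derivative f (at x) v))"

definition compact_support_in :: "'a::topological_space set \<Rightarrow> ('a \<Rightarrow> 'b::zero) \<Rightarrow> bool" where
  "compact_support_in \<Omega> f \<longleftrightarrow> compact (closure {x. f x \<noteq> 0}) \<and> closure {x. f x \<noteq> 0} \<subseteq> \<Omega>"

text \<open>A test function on \<open>\<Omega>\<close> is identified with its extension by zero to the whole space.\<close>

definition C1c :: "'a::real_normed_vector set \<Rightarrow> ('a \<Rightarrow> 'b::real_normed_vector) set" where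
  "C1c \<Omega> = {\<zeta>. Ck 1 \<zeta> \<and> compact_support_in \<Omega> \<zeta>}"

definition Cinfc :: "'a::real_normed_vector set \<Rightarrow> ('a \<Rightarrow> 'b::real_normed_vector) set" where
  "Cinfc \<Omega> = {\<phi>. (\<forall>n. Ck n \<phi>) \<and> compact_support_in \<Omega> \<phi>}"


section \<open>Local Lebesgue and Sobolev spaces\<close>

definition Lp_loc :: "ereal \<Rightarrow> 'a::euclidean_space set \<Rightarrow> ('a \<Rightarrow> 'b::euclidean_space) set" where
  "Lp_loc p \<Omega> = {f. f \<in> borel_measurable (lebesgue_on \<Omega>) \<and>
     (\<forall>K. compact K \<and> K \<subseteq> \<Omega> \<longrightarrow>
        (if p = \<infinity> then \<exists>C. AE x in lebesgue_on K. norm (f x) \<le> C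
         else integrable (lebesgue_on K) (\<lambda>x. norm (f x) powr real_of_ereal p)))}"

definition has_weak_gradient ::
  "(real^'n \<Rightarrow> real) \<Rightarrow> (real^'n \<Rightarrow> real^'n) \<Rightarrow> (real^'n) set \<Rightarrow> bool" where
  "has_weak_gradient f g \<Omega> \<longleftrightarrow> f \<in> Lp_loc 1 \<Omega> \<and> g \<in> Lp_loc 1 \<Omega> \<and>
     (\<forall>\<phi>\<in>Cinfc \<Omega>. \<forall>j.
        (LINT x|lebesgue_on \<Omega>. f x * frechet_derivative \<phi> (at x) (axis j 1))
        = - (LINT x|lebesgue_on \<Omega>. g x $ j * \<phi> x))"

text \<open>Row \<open>i\<close> of the Jacobian matrix is the gradient of the \<open>i\<close>-th component.\<close>

definition has_weak_jacobian ::
  "(real^'n \<Rightarrow> real^'m) \<Rightarrow> (real^'n \<Rightarrow> real^'n^'m) \<Rightarrow> (real^'n) set \<Rightarrow> bool" where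
  "has_weak_jacobian u G \<Omega> \<longleftrightarrow> (\<forall>i. has_weak_gradient (\<lambda>x. u x $ i) (\<lambda>x. G x $ i) \<Omega>)"

definition W1p_loc :: "ereal \<Rightarrow> (real^'n) set \<Rightarrow> (real^'n \<Rightarrow> real) set" where
  "W1p_loc p \<Omega> = {f \<in> Lp_loc p \<Omega>. \<exists>g \<in> Lp_loc p \<Omega>. has_weak_gradient f g \<Omega>}"

definition W1p_loc_vec :: "ereal \<Rightarrow> (real^'n) set \<Rightarrow> (real^'n \<Rightarrow> real^'m) set" where
  "W1p_loc_vec p \<Omega> = {u \<in> Lp_loc p \<Omega>. \<exists>G \<in> Lp_loc p \<Omega>. has_weak_jacobian u G \<Omega>}"


section \<open>The equation\<close>

definition jacobian :: "(real^'n \<Rightarrow> real^'m) \<Rightarrow> real^'n \<Rightarrow> real^'n^'m" where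
  "jacobian \<zeta> x = matrix (frechet_derivative \<zeta> (at x))"

text \<open>Weak solutions of $\mathrm{div}\,(h(\det Du)\,\mathrm{cof}\,Du) = 0$ in \<open>\<Omega>\<close>. The weak Jacobian
  is unique up to null sets, so the choice of its representative \<open>Du\<close> is immaterial.\<close>

definition weak_solution ::
  "(real \<Rightarrow> real) \<Rightarrow> (real^'n) set \<Rightarrow> (real^'n \<Rightarrow> real^'n) \<Rightarrow> bool" where
  "weak_solution h \<Omega> u \<longleftrightarrow> u \<in> W1p_loc_vec 1 \<Omega> \<and>
     (\<exists>Du. has_weak_jacobian u Du \<Omega> \<and>
        (\<lambda>x. h (det (Du x)) *\<^sub>R cof (Du x)) \<in> Lp_loc 1 \<Omega> \<and>
        (\<forall>\<zeta>\<in>C1c \<Omega>. (LINT x|lebesgue_on \<Omega>. (h (det (Du x)) *\<^sub>R cof (Du x)) \<bullet> jacobian \<zeta> x) = 0))"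

text \<open>The exponent \<open>p / (p + 1 - n)\<close>, with its two conventional values.\<close>

definition pbar :: "nat \<Rightarrow> ereal \<Rightarrow> ereal" where
  "pbar n p = (if p = \<infinity> then 1
               else if p = ereal (real n - 1) then \<infinity>
               else p / (p + 1 - ereal (real n)))"

end

theory Submission
  imports Defs
begin

text \<open>Write \<open>f = h (det Du)\<close> and let \<open>g\<close> be the weak gradient of \<open>f\<close>. By the Piola identity the rows of
  \<open>cof Du\<close> are divergence free, so the product rule turns the equation $\mathrm{div}\,(f\,\mathrm{cof}\,Du) = 0$
  into \<open>cof Du *v g = 0\<close>. Multiplying by the transpose of \<open>Du\<close> gives \<open>det Du *\<^sub>R g = 0\<close>, that is,
  \<open>g = 0\<close> wherever \<open>det Du\<close> does not vanish. Where \<open>det Du\<close> vanishes, \<open>f\<close> takes the single value \<open>h 0\<close>, and the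
  weak gradient of a Sobolev function is zero almost everywhere on each of its level sets. So
  \<open>g = 0\<close> almost everywhere, and \<open>f\<close> is constant because \<open>\<Omega>\<close> is connected.

  Each step is justified by mollification. For smooth functions the Piola identity says that the
  integral of a determinant of gradients is zero if one of the functions has compact support
  (\<open>integral_det_gradients_eq_0\<close>); \<open>weak_piola\<close> carries this over to \<open>u\<close>. Testing it with
  \<open>f\<^sub>r \<zeta>\<close>, where \<open>f\<^sub>r\<close> is a mollification of \<open>f\<close> and \<open>\<zeta>\<close> a test function, and letting \<open>r\<close> tend to \<open>0\<close> gives the
  product rule \<open>div_free_weak_product\<close>. The statement about level sets is
  \<open>weak_gradient_level_set\<close>, and functions with zero weak gradient are treated in
  \<open>weak_gradient_0_constant\<close>.

  Mollifications are removed from integral identities by \<open>mollify_limit\<close>, which only uses convergence in $L^1$. An integrand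
  built from a mollification \<open>m\<^sub>r\<close> is bounded by the mollification of an integrable function plus a fixed integrable function
  (by Jensen's inequality for the cofactors, by Young's inequality for products), and such bounds
  converge in $L^1$ as well, so a dominated convergence theorem with a varying dominating function
  applies. For the products this requires an estimate \<open>norm (\<Phi> y) * norm (V x) \<le> F y + H x\<close> at two
  \<^emph>\<open>different\<close> points. It holds because the exponent $\bar p$ of \<open>f\<close> and \<open>g\<close> is conjugate to the exponent
  $p/(n-1)$ of \<open>cof Du\<close>, and it has the same form in the borderline cases $p = n-1$ and
  $p = \infty$ (\<open>locally_dominated_conjugate\<close>).\<close>

section \<open>Smooth functions\<close>

definition smooth :: "('a::real_normed_vector \<Rightarrow> 'b::real_normed_vector) \<Rightarrow> bool" where
  "smooth f \<longleftrightarrow> (\<forall>n. Ck n f)"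

abbreviation dir_deriv :: "('a::real_normed_vector \<Rightarrow> 'b::real_normed_vector) \<Rightarrow> 'a \<Rightarrow> 'a \<Rightarrow> 'b" where
  "dir_deriv f v \<equiv> (\<lambda>x. frechet_derivative f (at x) v)"

lemma dir_deriv_eq: "(f has_derivative f') (at x) \<Longrightarrow> dir_deriv f v x = f' v"
  by (metis frechet_derivative_at)

lemma Ck_SucI:
  assumes "\<And>x. (f has_derivative f' x) (at x)" "\<And>v. Ck n (\<lambda>x. f' x v)"
  shows "Ck (Suc n) f"
proof -
  have "frechet_derivative f (at x) = f' x" for x
    using assms(1) by (metis frechet_derivative_at)
  then show ?thesis
    using assms by (auto simp: differentiable_def)
qed

lemma Ck_has_derivative:
  "Ck (Suc n) f \<Longrightarrow> (f has_derivative frechet_derivative f (at x)) (at x)"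
  by (simp add: frechet_derivative_works[symmetric])

lemma Ck_SucD: "Ck (Suc n) f \<Longrightarrow> Ck n f"
proof (induction n arbitrary: f)
  case 0
  then show ?case
    by (auto intro!: continuous_at_imp_continuous_on differentiable_imp_continuous_within)
qed auto

lemma Ck_const: "Ck n (\<lambda>x. c)"
proof (induction n arbitrary: c)
  case (Suc n)
  show ?case
    by (rule Ck_SucI[where f' = "\<lambda>_ _. 0"]) (auto intro!: derivative_eq_intros Suc)
qed simp

lemma Ck_add: "Ck n f \<Longrightarrow> Ck n g \<Longrightarrow> Ck n (\<lambda>x. f x + g x)"
proof (induction n arbitrary: f g)
  case (Suc n)
  show ?case
    by (rule Ck_SucI[OF has_derivative_add[OF Ck_has_derivative Ck_has_derivative]])
       (use Suc in auto)
qed (auto intro!: continuous_intros)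

lemma Ck_scaleR: "Ck n f \<Longrightarrow> Ck n g \<Longrightarrow> Ck n (\<lambda>x. f x *\<^sub>R g x)"
proof (induction n arbitrary: f g)
  case (Suc n)
  show ?case
    by (rule Ck_SucI[OF has_derivative_scaleR[OF Ck_has_derivative Ck_has_derivative]])
       (use Suc.prems in \<open>auto intro!: Ck_add Suc.IH Ck_SucD[OF Suc.prems(1)] Ck_SucD[OF Suc.prems(2)] simp del: Ck.simps(2), simp_all\<close>)
qed (auto intro!: continuous_intros)

lemma Ck_bounded_linear:
  assumes L: "bounded_linear L"
  shows "Ck n f \<Longrightarrow> Ck n (\<lambda>x. L (f x))"
proof (induction n arbitrary: f)
  case 0
  then show ?case
    by (auto intro!: bounded_linear.continuous_on[OF L])
next
  case (Suc n)
  show ?case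
    by (rule Ck_SucI[OF bounded_linear.has_derivative[OF L Ck_has_derivative]])
       (use Suc in auto)
qed

lemma Ck_reflect: "Ck n f \<Longrightarrow> Ck n (\<lambda>x. f (c - x))"
proof (induction n arbitrary: f)
  case 0
  then show ?case
    by (auto intro!: continuous_on_compose2[OF _ _ subset_UNIV, where g = f] continuous_intros)
next
  case (Suc n)
  show ?case
  proof (rule Ck_SucI)
    fix x
    have "((\<lambda>x. c - x) has_derivative (\<lambda>v. - v)) (at x)"
      by (auto intro!: derivative_eq_intros)
    from has_derivative_compose[OF this Ck_has_derivative[OF Suc.prems]]
    show "((\<lambda>x. f (c - x)) has_derivative (\<lambda>v. dir_deriv f (- v) (c - x))) (at x)" .
  qed (use Suc in auto)
qed

lemma smooth_has_derivative:
  "smooth f \<Longrightarrow> (f has_derivative frechet_derivative f (at x)) (at x)"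
  unfolding smooth_def by (metis Ck_has_derivative)

lemma smooth_dir_deriv: "smooth f \<Longrightarrow> smooth (dir_deriv f v)"
  unfolding smooth_def by (metis Ck.simps(2))

lemma smooth_continuous: "smooth f \<Longrightarrow> continuous_on UNIV f"
  unfolding smooth_def by (metis Ck.simps(1))

lemma smooth_const: "smooth (\<lambda>x. c)"
  by (simp add: smooth_def Ck_const)

lemma smooth_scaleR: "smooth f \<Longrightarrow> smooth g \<Longrightarrow> smooth (\<lambda>x. f x *\<^sub>R g x)"
  by (simp add: smooth_def Ck_scaleR)

lemma smooth_mult: "smooth f \<Longrightarrow> smooth g \<Longrightarrow> smooth (\<lambda>x. f x * g x :: real)"
  using smooth_scaleR[of f g] by simp

lemma smooth_reflect: "smooth f \<Longrightarrow> smooth (\<lambda>x. f (c - x))"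
  by (simp add: smooth_def Ck_reflect)

lemma Cinfc_iff: "\<phi> \<in> Cinfc \<Omega> \<longleftrightarrow> smooth \<phi> \<and> compact_support_in \<Omega> \<phi>"
  by (simp add: Cinfc_def smooth_def)

section \<open>The standard bump\<close>

text \<open>The powers of \<open>t\<close> in the denominator make the family closed under differentiation, so that smoothness
  can be proved for all \<open>k\<close> at once by induction on the order of the derivative.\<close>

definition flat :: "nat \<Rightarrow> real \<Rightarrow> real" where
  "flat k t = (if t > 0 then exp (- 1 / t) / t ^ k else 0)"

lemma flat_tendsto_0: "(flat k \<longlongrightarrow> 0) (at 0)"
proof -
  have "((\<lambda>t. inverse t ^ k / exp (inverse t)) \<longlongrightarrow> (0::real)) (at_right 0)"
    by (rule filterlim_compose[OF tendsto_power_div_exp_0 filterlim_inverse_at_top_right])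
  moreover have "\<forall>\<^sub>F t in at_right 0. inverse t ^ k / exp (inverse t) = flat k t"
    using eventually_at_right_less[of 0]
    by eventually_elim (auto simp: flat_def field_simps exp_minus)
  ultimately have right: "(flat k \<longlongrightarrow> 0) (at_right 0)"
    by (rule Lim_transform_eventually)
  have "\<forall>\<^sub>F t in at_left 0. flat k t = 0"
    unfolding eventually_at_filter by (auto simp: flat_def)
  then have "(flat k \<longlongrightarrow> 0) (at_left 0)"
    by (rule tendsto_eventually)
  with right show ?thesis
    by (simp add: filterlim_split_at)
qed

lemma flat_has_derivative:
  "(flat k has_real_derivative flat (k + 2) t - real k * flat (k + 1) t) (at t)"
proof -
  consider "t > 0" | "t < 0" | "t = 0" by linarith
  then show ?thesis
  proof cases
    case 1
    have 1: "((\<lambda>t. exp (- 1 / t) / t ^ k) has_real_derivative flat (k + 2) t - real k * flat (k + 1) t) (at t)"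
      using \<open>t > 0\<close> by (auto intro!: derivative_eq_intros simp: flat_def field_simps power2_eq_square)
        (cases k; simp add: field_simps)
    have 2: "\<forall>\<^sub>F s in nhds t. flat k s = exp (- 1 / s) / s ^ k"
      using eventually_nhds_in_open[of "{0<..}" t] \<open>t > 0\<close>
      by (auto elim!: eventually_mono simp: flat_def)
    show ?thesis
      using DERIV_cong_ev[OF refl 2 refl] 1 by blast
  next
    case 2
    have "\<forall>\<^sub>F s in nhds t. flat k s = 0"
      using eventually_nhds_in_open[of "{..<0}" t] 2
      by (auto elim!: eventually_mono simp: flat_def)
    then have "(flat k has_real_derivative 0) (at t)"
      using DERIV_cong_ev[OF refl _ refl, of "flat k" "\<lambda>_. 0" t 0] by simp
    then show ?thesis using 2 by (simp add: flat_def)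
  next
    case 3
    have "(\<lambda>h. flat k h / h) = flat (k + 1)"
      by (auto simp: flat_def fun_eq_iff)
    then show ?thesis
      using flat_tendsto_0[of "k+1"] 3 by (simp add: DERIV_def flat_def)
  qed
qed

definition bump :: "nat \<Rightarrow> real \<Rightarrow> 'a::euclidean_space \<Rightarrow> real" where
  "bump k r x = flat k (r\<^sup>2 - (norm x)\<^sup>2)"

text \<open>By induction this makes every \<open>bump k r\<close> smooth, as the derivative lies in the span of the products of
  other bumps with linear functions.\<close>

lemma bump_has_derivative:
  "(bump k r has_derivative (\<lambda>v. (bump (k + 2) r x - real k * bump (k + 1) r x) * (- 2 * (x \<bullet> v)))) (at x)"
proof -
  have "((\<lambda>x. r\<^sup>2 - (norm x)\<^sup>2) has_derivative (\<lambda>v. - 2 * (x \<bullet> v))) (at x)"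
    unfolding power2_norm_eq_inner by (auto intro!: derivative_eq_intros simp: inner_commute)
  from has_derivative_compose[OF this flat_has_derivative[unfolded has_field_derivative_def]]
  show ?thesis
    unfolding bump_def .
qed

lemma smooth_bump: "smooth (bump k r :: 'a::euclidean_space \<Rightarrow> real)"
proof -
  have "Ck n (bump k r :: 'a \<Rightarrow> real)" for n
  proof (induction n arbitrary: k)
    case 0
    then show ?case
      using bump_has_derivative
      by (auto intro!: continuous_at_imp_continuous_on has_derivative_continuous)
  next
    case (Suc n)
    have id: "Ck n (\<lambda>x::'a. x)" 
      by (cases n) (auto intro!: Ck_SucI[where f' = "\<lambda>_ v. v"] Ck_const)
    show ?case
    proof (rule Ck_SucI[OF bump_has_derivative])
      fix v :: 'a
      have 1: "Ck n (\<lambda>x::'a. bump (k + 2) r x + (- real k) *\<^sub>R bump (k + 1) r x)"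
        by (intro Ck_add Ck_scaleR Ck_const Suc)
      have 2: "Ck n (\<lambda>x::'a. - 2 * (x \<bullet> v))"
        by (rule Ck_bounded_linear[OF _ id])
           (intro bounded_linear_const_mult bounded_linear_inner_left)
      show "Ck n (\<lambda>x. (bump (k + 2) r x - real k * bump (k + 1) r x) * (- 2 * (x \<bullet> v)))"
        using Ck_scaleR[OF 1 2] by simp
    qed
  qed
  then show ?thesis by (simp add: smooth_def)
qed

text \<open>The second derivative is computed explicitly. Schwarz's theorem is only ever needed for
  mollifications, whose derivatives fall on the kernel, and hence only for this function.\<close>

lemma bump_second_derivative_symmetric: "dir_deriv (dir_deriv (bump k r) v) w x = dir_deriv (dir_deriv (bump k r) w) v x"
proof -
  have D: "dir_deriv (bump k r) v = (\<lambda>x. (bump (k + 2) r x - real k * bump (k + 1) r x) * (- 2 * (x \<bullet> v)))"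
    for v :: 'a and k
    by (rule ext) (rule dir_deriv_eq[OF bump_has_derivative])
  have "dir_deriv (dir_deriv (bump k r) v) w x = (bump (k + 4) r x - real (k+2) * bump (k + 3) r x
      - real k * (bump (k + 3) r x - real (k + 1) * bump (k + 2) r x)) * (4 * (x \<bullet> v) * (x \<bullet> w))
      + (bump (k + 2) r x - real k * bump (k + 1) r x) * (- 2 * (w \<bullet> v))" for v w
    unfolding D
    by (rule dir_deriv_eq)
       (auto intro!: derivative_eq_intros bump_has_derivative simp: algebra_simps numeral_eq_Suc)
  then show ?thesis
    by (simp only: inner_commute[of v w] mult.assoc mult.commute[of "x \<bullet> v"])
qed

lemma bump_nonneg: "bump k r x \<ge> 0"
  by (simp add: bump_def flat_def)

lemma bump_eq_0:
  assumes "r \<ge> 0" "norm x \<ge> r"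
  shows "bump k r x = 0"
  using power_mono[OF assms(2,1), of 2] by (simp add: bump_def flat_def)

lemma bump_pos: "r > 0 \<Longrightarrow> norm x < r \<Longrightarrow> bump k r x > 0"
  by (simp add: bump_def flat_def power_strict_mono)

section \<open>Density of continuous functions in $L^1$\<close>

lemma continuous_borel_measurable_lebesgue:
  "continuous_on UNIV f \<Longrightarrow> f \<in> borel_measurable lebesgue"
  by (intro measurable_completion) (auto intro: borel_measurable_continuous_onI)

text \<open>For the indicator of a set of finite measure, squeeze the set between a closed and an open set of almost
  the same measure and take an Urysohn function; the general case follows by linearity and dominated convergence.\<close>

lemma L1_dense_continuous:
  fixes f :: "'a::euclidean_space \<Rightarrow> 'b::euclidean_space"
  assumes "integrable lebesgue f"
  shows "\<forall>e>0. \<exists>g. continuous_on UNIV g \<and> integrable lebesgue g \<and> (LINT x|lebesgue. norm (f x - g x)) < e"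
  using assms
proof (induction f rule: integrable_induct)
  case (base A c)
  show ?case
  proof (intro allI impI)
    fix e :: real assume "e > 0"
    \<comment> \<open>the open and the closed set may together differ by measure \<open>2 * d\<close>, on which the error is at most \<open>norm c\<close>\<close>
    define d where "d = e / (norm c + 1) / 2"
    have "d > 0" using \<open>e > 0\<close> by (simp add: d_def add_nonneg_pos)
    obtain T where T: "closed T" "T \<subseteq> A" "A - T \<in> lmeasurable" "emeasure lebesgue (A - T) < ennreal d"
      using sets_lebesgue_inner_closed[OF base(1) \<open>d > 0\<close>] by metis
    obtain U where U: "open U" "A \<subseteq> U" "U - A \<in> lmeasurable" "emeasure lebesgue (U - A) < ennreal d"
      using sets_lebesgue_outer_open[OF base(1) \<open>d > 0\<close>] by metis
    obtain g where g: "continuous_on UNIV g" "\<And>x. g x \<in> closed_segment c 0"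
        "\<And>x. x \<in> T \<Longrightarrow> g x = c" "\<And>x. x \<in> - U \<Longrightarrow> g x = 0"
      using Urysohn[of T "- U" c 0] T U by (metis closed_Compl disjoint_eq_subset_Compl double_compl order_trans)
    have [measurable]: "g \<in> borel_measurable lebesgue"
      using g(1) by (rule continuous_borel_measurable_lebesgue)
    have seg: "norm (g x) \<le> norm c" "norm (c - g x) \<le> norm c" for x
      using segment_bound[OF g(2)[of x]] by (auto simp: norm_minus_commute)
    have "A \<in> lmeasurable" using base by (auto simp: fmeasurable_def)
    have "U = A \<union> (U - A)" using U by auto
    with \<open>A \<in> lmeasurable\<close> U(3) have Um: "U \<in> lmeasurable" by (metis fmeasurable.Un)
    have Tm: "U - T \<in> lmeasurable"
    proof -
      have "U - T = (U - A) \<union> (A - T)" using T U by auto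
      then show ?thesis using fmeasurable.Un[OF U(3) T(3)] by simp
    qed
    have gi: "integrable lebesgue g"
    proof (rule Bochner_Integration.integrable_bound)
      show "integrable lebesgue (\<lambda>x. indicator U x *\<^sub>R norm c)"
        using Um by (auto simp: fmeasurable_def)
      show "AE x in lebesgue. norm (g x) \<le> norm (indicator U x *\<^sub>R norm c)"
        using seg g(4) by (intro AE_I2) (auto simp: indicator_def)
    qed simp
    have mlt: "measure lebesgue X < d" if "X \<in> lmeasurable" "emeasure lebesgue X < ennreal d" for X :: "'a set"
      using that by (simp add: emeasure_eq_measure2 ennreal_less_iff)
    have "measure lebesgue (U - T) \<le> measure lebesgue (U - A) + measure lebesgue (A - T)"
    proof -
      have "U - T = (U - A) \<union> (A - T)" using T U by auto
      then show ?thesis by (simp add: measure_Un_le T U fmeasurableD)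
    qed
    also have "\<dots> < d + d"
      using mlt[OF T(3,4)] mlt[OF U(3,4)] by linarith
    finally have m: "measure lebesgue (U - T) < e / (norm c + 1)" by (simp only: d_def field_sum_of_halves)
    have "(LINT x|lebesgue. norm (indicator A x *\<^sub>R c - g x)) \<le> (LINT x|lebesgue. indicator (U - T) x *\<^sub>R norm c)"
    proof (rule integral_mono)
      show "integrable lebesgue (\<lambda>x. norm (indicator A x *\<^sub>R c - g x))"
        using gi \<open>A \<in> lmeasurable\<close> by (auto simp: fmeasurable_def)
      show "integrable lebesgue (\<lambda>x. indicator (U - T) x *\<^sub>R norm c)"
        using Tm by (auto simp: fmeasurable_def)
      show "norm (indicator A x *\<^sub>R c - g x) \<le> indicator (U - T) x *\<^sub>R norm c" for x
        using seg[of x] g(3,4)[of x] T(2) U(2) by (auto simp: indicator_def)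
    qed
    also have "\<dots> = measure lebesgue (U - T) * norm c"
      by simp
    also have "\<dots> \<le> (e / (norm c + 1)) * norm c"
      using m by (intro mult_right_mono) auto
    also have "\<dots> < e"
      using \<open>e > 0\<close> by (simp add: pos_divide_less_eq add_nonneg_pos distrib_left)
    finally show "\<exists>g. continuous_on UNIV g \<and> integrable lebesgue g
        \<and> (LINT x|lebesgue. norm (indicator A x *\<^sub>R c - g x)) < e"
      using g(1) gi by blast
  qed
next
  case (add f1 f2)
  show ?case
  proof (intro allI impI)
    fix e :: real assume "e > 0"
    then have "e / 2 > 0" by simp
    then obtain g1 g2 where g: "continuous_on UNIV g1" "integrable lebesgue g1" "(LINT x|lebesgue. norm (f1 x - g1 x)) < e/2"
      "continuous_on UNIV g2" "integrable lebesgue g2" "(LINT x|lebesgue. norm (f2 x - g2 x)) < e/2"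
      using add.IH by meson
    have "(LINT x|lebesgue. norm (f1 x + f2 x - (g1 x + g2 x)))
        \<le> (LINT x|lebesgue. norm (f1 x - g1 x) + norm (f2 x - g2 x))"
      using add g by (intro integral_mono) (auto intro!: norm_diff_triangle_ineq)
    also have "\<dots> < e" using add g by simp
    finally show "\<exists>g. continuous_on UNIV g \<and> integrable lebesgue g
        \<and> (LINT x|lebesgue. norm (f1 x + f2 x - g x)) < e"
      using g by (intro exI[of _ "\<lambda>x. g1 x + g2 x"]) (auto intro!: continuous_intros)
  qed
next
  case (lim f s)
  show ?case
  proof (intro allI impI)
    fix e :: real assume "e > 0"
    have "(\<lambda>i. LINT x|lebesgue. norm (f x - s i x)) \<longlonglongrightarrow> integral\<^sup>L (lebesgue :: 'a measure) (\<lambda>_. 0 :: real)"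
    proof (rule integral_dominated_convergence[where w = "\<lambda>x. 3 * norm (f x)" and M = lebesgue])
      show "AE x in lebesgue. (\<lambda>i. norm (f x - s i x)) \<longlonglongrightarrow> 0"
      proof (rule AE_I2)
        fix x :: 'a assume "x \<in> space lebesgue"
        then have "(\<lambda>i. f x - s i x) \<longlonglongrightarrow> f x - f x"
          by (intro tendsto_diff tendsto_const lim.hyps(2))
        then show "(\<lambda>i. norm (f x - s i x)) \<longlonglongrightarrow> 0"
          by (auto intro: tendsto_norm_zero)
      qed
      show "AE x in lebesgue. norm (norm (f x - s i x)) \<le> 3 * norm (f x)" for i
      proof (rule AE_I2)
        fix x :: 'a assume "x \<in> space lebesgue"
        then show "norm (norm (f x - s i x)) \<le> 3 * norm (f x)"
          using lim.hyps(3)[of x i] norm_triangle_ineq4[of "f x" "s i x"] by simp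
      qed
    qed (use lim in auto)
    then have "\<forall>\<^sub>F i in sequentially. (LINT x|lebesgue. norm (f x - s i x)) < e / 2"
      using \<open>e > 0\<close> by (intro order_tendstoD(2)[where y = 0]) auto
    then obtain i where i: "(LINT x|lebesgue. norm (f x - s i x)) < e / 2"
      by (auto simp: eventually_sequentially)
    obtain g where g: "continuous_on UNIV g" "integrable lebesgue g" "(LINT x|lebesgue. norm (s i x - g x)) < e / 2"
      using lim.IH[of i] \<open>e > 0\<close> by (meson half_gt_zero)
    have "(LINT x|lebesgue. norm (f x - g x)) \<le> (LINT x|lebesgue. norm (f x - s i x) + norm (s i x - g x))"
      using lim g by (intro integral_mono) (auto intro!: norm_diff_triangle_le)
    also have "\<dots> < e" using lim g i by simp
    finally show "\<exists>g. continuous_on UNIV g \<and> integrable lebesgue g \<and> (LINT x|lebesgue. norm (f x - g x)) < e"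
      using g by blast
  qed
qed

section \<open>Convolution with a smooth kernel\<close>

definition kernel :: "real \<Rightarrow> ('a::euclidean_space \<Rightarrow> real) \<Rightarrow> bool" where
  "kernel R \<rho> \<longleftrightarrow> smooth \<rho> \<and> (\<forall>x. norm x > R \<longrightarrow> \<rho> x = 0)"

definition conv :: "('a::euclidean_space \<Rightarrow> real) \<Rightarrow> ('a \<Rightarrow> 'b::euclidean_space) \<Rightarrow> 'a \<Rightarrow> 'b" where
  "conv \<rho> f x = (LINT y|lebesgue. \<rho> (x - y) *\<^sub>R f y)"

lemma dir_deriv_eq_0_open:
  assumes "open S" "x \<in> S" "\<And>y. y \<in> S \<Longrightarrow> f y = 0"
  shows "dir_deriv f v x = 0"
proof -
  have "(f has_derivative (\<lambda>v. 0)) (at x)"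
    by (rule has_derivative_transform_within_open[OF has_derivative_const[of 0] assms(1,2)])
       (use assms(3) in auto)
  then show ?thesis by (rule dir_deriv_eq)
qed

lemma kernel_dir_deriv: "kernel R \<rho> \<Longrightarrow> kernel R (dir_deriv \<rho> v)"
proof -
  assume k: "kernel R \<rho>"
  have "dir_deriv \<rho> v x = 0" if "norm x > R" for x
  proof (rule dir_deriv_eq_0_open)
    show "open (- cball 0 R)" by auto
  qed (use k that in \<open>auto simp: kernel_def\<close>)
  then show ?thesis using k by (auto simp: kernel_def smooth_dir_deriv)
qed

lemma kernel_bounded:
  assumes "kernel R \<rho>"
  obtains B where "B \<ge> 0" "\<And>x. \<bar>\<rho> x\<bar> \<le> B"
proof -
  have "compact (\<rho> ` cball 0 R)"
    using assms by (intro compact_continuous_image continuous_on_subset[OF smooth_continuous]) (auto simp: kernel_def)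
  then obtain B where B: "\<forall>y\<in>\<rho> ` cball 0 R. norm y \<le> B"
    by (meson bounded_iff compact_imp_bounded)
  have "\<bar>\<rho> x\<bar> \<le> max B 0" for x
    using B assms by (cases "norm x \<le> R") (force simp: kernel_def intro: max.coboundedI1)+
  then show ?thesis using that[of "max B 0"] by auto
qed

lemma directional_mvt:
  fixes f :: "'a::euclidean_space \<Rightarrow> real"
  assumes "\<And>x. (f has_derivative f' x) (at x)"
  shows "\<exists>t. 0 < t \<and> t < 1 \<and> f (z + h) - f z = f' (z + t *\<^sub>R h) h"
proof -
  have "((\<lambda>t. f (z + t *\<^sub>R h)) has_real_derivative f' (z + t *\<^sub>R h) h) (at t)" for t :: real
  proof -
    have "((\<lambda>t. z + t *\<^sub>R h) has_derivative (\<lambda>t. t *\<^sub>R h)) (at t)"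
      by (auto intro!: derivative_eq_intros)
    from has_derivative_compose[OF this assms]
    have "((\<lambda>t. f (z + t *\<^sub>R h)) has_derivative (\<lambda>s. f' (z + t *\<^sub>R h) (s *\<^sub>R h))) (at t)" .
    moreover have "linear (f' (z + t *\<^sub>R h))"
      using assms has_derivative_linear by blast
    ultimately show ?thesis
      by (simp add: has_field_derivative_def linear_cmul mult_commute_abs)
  qed
  from MVT2[of 0 1 "\<lambda>t. f (z + t *\<^sub>R h)", OF _ this] show ?thesis by auto
qed

text \<open>Reduces bounds in all directions to the finitely many basis directions.\<close>

lemma linear_euclidean_expand:
  fixes v :: "'a::euclidean_space"
  shows "linear L \<Longrightarrow> L v = (\<Sum>b\<in>Basis. (v \<bullet> b) *\<^sub>R L b)"
  by (subst euclidean_representation[of v, symmetric]) (simp add: linear_sum linear_cmul)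

lemma kernel_dir_deriv_bounded:
  assumes "kernel R \<rho>"
  obtains B where "B \<ge> 0" "\<And>x v. \<bar>dir_deriv \<rho> v x\<bar> \<le> B * norm v"
proof -
  have "\<exists>B. B \<ge> 0 \<and> (\<forall>x. \<bar>dir_deriv \<rho> b x\<bar> \<le> B)" for b
    by (metis kernel_bounded[OF kernel_dir_deriv[OF assms]])
  then obtain B where B: "\<And>b. B b \<ge> 0" "\<And>b x. \<bar>dir_deriv \<rho> b x\<bar> \<le> B b" by metis
  have "\<bar>dir_deriv \<rho> v x\<bar> \<le> sum B Basis * norm v" for x v
  proof -
    have "linear (frechet_derivative \<rho> (at x))"
      using assms by (auto simp: kernel_def intro: has_derivative_linear smooth_has_derivative)
    then have "\<bar>dir_deriv \<rho> v x\<bar> = \<bar>\<Sum>b\<in>Basis. (v \<bullet> b) *\<^sub>R dir_deriv \<rho> b x\<bar>"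
      by (subst linear_euclidean_expand[of _ v]) auto
    also have "\<dots> \<le> (\<Sum>b\<in>Basis. norm v * B b)"
      by (intro order_trans[OF sum_abs] sum_mono) (auto simp: abs_mult intro!: mult_mono B Basis_le_norm)
    finally show ?thesis by (simp add: sum_distrib_left mult.commute)
  qed
  then show ?thesis using that[of "sum B Basis"] B by (auto simp: sum_nonneg)
qed

text \<open>A quadratic remainder that is uniform in the base point allows differentiation under the integral sign
  against an arbitrary integrable function.\<close>

lemma kernel_taylor:
  assumes k: "kernel R \<rho>"
  obtains L where "L \<ge> 0" "\<And>z h. \<bar>\<rho> (z + h) - \<rho> z - dir_deriv \<rho> h z\<bar> \<le> L * (norm h)\<^sup>2"
proof -
  have "\<exists>B. B \<ge> 0 \<and> (\<forall>x v. \<bar>dir_deriv (dir_deriv \<rho> b) v x\<bar> \<le> B * norm v)" for b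
    by (metis kernel_dir_deriv_bounded[OF kernel_dir_deriv[OF k]])
  then obtain B where B: "\<And>b. B b \<ge> 0" "\<And>b x v. \<bar>dir_deriv (dir_deriv \<rho> b) v x\<bar> \<le> B b * norm v" by metis
  have sm: "smooth \<rho>" using k by (simp add: kernel_def)
  have lin: "linear (frechet_derivative \<rho> (at x))" for x
    using sm by (auto intro: has_derivative_linear smooth_has_derivative)
  have "\<bar>\<rho> (z + h) - \<rho> z - dir_deriv \<rho> h z\<bar> \<le> sum B Basis * (norm h)\<^sup>2" for z h
  proof -
    obtain t where t: "0 < t" "t < 1" "\<rho> (z + h) - \<rho> z = dir_deriv \<rho> h (z + t *\<^sub>R h)"
      using directional_mvt[OF smooth_has_derivative[OF sm]] by blast
    have *: "\<bar>dir_deriv \<rho> b (z + t *\<^sub>R h) - dir_deriv \<rho> b z\<bar> \<le> B b * norm h" for b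
    proof -
      obtain s where "dir_deriv \<rho> b (z + t *\<^sub>R h) - dir_deriv \<rho> b z = dir_deriv (dir_deriv \<rho> b) (t *\<^sub>R h) (z + s *\<^sub>R t *\<^sub>R h)"
        using directional_mvt[OF smooth_has_derivative[OF smooth_dir_deriv[OF sm]]] by blast
      then have "\<bar>dir_deriv \<rho> b (z + t *\<^sub>R h) - dir_deriv \<rho> b z\<bar> \<le> B b * norm (t *\<^sub>R h)"
        using B(2) by metis
      also have "\<dots> \<le> B b * norm h"
        using t B(1) by (intro mult_left_mono) (auto simp: mult_left_le_one_le)
      finally show ?thesis .
    qed
    have e: "dir_deriv \<rho> h w = (\<Sum>b\<in>Basis. (h \<bullet> b) * dir_deriv \<rho> b w)" for w
      by (subst linear_euclidean_expand[OF lin]) simp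
    have "\<rho> (z + h) - \<rho> z - dir_deriv \<rho> h z = (\<Sum>b\<in>Basis. (h \<bullet> b) * (dir_deriv \<rho> b (z + t *\<^sub>R h) - dir_deriv \<rho> b z))"
      unfolding t(3) e[of "z + t *\<^sub>R h"] e[of z]
      by (simp add: algebra_simps sum_subtractf)
    also have "\<bar>\<dots>\<bar> \<le> (\<Sum>b\<in>Basis. norm h * (B b * norm h))"
      by (intro order_trans[OF sum_abs] sum_mono) (auto simp: abs_mult intro!: mult_mono * Basis_le_norm)
    finally show ?thesis by (simp add: sum_distrib_left sum_distrib_right power2_eq_square ac_simps)
  qed
  then show ?thesis using that[of "sum B Basis"] B by (auto simp: sum_nonneg)
qed

lemma integrable_kernel:
  fixes f :: "'a::euclidean_space \<Rightarrow> 'b::euclidean_space"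
  assumes k: "kernel R \<rho>" and f: "integrable lebesgue f"
  shows "integrable lebesgue (\<lambda>y. \<rho> (x - y) *\<^sub>R f y)"
proof -
  obtain B where B: "B \<ge> 0" "\<And>x. \<bar>\<rho> x\<bar> \<le> B" using kernel_bounded[OF k] by metis
  have "continuous_on UNIV (\<lambda>y. \<rho> (x - y))"
    using k by (auto simp: kernel_def intro!: smooth_continuous smooth_reflect)
  then have [measurable]: "(\<lambda>y. \<rho> (x - y)) \<in> borel_measurable lebesgue"
    by (rule continuous_borel_measurable_lebesgue)
  have [measurable]: "f \<in> borel_measurable lebesgue" using f by auto
  show ?thesis
    by (rule Bochner_Integration.integrable_bound[where f = "\<lambda>y. B *\<^sub>R f y"])
       (use B f in \<open>auto intro!: mult_right_mono\<close>)
qed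

text \<open>The derivative falls on the kernel; the error is at most the $L^1$ norm of \<open>f\<close> times the uniform
  second order remainder of the kernel.\<close>

lemma conv_has_derivative:
  assumes k: "kernel R \<rho>" and f: "integrable lebesgue f"
  shows "(conv \<rho> f has_derivative (\<lambda>v. conv (dir_deriv \<rho> v) f x)) (at x)"
proof -
  obtain L where L: "L \<ge> 0" "\<And>z h. \<bar>\<rho> (z + h) - \<rho> z - dir_deriv \<rho> h z\<bar> \<le> L * (norm h)\<^sup>2"
    using kernel_taylor[OF k] by metis
  have lin: "linear (frechet_derivative \<rho> (at x))" for x
    using k by (auto simp: kernel_def intro: has_derivative_linear smooth_has_derivative)
  note int = integrable_kernel[OF k f] integrable_kernel[OF kernel_dir_deriv[OF k] f]
  have "linear (\<lambda>v. conv (dir_deriv \<rho> v) f x)"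
    by (rule linearI)
       (simp_all add: conv_def linear_add[OF lin] linear_cmul[OF lin] scaleR_add_left int
          flip: scaleR_scaleR)
  then have bl: "bounded_linear (\<lambda>v. conv (dir_deriv \<rho> v) f x)"
    by (simp add: linear_conv_bounded_linear)
  define C where "C = L * (LINT y|lebesgue. norm (f y))"
  have "norm (conv \<rho> f (x + h) - conv \<rho> f x - conv (dir_deriv \<rho> h) f x) \<le> C * (norm h)\<^sup>2" for h
  proof -
    have eq: "conv \<rho> f (x + h) - conv \<rho> f x - conv (dir_deriv \<rho> h) f x
        = (LINT y|lebesgue. (\<rho> ((x - y) + h) - \<rho> (x - y) - dir_deriv \<rho> h (x - y)) *\<^sub>R f y)"
      unfolding conv_def by (simp add: int scaleR_diff_left algebra_simps flip: Bochner_Integration.integral_diff)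
    show ?thesis
      unfolding eq C_def
    proof (rule order_trans[OF Bochner_Integration.integral_norm_bound_integral[where g = "\<lambda>y. (L * (norm h)\<^sup>2) * norm (f y)"]])
      show "integrable lebesgue (\<lambda>y. (\<rho> ((x - y) + h) - \<rho> (x - y) - dir_deriv \<rho> h (x - y)) *\<^sub>R f y)"
        unfolding scaleR_diff_left using int(1)[of "x + h"]
        by (intro Bochner_Integration.integrable_diff int) (simp add: algebra_simps)
    qed (use L f in \<open>auto intro!: mult_right_mono\<close>)
  qed
  then have bd: "norm (norm (conv \<rho> f (x + h) - conv \<rho> f x - conv (dir_deriv \<rho> h) f x) / norm h) \<le> norm h * C" for h
    by (cases "h = 0") (auto simp: field_simps power2_eq_square)
  have "(\<lambda>h. norm (conv \<rho> f (x + h) - conv \<rho> f x - conv (dir_deriv \<rho> h) f x) / norm h) \<midarrow>0\<rightarrow> 0"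
  proof (rule Lim_null_comparison)
    show "((\<lambda>h. norm h * C) \<longlongrightarrow> 0) (at 0)"
      by (auto intro!: tendsto_eq_intros)
  qed (use bd in auto)
  then show ?thesis
    using bl by (simp add: has_derivative_at)
qed

lemma conv_dir_deriv:
  "kernel R \<rho> \<Longrightarrow> integrable lebesgue f \<Longrightarrow> dir_deriv (conv \<rho> f) v = conv (dir_deriv \<rho> v) f"
  by (rule ext) (rule dir_deriv_eq[OF conv_has_derivative])

lemma smooth_conv:
  assumes k: "kernel R \<rho>" and f: "integrable lebesgue f"
  shows "smooth (conv \<rho> f)"
proof -
  have "Ck n (conv \<rho> f)" for n using k
  proof (induction n arbitrary: \<rho>)
    case 0
    then show ?case
      by (auto intro!: continuous_at_imp_continuous_on has_derivative_continuous conv_has_derivative f)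
  next
    case (Suc n)
    show ?case
      by (rule Ck_SucI[OF conv_has_derivative[OF Suc.prems f]]) (use Suc kernel_dir_deriv in blast)
  qed
  then show ?thesis by (simp add: smooth_def)
qed

lemma conv_bounded_linear:
  assumes "kernel R \<rho>" "integrable lebesgue f" "bounded_linear L"
  shows "conv \<rho> (\<lambda>x. L (f x)) x = L (conv \<rho> f x)"
proof -
  interpret L: bounded_linear L by fact
  show ?thesis
    unfolding conv_def
    by (subst integral_bounded_linear[OF assms(3) integrable_kernel[OF assms(1,2)], symmetric])
       (simp add: L.scaleR)
qed

lemma conv_diff:
  assumes "kernel R \<rho>" "integrable lebesgue f" "integrable lebesgue g"
  shows "conv \<rho> (\<lambda>x. f x - g x) x = conv \<rho> f x - conv \<rho> g x"
  unfolding conv_def by (simp add: scaleR_diff_right integrable_kernel[OF assms(1)] assms(2,3))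

section \<open>Mollification\<close>

text \<open>Dividing by the integral normalizes each radius separately, which spares a change of variables by scaling.\<close>

definition mollifier :: "real \<Rightarrow> 'a::euclidean_space \<Rightarrow> real" where
  "mollifier r x = bump 0 r x / (LINT x|lborel. bump 0 r (x::'a))"

lemma bump_integrable: "r > 0 \<Longrightarrow> integrable lborel (bump k r :: 'a::euclidean_space \<Rightarrow> real)"
proof -
  assume "r > 0"
  then have "(\<lambda>x::'a. indicator (cball 0 r) x *\<^sub>R bump k r x) = bump k r"
    by (auto simp: fun_eq_iff indicator_def bump_eq_0)
  moreover have "integrable lborel (\<lambda>x::'a. indicator (cball 0 r) x *\<^sub>R bump k r x)"
    by (intro borel_integrable_compact continuous_on_subset[OF smooth_continuous[OF smooth_bump]]) auto
  ultimately show ?thesis by simp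
qed

lemma bump_integral_pos: "r > 0 \<Longrightarrow> (LINT x|lborel. bump k r (x::'a::euclidean_space)) > 0"
proof -
  assume r: "r > 0"
  have "(LINT x|lborel. bump k r (x::'a)) \<noteq> 0"
  proof
    assume "(LINT x|lborel. bump k r (x::'a)) = 0"
    then have "AE x in lborel. bump k r (x::'a) = 0"
      by (subst (asm) integral_nonneg_eq_0_iff_AE) (auto simp: bump_integrable[OF r] bump_nonneg)
    then have "AE x in lborel. x \<notin> ball (0::'a) r"
    proof eventually_elim
      case (elim x)
      then show ?case using bump_pos[OF r, of x k] by auto
    qed
    then have "ball (0::'a) r \<in> null_sets lborel"
      by (subst AE_iff_null_sets) auto
    then have "negligible (ball (0::'a) r)"
      using negligible_iff_null_sets null_sets_completionI by blast
    then show False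
      using open_not_negligible[of "ball (0::'a) r"] r by auto
  qed
  moreover have "(LINT x|lborel. bump k r (x::'a)) \<ge> 0"
    by (simp add: bump_nonneg)
  ultimately show ?thesis by simp
qed

lemma mollifier_nonneg: "r > 0 \<Longrightarrow> mollifier r x \<ge> 0"
  by (simp add: mollifier_def bump_nonneg less_imp_le[OF bump_integral_pos])

lemma smooth_mollifier: "smooth (mollifier r :: 'a::euclidean_space \<Rightarrow> real)"
  using smooth_scaleR[OF smooth_const[of "inverse (LINT x|lborel. bump 0 r (x::'a::euclidean_space))"] smooth_bump[of 0 r]]
  by (simp add: mollifier_def[abs_def] divide_inverse mult.commute)

lemma kernel_mollifier: "r > 0 \<Longrightarrow> kernel r (mollifier r)"
  by (simp add: kernel_def smooth_mollifier) (simp add: mollifier_def bump_eq_0)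

lemma mollifier_sym: "mollifier r (x - y) = mollifier r (y - x)"
  by (simp add: mollifier_def bump_def norm_minus_commute)

lemma mollifier_borel[measurable]: "mollifier r \<in> borel_measurable borel"
  by (intro borel_measurable_continuous_onI smooth_continuous smooth_mollifier)

lemma lborel_nn_shift:
  fixes f :: "'a::euclidean_space \<Rightarrow> ennreal"
  assumes [measurable]: "f \<in> borel_measurable borel"
  shows "(\<integral>\<^sup>+x. f (x - y) \<partial>lborel) = (\<integral>\<^sup>+x. f x \<partial>lborel)"
  by (subst (2) lborel_distr_plus[of "- y", symmetric]) (simp add: nn_integral_distr)

lemma mollifier_nn_integral: "r > 0 \<Longrightarrow> (\<integral>\<^sup>+x. ennreal (mollifier r (x - y)) \<partial>lborel) = 1"
proof -
  assume r: "r > 0"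
  have "(LINT x|lborel. mollifier r (x::'a)) = 1"
    using bump_integral_pos[OF r, where 'a='a, of 0] by (simp add: mollifier_def)
  moreover have "integrable lborel (mollifier r :: 'a \<Rightarrow> real)"
    unfolding mollifier_def[abs_def] by (intro integrable_divide bump_integrable r)
  ultimately have "(\<integral>\<^sup>+x. ennreal (mollifier r (x::'a)) \<partial>lborel) = 1"
    by (subst nn_integral_eq_integral) (auto simp: mollifier_nonneg r)
  then show ?thesis
    by (subst lborel_nn_shift) auto
qed

lemma mollifier_has_integral:
  assumes r: "r > 0"
  shows "integrable lebesgue (\<lambda>y. mollifier r (x - y))" "(LINT y|lebesgue. mollifier r (x - y)) = 1"
proof -
  have *: "(\<integral>\<^sup>+y. ennreal (mollifier r (x - y)) \<partial>lborel) = 1"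
    using mollifier_nn_integral[OF r, of x] by (simp add: mollifier_sym)
  have "integrable lborel (\<lambda>y. mollifier r (x - y))"
    by (rule integrableI_nonneg) (auto simp: mollifier_nonneg r *)
  moreover have "(LINT y|lborel. mollifier r (x - y)) = 1"
    by (subst integral_eq_nn_integral) (auto simp: mollifier_nonneg r *)
  ultimately show "integrable lebesgue (\<lambda>y. mollifier r (x - y))" "(LINT y|lebesgue. mollifier r (x - y)) = 1"
    by (simp_all add: integrable_completion integral_completion)
qed

definition mollify :: "real \<Rightarrow> ('a::euclidean_space \<Rightarrow> 'b::euclidean_space) \<Rightarrow> 'a \<Rightarrow> 'b" where
  "mollify r f = conv (mollifier r) f"

lemma smooth_mollify: "r > 0 \<Longrightarrow> integrable lebesgue f \<Longrightarrow> smooth (mollify r f)"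
  unfolding mollify_def by (rule smooth_conv[OF kernel_mollifier])

lemma mollify_integrand:
  fixes f :: "'a::euclidean_space \<Rightarrow> 'b::euclidean_space"
  shows
  "r > 0 \<Longrightarrow> integrable lebesgue f \<Longrightarrow> integrable lebesgue (\<lambda>y. mollifier r (x - y) *\<^sub>R f y)"
  by (rule integrable_kernel[OF kernel_mollifier])

lemma norm_mollify_le:
  assumes "r > 0" "integrable lebesgue f"
  shows "norm (mollify r f x) \<le> (LINT y|lebesgue. mollifier r (x - y) * norm (f y))"
  unfolding mollify_def conv_def
  by (rule order_trans[OF integral_norm_bound]) (use assms in \<open>simp add: mollifier_nonneg\<close>)

text \<open>Mollification is a contraction of $L^1$, by Tonelli's theorem. That theorem is applied to Borel functions, so
  \<open>norm \<circ> d\<close> is first replaced by a Borel function that is almost everywhere equal to it.\<close>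

lemma mollify_young:
  fixes d :: "'a::euclidean_space \<Rightarrow> 'b::euclidean_space"
  assumes r: "r > 0" and d: "integrable lebesgue d"
  shows "integrable lebesgue (mollify r d)"
    and "(LINT x|lebesgue. norm (mollify r d x)) \<le> (LINT x|lebesgue. norm (d x))"
proof -
  have [measurable]: "d \<in> borel_measurable lebesgue" using d by auto
  have m[measurable]: "mollify r d \<in> borel_measurable borel"
    by (intro borel_measurable_continuous_onI smooth_continuous smooth_mollify r d)
  have ml[measurable]: "mollify r d \<in> borel_measurable lebesgue"
    by (intro continuous_borel_measurable_lebesgue smooth_continuous smooth_mollify r d)
  obtain g where g[measurable]: "g \<in> borel_measurable lborel"
    and gd: "AE y in lborel. ennreal (norm (d y)) = g y"
    using completion_ex_borel_measurable[of "\<lambda>y. ennreal (norm (d y))" lborel] by auto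
  have [measurable]: "g \<in> borel_measurable borel" using g by simp
  have "(\<integral>\<^sup>+x. norm (mollify r d x) \<partial>lebesgue) = (\<integral>\<^sup>+x. norm (mollify r d x) \<partial>lborel)"
    by (rule nn_integral_completion)
  also have "\<dots> \<le> (\<integral>\<^sup>+x. (\<integral>\<^sup>+y. ennreal (mollifier r (x - y)) * g y \<partial>lborel) \<partial>lborel)"
  proof (rule nn_integral_mono)
    fix x :: 'a
    have "ennreal (norm (mollify r d x)) \<le> (\<integral>\<^sup>+y. norm (mollifier r (x - y) *\<^sub>R d y) \<partial>lebesgue)"
      unfolding mollify_def conv_def by (rule integral_norm_bound_ennreal[OF mollify_integrand[OF r d]])
    also have "\<dots> = (\<integral>\<^sup>+y. ennreal (mollifier r (x - y)) * g y \<partial>lebesgue)"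
      by (rule nn_integral_cong_AE, rule AE_mp[OF AE_completion[OF gd]], rule AE_I2)
         (simp add: mollifier_nonneg r ennreal_mult)
    also have "\<dots> = (\<integral>\<^sup>+y. ennreal (mollifier r (x - y)) * g y \<partial>lborel)"
      by (rule nn_integral_completion)
    finally show "ennreal (norm (mollify r d x)) \<le> (\<integral>\<^sup>+y. ennreal (mollifier r (x - y)) * g y \<partial>lborel)" .
  qed
  also have "\<dots> = (\<integral>\<^sup>+y. (\<integral>\<^sup>+x. ennreal (mollifier r (x - y)) * g y \<partial>lborel) \<partial>lborel)"
    by (rule lborel_pair.Fubini') measurable
  also have "\<dots> = (\<integral>\<^sup>+y. g y \<partial>lborel)"
    by (subst nn_integral_multc) (auto simp: mollifier_nn_integral r)
  also have "\<dots> = (\<integral>\<^sup>+y. norm (d y) \<partial>lborel)"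
    by (rule nn_integral_cong_AE) (use gd in auto)
  also have "\<dots> = (\<integral>\<^sup>+y. norm (d y) \<partial>lebesgue)"
    by (intro nn_integral_completion[symmetric])
  also have "\<dots> = ennreal (LINT x|lebesgue. norm (d x))"
    using d by (intro nn_integral_eq_integral) auto
  finally have le: "(\<integral>\<^sup>+x. norm (mollify r d x) \<partial>lebesgue) \<le> ennreal (LINT x|lebesgue. norm (d x))" .
  show i: "integrable lebesgue (mollify r d)"
    by (rule integrableI_bounded) (use le in \<open>auto intro: le_less_trans\<close>)
  have "ennreal (LINT x|lebesgue. norm (mollify r d x)) \<le> ennreal (LINT x|lebesgue. norm (d x))"
    using le i by (subst nn_integral_eq_integral[symmetric]) auto
  then show "(LINT x|lebesgue. norm (mollify r d x)) \<le> (LINT x|lebesgue. norm (d x))"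
    by (subst (asm) ennreal_le_iff) auto
qed

definition radius :: "nat \<Rightarrow> real" where "radius k = 1 / real (Suc k)"

lemma radius_pos: "radius k > 0" by (simp add: radius_def)

lemma radius_tendsto: "radius \<longlonglongrightarrow> 0"
  unfolding radius_def[abs_def] by (rule LIMSEQ_Suc[OF lim_1_over_n])

lemma radius_eventually: "e > 0 \<Longrightarrow> \<forall>\<^sub>F k in sequentially. radius k < e"
  using order_tendstoD(2)[OF radius_tendsto] .

lemma lebesgue_on_integrable: "S \<in> sets lebesgue \<Longrightarrow> integrable lebesgue f \<Longrightarrow> integrable (lebesgue_on S) f"
  for f :: "'a::euclidean_space \<Rightarrow> 'b::euclidean_space"
  by (simp add: integrable_restrict_space integrable_mult_indicator)

lemma lebesgue_on_integral_mono:
  fixes f :: "'a::euclidean_space \<Rightarrow> real"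
  assumes "S \<in> sets lebesgue" "integrable lebesgue f" "\<And>x. f x \<ge> 0"
  shows "(LINT x|lebesgue_on S. f x) \<le> (LINT x|lebesgue. f x)"
  using assms
  by (simp add: integral_restrict_space, intro integral_mono integrable_mult_indicator[where 'b=real, simplified])
     (auto simp: indicator_def)

lemma mollify_continuous_uniform:
  fixes g :: "'a::euclidean_space \<Rightarrow> 'b::euclidean_space"
  assumes g: "continuous_on UNIV g" "integrable lebesgue g" and C: "compact C" and e: "e > 0"
  shows "\<forall>\<^sub>F k in sequentially. \<forall>x\<in>C. norm (mollify (radius k) g x - g x) \<le> e"
proof -
  define D where "D = {x + y |x y. x \<in> C \<and> y \<in> cball 0 1}"
  have "compact D" unfolding D_def by (intro compact_sums C) auto
  then have "uniformly_continuous_on D g"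
    by (intro compact_uniformly_continuous continuous_on_subset[OF g(1)]) auto
  then obtain d where d: "d > 0" "\<And>x y. x \<in> D \<Longrightarrow> y \<in> D \<Longrightarrow> dist y x < d \<Longrightarrow> dist (g y) (g x) < e"
    using e unfolding uniformly_continuous_on_def by metis
  have "\<forall>\<^sub>F k in sequentially. radius k < min d 1"
    using d by (intro radius_eventually) auto
  then show ?thesis
  proof eventually_elim
    case (elim k)
    show ?case
    proof
      fix x assume x: "x \<in> C"
      have "mollify (radius k) g x - g x = (LINT y|lebesgue. mollifier (radius k) (x - y) *\<^sub>R (g y - g x))"
        unfolding scaleR_diff_right
        using mollify_integrand[OF radius_pos g(2), of k x] mollifier_has_integral[OF radius_pos, of k x]
        by (subst Bochner_Integration.integral_diff) (auto simp: mollify_def conv_def)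
      also have "norm \<dots> \<le> (LINT y|lebesgue. mollifier (radius k) (x - y) * e)"
      proof (rule Bochner_Integration.integral_norm_bound_integral)
        show "integrable lebesgue (\<lambda>y. mollifier (radius k) (x - y) *\<^sub>R (g y - g x))"
          unfolding scaleR_diff_right
          using mollify_integrand[OF radius_pos g(2), of k x] mollifier_has_integral(1)[OF radius_pos, of k x]
          by (intro Bochner_Integration.integrable_diff) auto
        show "norm (mollifier (radius k) (x - y) *\<^sub>R (g y - g x)) \<le> mollifier (radius k) (x - y) * e" for y
        proof (cases "norm (x - y) < radius k")
          case True
          have "x \<in> D" unfolding D_def using x by (intro CollectI exI[of _ x] exI[of _ 0]) auto
          moreover have "y \<in> D" unfolding D_def using x True elim
            by (intro CollectI exI[of _ x] exI[of _ "y - x"]) (auto simp: norm_minus_commute)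
          ultimately have "norm (g y - g x) \<le> e"
            using d(2)[of x y] True elim by (auto simp: dist_norm norm_minus_commute)
          then show ?thesis by (simp add: mollifier_nonneg radius_pos mult_left_mono)
        next
          case False
          then have "mollifier (radius k) (x - y) = 0"
            using less_imp_le[OF radius_pos] by (simp add: mollifier_def bump_eq_0)
          then show ?thesis by simp
        qed
      qed (use mollifier_has_integral(1)[OF radius_pos] in auto)
      also have "\<dots> = e"
        using mollifier_has_integral[OF radius_pos, of k x] by simp
      finally show "norm (mollify (radius k) g x - g x) \<le> e" .
    qed
  qed
qed

text \<open>Approximate \<open>f\<close> in $L^1$ by a continuous function, for which the mollifications converge uniformly on \<open>C\<close>; the
  error contributes at most twice its $L^1$ norm.\<close>

lemma mollify_L1:
  fixes f :: "'a::euclidean_space \<Rightarrow> 'b::euclidean_space"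
  assumes f: "integrable lebesgue f" and C: "compact C"
  shows "(\<lambda>k. LINT x|lebesgue_on C. norm (mollify (radius k) f x - f x)) \<longlonglongrightarrow> 0"
proof (rule order_tendstoI)
  fix a :: real assume "a < 0"
  then show "\<forall>\<^sub>F k in sequentially. a < (LINT x|lebesgue_on C. norm (mollify (radius k) f x - f x))"
    by (auto intro!: always_eventually less_le_trans[OF _ Bochner_Integration.integral_nonneg])
next
  fix a :: real assume a: "0 < a"
  have Cs: "C \<in> sets lebesgue" using lmeasurable_compact[OF C] by auto
  define M where "M = measure lebesgue C + 1"
  have "M > 0" unfolding M_def by (simp add: add_nonneg_pos)
  obtain g where g: "continuous_on UNIV g" "integrable lebesgue g"
      and fg: "(LINT x|lebesgue. norm (f x - g x)) < a / 3"
    using L1_dense_continuous[OF f] a by (meson divide_pos_pos zero_less_numeral)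
  \<comment> \<open>one third of \<open>a\<close> each for the approximation error, its mollification and the uniform convergence on \<open>C\<close>\<close>
  have "a / (3 * M) > 0" using a \<open>M > 0\<close> by simp
  from mollify_continuous_uniform[OF g C this]
  show "\<forall>\<^sub>F k in sequentially. (LINT x|lebesgue_on C. norm (mollify (radius k) f x - f x)) < a"
  proof eventually_elim
    case (elim k)
    define d where "d = (\<lambda>x. f x - g x)"
    have d: "integrable lebesgue d" unfolding d_def using f g by auto
    have split: "mollify (radius k) f x - f x = mollify (radius k) d x + (mollify (radius k) g x - g x) - d x" for x
      unfolding d_def mollify_def by (simp add: conv_diff[OF kernel_mollifier[OF radius_pos] f g(2)])
    have gi: "integrable (lebesgue_on C) (\<lambda>x. mollify (radius k) g x - g x)"
      by (intro lebesgue_on_integrable Cs Bochner_Integration.integrable_diff mollify_young radius_pos g)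
    have mi: "integrable (lebesgue_on C) (mollify (radius k) d)" "integrable (lebesgue_on C) d"
      by (intro lebesgue_on_integrable Cs mollify_young radius_pos d)+
    have "(LINT x|lebesgue_on C. norm (mollify (radius k) f x - f x))
        \<le> (LINT x|lebesgue_on C. norm (mollify (radius k) d x) + norm (mollify (radius k) g x - g x) + norm (d x))"
      unfolding split
      by (intro integral_mono integrable_norm Bochner_Integration.integrable_add Bochner_Integration.integrable_diff gi mi)
         (auto intro!: order_trans[OF norm_triangle_ineq4] add_right_mono norm_triangle_ineq)
    also have "\<dots> = (LINT x|lebesgue_on C. norm (mollify (radius k) d x))
        + (LINT x|lebesgue_on C. norm (mollify (radius k) g x - g x)) + (LINT x|lebesgue_on C. norm (d x))"
      using gi mi by simp
    also have "(LINT x|lebesgue_on C. norm (mollify (radius k) d x)) \<le> (LINT x|lebesgue. norm (d x))"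
      by (rule order_trans[OF lebesgue_on_integral_mono mollify_young(2)[OF radius_pos d]])
         (auto intro!: Cs mollify_young radius_pos d)
    also have "(LINT x|lebesgue_on C. norm (d x)) \<le> (LINT x|lebesgue. norm (d x))"
      by (rule lebesgue_on_integral_mono) (auto intro!: Cs d)
    also have "(LINT x|lebesgue_on C. norm (mollify (radius k) g x - g x)) \<le> (LINT x|lebesgue_on C. a / (3 * M))"
    proof (rule integral_mono)
      show "integrable (lebesgue_on C) (\<lambda>x. a / (3 * M))"
        using lmeasurable_compact[OF C] by (simp add: integrable_on_const lmeasurable_iff_integrable_on finite_measure_lebesgue_on finite_measure.integrable_const)
    qed (use elim gi in auto)
    also have "(LINT x|lebesgue_on C. a / (3 * M)) = a / (3 * M) * measure lebesgue C"
      using Cs by (simp add: measure_restrict_space)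
    also have "\<dots> < a / 3"
      using a \<open>M > 0\<close> by (simp add: M_def field_simps)
    finally show ?case using fg by (simp add: d_def)
  qed
qed

text \<open>The affine bound is averaged against the mollifier, whose integral is 1. The factor \<open>t\<close> and the constant
  \<open>s\<close> will stand for quantities that depend on \<open>x\<close> but not on the variable of integration.\<close>

lemma mollify_bound:
  assumes r: "r > 0" and f: "integrable lebesgue f" and F: "integrable lebesgue F"
    and "t \<ge> 0" and b: "AE y in lebesgue. norm (f y) * t \<le> F y + s"
  shows "norm (mollify r f x) * t \<le> mollify r F x + s"
proof -
  note i = mollify_integrand[OF r F, of x] mollifier_has_integral[OF r, of x]
  have "norm (mollify r f x) * t \<le> (LINT y|lebesgue. mollifier r (x - y) * norm (f y)) * t"
    by (intro mult_right_mono norm_mollify_le r f \<open>t \<ge> 0\<close>)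
  also have "\<dots> = (LINT y|lebesgue. mollifier r (x - y) * (norm (f y) * t))"
    by (simp flip: mult.assoc)
  also have "\<dots> \<le> (LINT y|lebesgue. mollifier r (x - y) * (F y + s))"
  proof (rule integral_mono_AE)
    show "integrable lebesgue (\<lambda>y. mollifier r (x - y) * (norm (f y) * t))"
      using mollify_integrand[OF r integrable_norm[OF f], of x] by (simp flip: mult.assoc)
    show "integrable lebesgue (\<lambda>y. mollifier r (x - y) * (F y + s))"
      using i by (simp add: distrib_left)
    show "AE y in lebesgue. mollifier r (x - y) * (norm (f y) * t) \<le> mollifier r (x - y) * (F y + s)"
      using b by eventually_elim (simp add: mult_left_mono mollifier_nonneg r)
  qed
  also have "\<dots> = mollify r F x + s"
    using i by (simp add: distrib_left mollify_def conv_def)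
  finally show ?thesis .
qed

text \<open>The power function lies above its tangent at \<open>a\<close>.\<close>

lemma power_tangent:
  fixes s a :: real
  assumes "s \<ge> 0" "a \<ge> 0" "m \<ge> 1"
  shows "a ^ m + real m * a ^ (m - 1) * (s - a) \<le> s ^ m"
proof (cases "a = 0")
  case True
  then show ?thesis using assms by (cases "m = 1") (auto simp: power_0_left)
next
  case False
  then have "a > 0" using assms by simp
  have "1 + real m * (s / a - 1) \<le> (1 + (s / a - 1)) ^ m"
    using assms \<open>a > 0\<close> by (intro Bernoulli_inequality) auto
  then have "a ^ m * (1 + real m * (s / a - 1)) \<le> a ^ m * (s / a) ^ m"
    using \<open>a > 0\<close> by (intro mult_left_mono) auto
  moreover have "a ^ m * (s / a) ^ m = s ^ m"
    using \<open>a > 0\<close> by (simp add: power_divide)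
  moreover have "a ^ m = a * a ^ (m - 1)"
    using \<open>m \<ge> 1\<close> by (metis power_eq_if not_one_le_zero)
  then have "a ^ m * (1 + real m * (s / a - 1)) = a ^ m + real m * a ^ (m - 1) * (s - a)"
    using \<open>a > 0\<close> by (simp add: field_simps)
  ultimately show ?thesis by simp
qed

text \<open>Jensen's inequality: the tangent of the power function at \<open>norm (mollify r f x)\<close> is an affine bound to which
  \<open>mollify_bound\<close> applies.\<close>

lemma mollify_jensen:
  assumes r: "r > 0" and f: "integrable lebesgue f" and m: "m \<ge> 1"
    and F: "integrable lebesgue (\<lambda>y. norm (f y) ^ m)"
  shows "norm (mollify r f x) ^ m \<le> mollify r (\<lambda>y. norm (f y) ^ m) x"
proof -
  define a where "a = norm (mollify r f x)"
  define c where "c = real m * a ^ (m - 1)"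
  have c: "c \<ge> 0" unfolding c_def a_def by simp
  have "norm (mollify r f x) * c \<le> mollify r (\<lambda>y. norm (f y) ^ m) x + (c * a - a ^ m)"
  proof (rule mollify_bound[OF r f F c], rule AE_I2)
    fix y
    show "norm (f y) * c \<le> norm (f y) ^ m + (c * a - a ^ m)"
      using power_tangent[of "norm (f y)" a m] m by (simp add: c_def a_def algebra_simps)
  qed
  then show ?thesis by (simp add: a_def mult.commute)
qed

section \<open>Passing to the limit\<close>

text \<open>Split the distance of \<open>gk k\<close> and \<open>g\<close>, which is at most \<open>wk k + w\<close>, at the height \<open>2 * w\<close>. The part below is
  dominated by \<open>2 * w\<close>, and the part above is at most \<open>wk k - w\<close>, which is small in $L^1$.\<close>

lemma generalized_dominated_convergence:
  fixes g :: "'a \<Rightarrow> real" and gk :: "nat \<Rightarrow> 'a \<Rightarrow> real"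
  assumes [measurable]: "\<And>k. gk k \<in> borel_measurable M" "g \<in> borel_measurable M"
    and wk: "\<And>k. integrable M (wk k)" and w: "integrable M w"
    and lim: "AE x in M. (\<lambda>k. gk k x) \<longlonglongrightarrow> g x" and wlim: "AE x in M. (\<lambda>k. wk k x) \<longlonglongrightarrow> w x"
    and bound: "\<And>k. AE x in M. \<bar>gk k x\<bar> \<le> wk k x"
    and L1: "(\<lambda>k. LINT x|M. \<bar>wk k x - w x\<bar>) \<longlonglongrightarrow> 0"
  shows "(\<lambda>k. LINT x|M. gk k x) \<longlonglongrightarrow> (LINT x|M. g x)"
proof -
  have [measurable]: "w \<in> borel_measurable M" "\<And>k. wk k \<in> borel_measurable M"
    using w wk by auto
  have bd: "AE x in M. \<forall>k. \<bar>gk k x\<bar> \<le> wk k x"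
    using bound by (simp add: AE_all_countable)
  have gw: "AE x in M. \<bar>g x\<bar> \<le> w x"
    using lim wlim bd
  proof eventually_elim
    case (elim x)
    then show ?case
      by (intro LIMSEQ_le[OF tendsto_rabs]) auto
  qed
  have gi: "integrable M g"
    by (rule Bochner_Integration.integrable_bound[OF w]) (use gw in auto)
  have gki: "integrable M (gk k)" for k
    by (rule Bochner_Integration.integrable_bound[OF wk[of k]]) (use bound[of k] in auto)
  have A: "(\<lambda>k. LINT x|M. min \<bar>gk k x - g x\<bar> (2 * w x)) \<longlonglongrightarrow> integral\<^sup>L M (\<lambda>_. 0 :: real)"
  proof (rule integral_dominated_convergence[where w = "\<lambda>x. 2 * \<bar>w x\<bar>"])
    show "AE x in M. (\<lambda>k. min \<bar>gk k x - g x\<bar> (2 * w x)) \<longlonglongrightarrow> 0"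
      using lim gw
    proof eventually_elim
      case (elim x)
      have "(\<lambda>k. min \<bar>gk k x - g x\<bar> (2 * w x)) \<longlonglongrightarrow> min \<bar>g x - g x\<bar> (2 * w x)"
        using elim by (intro tendsto_intros)
      then show ?case using elim by (simp add: min_def)
    qed
  qed (use w gw in auto)
  have B: "(\<lambda>k. (LINT x|M. min \<bar>gk k x - g x\<bar> (2 * w x)) + (LINT x|M. \<bar>wk k x - w x\<bar>)) \<longlonglongrightarrow> 0"
    using tendsto_add[OF A L1] by simp
  have mi: "integrable M (\<lambda>x. min \<bar>gk k x - g x\<bar> (2 * w x))" for k
    by (intro integrable_min integrable_abs Bochner_Integration.integrable_diff gki gi integrable_mult_right w)
  have "norm ((LINT x|M. gk k x) - (LINT x|M. g x))
      \<le> (LINT x|M. min \<bar>gk k x - g x\<bar> (2 * w x)) + (LINT x|M. \<bar>wk k x - w x\<bar>)" for k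
  proof -
    have "norm ((LINT x|M. gk k x) - (LINT x|M. g x)) = norm (LINT x|M. gk k x - g x)"
      by (simp add: gi gki)
    also have "\<dots> \<le> (LINT x|M. norm (gk k x - g x))"
      by (rule integral_norm_bound)
    also have "\<dots> \<le> (LINT x|M. min \<bar>gk k x - g x\<bar> (2 * w x) + \<bar>wk k x - w x\<bar>)"
    proof (rule integral_mono_AE)
      show "integrable M (\<lambda>x. min \<bar>gk k x - g x\<bar> (2 * w x) + \<bar>wk k x - w x\<bar>)"
        using mi w wk by auto
      show "AE x in M. norm (gk k x - g x) \<le> min \<bar>gk k x - g x\<bar> (2 * w x) + \<bar>wk k x - w x\<bar>"
        using bd gw
      proof eventually_elim
        case (elim x)
        then have "\<bar>gk k x\<bar> \<le> wk k x" by blast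
        with elim(2) show ?case by (auto simp: min_def abs_if split: if_splits)
      qed
    qed (use gi gki in auto)
    also have "\<dots> = (LINT x|M. min \<bar>gk k x - g x\<bar> (2 * w x)) + (LINT x|M. \<bar>wk k x - w x\<bar>)"
      using mi w wk by simp
    finally show ?thesis .
  qed
  then have "(\<lambda>k. (LINT x|M. gk k x) - (LINT x|M. g x)) \<longlonglongrightarrow> 0"
    by (intro Lim_null_comparison[OF _ B]) auto
  then show ?thesis by (simp add: LIM_zero_iff)
qed

lemma integrable_Pair:
  fixes f :: "'a \<Rightarrow> 'b::euclidean_space" and g :: "'a \<Rightarrow> 'c::euclidean_space"
  assumes "integrable M f" "integrable M g"
  shows "integrable M (\<lambda>x. (f x, g x))"
proof -
  have "integrable M (\<lambda>x. (f x, 0 :: 'c))"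
    by (rule integrable_bounded_linear[OF bounded_linear_Pair[OF bounded_linear_ident bounded_linear_zero] assms(1)])
  moreover have "integrable M (\<lambda>x. (0 :: 'b, g x))"
    by (rule integrable_bounded_linear[OF bounded_linear_Pair[OF bounded_linear_zero bounded_linear_ident] assms(2)])
  ultimately have "integrable M (\<lambda>x. (f x, 0) + (0, g x))"
    by (rule Bochner_Integration.integrable_add)
  then show ?thesis by simp
qed

lemma mollify_AE_subsequence:
  fixes m :: "'a::euclidean_space \<Rightarrow> 'b::euclidean_space"
  assumes m: "integrable lebesgue m" and K: "compact K"
  shows "\<exists>s. strict_mono s \<and> (AE x in lebesgue_on K. (\<lambda>k. mollify (radius (s k)) m x) \<longlonglongrightarrow> m x)"
proof -
  have Ks: "K \<in> sets lebesgue" using lmeasurable_compact[OF K] by auto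
  have "\<exists>s. strict_mono s \<and> (AE x in lebesgue_on K. (\<lambda>k. mollify (radius (s k)) m x - m x) \<longlonglongrightarrow> 0)"
    by (rule tendsto_L1_AE_subseq[where u = "\<lambda>k x. mollify (radius k) m x - m x"])
       (auto intro!: lebesgue_on_integrable[OF Ks] Bochner_Integration.integrable_diff mollify_young radius_pos m mollify_L1 K)
  then show ?thesis by (simp add: LIM_zero_iff)
qed

text \<open>The common limit passage. Both \<open>m\<close> and the dominating function \<open>F\<close> are mollified, so that along a subsequence
  the integrands converge almost everywhere while their bounds converge in $L^1$ too. A subsequence is
  enough because the approximating integrals eventually vanish.\<close>

lemma mollify_limit:
  fixes m :: "'a::euclidean_space \<Rightarrow> 'b::euclidean_space" and T :: "'a \<Rightarrow> 'b \<Rightarrow> real"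
  assumes m: "integrable lebesgue m" and K: "compact K"
    and meas: "\<And>k. (\<lambda>x. T x (mollify (radius k) m x)) \<in> borel_measurable (lebesgue_on K)"
      "(\<lambda>x. T x (m x)) \<in> borel_measurable (lebesgue_on K)"
    and cont: "\<And>x. continuous_on UNIV (T x)"
    and F: "integrable lebesgue F" and H: "integrable (lebesgue_on K) H"
    and bound: "\<And>k. AE x in lebesgue_on K. \<bar>T x (mollify (radius k) m x)\<bar> \<le> mollify (radius k) F x + H x"
    and zero: "\<forall>\<^sub>F k in sequentially. (LINT x|lebesgue_on K. T x (mollify (radius k) m x)) = 0"
  shows "(LINT x|lebesgue_on K. T x (m x)) = 0"
proof -
  have Ks: "K \<in> sets lebesgue" using lmeasurable_compact[OF K] by auto
  \<comment> \<open>mollifying the pair yields one subsequence that serves both components\<close>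
  define u where "u = (\<lambda>x. (m x, F x))"
  have u: "integrable lebesgue u"
    unfolding u_def using m F by (rule integrable_Pair)
  obtain s where s: "strict_mono s" "AE x in lebesgue_on K. (\<lambda>k. mollify (radius (s k)) u x) \<longlonglongrightarrow> u x"
    using mollify_AE_subsequence[OF u K] by blast
  have fst: "fst (mollify r u x) = mollify r m x" and snd: "snd (mollify r u x) = mollify r F x" if "r > 0" for r x
    using conv_bounded_linear[OF kernel_mollifier[OF that] u bounded_linear_fst, of x]
      conv_bounded_linear[OF kernel_mollifier[OF that] u bounded_linear_snd, of x]
    by (simp_all add: mollify_def u_def)
  have lm: "AE x in lebesgue_on K. (\<lambda>k. mollify (radius (s k)) m x) \<longlonglongrightarrow> m x"
    using s(2) by eventually_elim (drule tendsto_fst, simp add: fst radius_pos, simp add: u_def)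
  have lF: "AE x in lebesgue_on K. (\<lambda>k. mollify (radius (s k)) F x) \<longlonglongrightarrow> F x"
    using s(2) by eventually_elim (drule tendsto_snd, simp add: snd radius_pos, simp add: u_def)
  have Fi: "integrable (lebesgue_on K) (mollify (radius k) F)" "integrable (lebesgue_on K) F" for k
    by (auto intro!: lebesgue_on_integrable[OF Ks] mollify_young radius_pos F)
  have "(\<lambda>k. LINT x|lebesgue_on K. T x (mollify (radius (s k)) m x)) \<longlonglongrightarrow> (LINT x|lebesgue_on K. T x (m x))"
  proof (rule generalized_dominated_convergence[where wk = "\<lambda>k x. mollify (radius (s k)) F x + H x" and w = "\<lambda>x. F x + H x"])
    show "AE x in lebesgue_on K. (\<lambda>k. T x (mollify (radius (s k)) m x)) \<longlonglongrightarrow> T x (m x)"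
      using lm by eventually_elim (rule continuous_on_tendsto_compose[OF cont], auto)
    show "AE x in lebesgue_on K. (\<lambda>k. mollify (radius (s k)) F x + H x) \<longlonglongrightarrow> F x + H x"
      using lF by eventually_elim (intro tendsto_intros)
    show "(\<lambda>k. LINT x|lebesgue_on K. \<bar>mollify (radius (s k)) F x + H x - (F x + H x)\<bar>) \<longlonglongrightarrow> 0"
      using LIMSEQ_subseq_LIMSEQ[OF mollify_L1[OF F K] s(1)] by (simp add: o_def)
  qed (use meas bound Fi H in auto)
  moreover have "\<forall>\<^sub>F k in sequentially. (LINT x|lebesgue_on K. T x (mollify (radius (s k)) m x)) = 0"
    using eventually_subseq[OF s(1) zero] .
  then have "(\<lambda>k. LINT x|lebesgue_on K. T x (mollify (radius (s k)) m x)) \<longlonglongrightarrow> 0"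
    by (rule tendsto_eventually)
  ultimately show ?thesis by (rule LIMSEQ_unique)
qed

section \<open>Null Lagrangians\<close>

lemma compact_support_continuous_integrable:
  fixes f :: "'a::euclidean_space \<Rightarrow> real"
  assumes "continuous_on UNIV f" "compact K" "\<And>x. x \<notin> K \<Longrightarrow> f x = 0"
  shows "integrable lborel f"
proof -
  have "(\<lambda>x. indicator K x *\<^sub>R f x) = f"
    using assms(3) by (auto simp: fun_eq_iff indicator_def)
  then show ?thesis
    using borel_integrable_compact[OF assms(2) continuous_on_subset[OF assms(1)]] by simp
qed

text \<open>The difference quotients have integral zero by translation invariance, they are uniformly bounded,
  and they vanish off a fixed compact set.\<close>

lemma integral_derivative_eq_0:
  fixes f :: "'a::euclidean_space \<Rightarrow> real"
  assumes d: "\<And>x. (f has_derivative f' x) (at x)" and c: "continuous_on UNIV (\<lambda>x. f' x v)"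
    and K: "compact K" and z: "\<And>x. x \<notin> K \<Longrightarrow> f x = 0"
  shows "(LINT x|lebesgue. f' x v) = 0"
proof -
  have cf: "continuous_on UNIV f"
    by (rule continuous_at_imp_continuous_on) (use d has_derivative_continuous in blast)
  have z': "f' x v = 0" if "x \<notin> K" for x
  proof -
    have "dir_deriv f v x = 0"
      by (rule dir_deriv_eq_0_open[of "- K"]) (use that z K compact_imp_closed in auto)
    then show ?thesis using dir_deriv_eq[OF d] by simp
  qed
  obtain R where R: "K \<subseteq> cball 0 R"
    using compact_imp_bounded[OF K] by (auto simp: bounded_iff subset_iff)
  have "compact ((\<lambda>x. f' x v) ` K)"
    by (intro compact_continuous_image K continuous_on_subset[OF c]) auto
  then obtain B0 where "\<forall>y\<in>(\<lambda>x. f' x v) ` K. norm y \<le> B0"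
    by (meson bounded_iff compact_imp_bounded)
  then have B: "\<bar>f' x v\<bar> \<le> \<bar>B0\<bar>" for x
    using z' by (cases "x \<in> K") force+
  have lin: "linear (f' x)" for x using d has_derivative_linear by blast
  have mvt: "\<exists>t. 0 < t \<and> t < 1 \<and> (f (x + h *\<^sub>R v) - f x) / h = f' (x + (t * h) *\<^sub>R v) v" if "h > 0" for x h
  proof -
    obtain t where "0 < t" "t < 1" "f (x + h *\<^sub>R v) - f x = f' (x + t *\<^sub>R h *\<^sub>R v) (h *\<^sub>R v)"
      using directional_mvt[OF d] by blast
    then show ?thesis using that by (auto simp: linear_cmul[OF lin])
  qed
  have fi: "integrable lborel f" by (rule compact_support_continuous_integrable[OF cf K z])
  have fs: "integrable lborel (\<lambda>x. f (x + h))" "(LINT x|lborel. f (x + h)) = (LINT x|lborel. f x)" for h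
  proof -
    have [measurable]: "f \<in> borel_measurable borel" using cf by (rule borel_measurable_continuous_onI)
    show "integrable lborel (\<lambda>x. f (x + h))"
      using fi by (subst (asm) lborel_distr_plus[of h, symmetric]) (simp add: integrable_distr_eq add.commute)
    show "(LINT x|lborel. f (x + h)) = (LINT x|lborel. f x)"
      by (subst (2) lborel_distr_plus[of h, symmetric]) (simp add: integral_distr add.commute)
  qed
  define q where "q = (\<lambda>k x. (f (x + radius k *\<^sub>R v) - f x) / radius k)"
  have q0: "(LINT x|lborel. q k x) = 0" for k
    unfolding q_def using fs fi by simp
  have "(\<lambda>k. LINT x|lborel. q k x) \<longlonglongrightarrow> (LINT x|lborel. f' x v)"
  proof (rule integral_dominated_convergence[where w = "\<lambda>x. \<bar>B0\<bar> * indicator (cball 0 (R + norm v)) x"])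
    show "(\<lambda>x. f' x v) \<in> borel_measurable lborel"
      using borel_measurable_continuous_onI[OF c] by simp
    show "q k \<in> borel_measurable lborel" for k
      unfolding q_def using fs fi by (intro borel_measurable_integrable) auto
    show "integrable lborel (\<lambda>x. \<bar>B0\<bar> * indicator (cball 0 (R + norm v)) x)"
      by (intro integrable_mult_right integrable_real_indicator emeasure_lborel_cball_finite) auto
    show "AE x in lborel. norm (q k x) \<le> \<bar>B0\<bar> * indicator (cball 0 (R + norm v)) x" for k
    proof (rule AE_I2)
      fix x
      show "norm (q k x) \<le> \<bar>B0\<bar> * indicator (cball 0 (R + norm v)) x"
      proof (cases "x \<in> cball 0 (R + norm v)")
        case True
        obtain t where "q k x = f' (x + (t * radius k) *\<^sub>R v) v"
          using mvt[OF radius_pos, of x k] unfolding q_def by blast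
        then show ?thesis using True B by simp
      next
        case False
        have "radius k \<le> 1" by (simp add: radius_def)
        then have "norm (radius k *\<^sub>R v) \<le> norm v" using radius_pos[of k] by (simp add: mult_left_le_one_le)
        moreover have "norm x \<le> norm (x + radius k *\<^sub>R v) + norm (radius k *\<^sub>R v)"
          using norm_triangle_ineq4[of "x + radius k *\<^sub>R v" "radius k *\<^sub>R v"] by simp
        ultimately have "x + radius k *\<^sub>R v \<notin> cball 0 R" "x \<notin> cball 0 R"
          using False norm_ge_zero[of v] unfolding mem_cball_0 by linarith+
        then have "x + radius k *\<^sub>R v \<notin> K" "x \<notin> K" using R by auto
        then show ?thesis using z by (simp add: q_def)
      qed
    qed
    show "AE x in lborel. (\<lambda>k. q k x) \<longlonglongrightarrow> f' x v"
    proof (rule AE_I2)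
      fix x
      obtain t where t: "\<And>k. 0 < t k" "\<And>k. t k < 1" "\<And>k. q k x = f' (x + (t k * radius k) *\<^sub>R v) v"
        using mvt[OF radius_pos, of x] unfolding q_def by metis
      have "(\<lambda>k. t k * radius k) \<longlonglongrightarrow> 0"
      proof (rule Lim_null_comparison[OF _ radius_tendsto])
        show "\<forall>\<^sub>F k in sequentially. norm (t k * radius k) \<le> radius k"
          using t(1,2) radius_pos by (intro always_eventually allI) (simp add: abs_mult less_imp_le mult_left_le_one_le)
      qed
      then have "(\<lambda>k. x + (t k * radius k) *\<^sub>R v) \<longlonglongrightarrow> x + 0 *\<^sub>R v" by (intro tendsto_intros)
      then have "(\<lambda>k. f' (x + (t k * radius k) *\<^sub>R v) v) \<longlonglongrightarrow> f' x v"
        using continuous_on_tendsto_compose[OF c] by simp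
      then show "(\<lambda>k. q k x) \<longlonglongrightarrow> f' x v" by (simp add: t(3))
    qed
  qed
  then have "(LINT x|lborel. f' x v) = 0" by (simp add: q0 LIMSEQ_const_iff)
  then show ?thesis
    using borel_measurable_continuous_onI[OF c] by (simp add: integral_completion)
qed

lemma smooth_prod: "(\<And>i. i \<in> I \<Longrightarrow> smooth (f i)) \<Longrightarrow> smooth (\<lambda>x. \<Prod>i\<in>I. f i x :: real)"
  by (induction I rule: infinite_finite_induct) (auto intro!: smooth_const smooth_mult)

text \<open>Expand the determinant over permutations. Up to terms with second derivatives, the summand of \<open>p\<close> is the
  derivative in direction \<open>p i\<close> of \<open>w i\<close> times the remaining factors, whose integral is zero as \<open>w i\<close>
  has compact support. The terms with second derivatives cancel in pairs.\<close>

lemma integral_det_gradients_eq_0: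
  fixes w :: "'n::finite \<Rightarrow> real^'n \<Rightarrow> real"
  assumes sm: "\<And>k. smooth (w k)" and K: "compact K" and z: "\<And>x. x \<notin> K \<Longrightarrow> w i x = 0"
    and sym: "\<And>k a b x. k \<noteq> i \<Longrightarrow> dir_deriv (dir_deriv (w k) a) b x = dir_deriv (dir_deriv (w k) b) a x"
  shows "(LINT x|lebesgue. det (\<chi> k l. dir_deriv (w k) (axis l 1) x)) = 0"
proof -
  define e :: "'n \<Rightarrow> real^'n" where "e = (\<lambda>l. axis l 1)"
  let ?I = "UNIV - {i}" and ?S = "{p. p permutes (UNIV :: 'n set)}"
  define P where "P = (\<lambda>p x. w i x * (\<Prod>k\<in>?I. dir_deriv (w k) (e (p k)) x))"
  define A where "A = (\<lambda>p m x. dir_deriv (dir_deriv (w m) (e (p m))) (e (p i)) x * (\<Prod>k\<in>?I - {m}. dir_deriv (w k) (e (p k)) x))"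
  have sP: "smooth (P p)" for p
    unfolding P_def by (intro smooth_mult sm smooth_prod smooth_dir_deriv)
  have dP: "dir_deriv (P p) (e (p i)) x = (\<Prod>k\<in>UNIV. dir_deriv (w k) (e (p k)) x) + w i x * (\<Sum>m\<in>?I. A p m x)" for p x
  proof -
    have "(P p has_derivative (\<lambda>v. w i x * (\<Sum>m\<in>?I. dir_deriv (dir_deriv (w m) (e (p m))) v x * (\<Prod>k\<in>?I - {m}. dir_deriv (w k) (e (p k)) x))
        + dir_deriv (w i) v x * (\<Prod>k\<in>?I. dir_deriv (w k) (e (p k)) x))) (at x)"
      unfolding P_def by (intro has_derivative_mult has_derivative_prod smooth_has_derivative sm smooth_dir_deriv)
    then have "dir_deriv (P p) (e (p i)) x = w i x * (\<Sum>m\<in>?I. A p m x) + dir_deriv (w i) (e (p i)) x * (\<Prod>k\<in>?I. dir_deriv (w k) (e (p k)) x)"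
      unfolding A_def by (rule dir_deriv_eq)
    also have "dir_deriv (w i) (e (p i)) x * (\<Prod>k\<in>?I. dir_deriv (w k) (e (p k)) x) = (\<Prod>k\<in>UNIV. dir_deriv (w k) (e (p k)) x)"
      by (subst (2) prod.remove[of _ i]) auto
    finally show ?thesis by simp
  qed
  \<comment> \<open>exchanging \<open>p i\<close> and \<open>p m\<close> flips the sign of \<open>p\<close>, but not \<open>A p m x\<close>, as second derivatives commute\<close>
  have S0: "(\<Sum>p\<in>?S. of_int (sign p) * A p m x) = 0" if "m \<noteq> i" for m x
  proof -
    let ?t = "Transposition.transpose i m"
    have t: "?t permutes UNIV" by (simp add: permutes_swap_id)
    have "(\<Sum>p\<in>?S. of_int (sign p) * A p m x) = (\<Sum>p\<in>?S. of_int (sign (p \<circ> ?t)) * A (p \<circ> ?t) m x)"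
      by (rule sum_permutations_compose_right[OF t])
    also have "\<dots> = (\<Sum>p\<in>?S. - (of_int (sign p) * A p m x))"
    proof (rule sum.cong[OF refl])
      fix p assume "p \<in> ?S"
      then have p: "permutation p" by (auto simp: permutation_permutes)
      have "sign (p \<circ> ?t) = - sign p"
        using that by (subst sign_compose[OF p]) (auto simp: permutation_swap_id sign_swap_id)
      moreover have "A (p \<circ> ?t) m x = A p m x"
      proof -
        have "(\<Prod>k\<in>?I - {m}. dir_deriv (w k) (e ((p \<circ> ?t) k)) x) = (\<Prod>k\<in>?I - {m}. dir_deriv (w k) (e (p k)) x)"
          by (rule prod.cong) (auto simp: transpose_apply_other)
        then show ?thesis
          using sym[OF that] by (simp add: A_def)
      qed
      ultimately show "of_int (sign (p \<circ> ?t)) * A (p \<circ> ?t) m x = - (of_int (sign p) * A p m x)"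
        by simp
    qed
    finally show ?thesis by (simp add: sum_negf)
  qed
  have "(\<Sum>p\<in>?S. of_int (sign p) * (\<Sum>m\<in>?I. A p m x)) = (\<Sum>m\<in>?I. \<Sum>p\<in>?S. of_int (sign p) * A p m x)" for x
    unfolding sum_distrib_left by (rule sum.swap)
  then have S: "(\<Sum>p\<in>?S. of_int (sign p) * (\<Sum>m\<in>?I. A p m x)) = 0" for x
    using S0 by simp
  have det: "det (\<chi> k l. dir_deriv (w k) (axis l 1) x) = (\<Sum>p\<in>?S. of_int (sign p) * dir_deriv (P p) (e (p i)) x)" for x
  proof -
    have "(\<Sum>p\<in>?S. of_int (sign p) * dir_deriv (P p) (e (p i)) x)
       = (\<Sum>p\<in>?S. of_int (sign p) * (\<Prod>k\<in>UNIV. dir_deriv (w k) (e (p k)) x))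
         + w i x * (\<Sum>p\<in>?S. of_int (sign p) * (\<Sum>m\<in>?I. A p m x))"
      unfolding dP by (simp add: distrib_left sum.distrib sum_distrib_left mult.left_commute)
    then show ?thesis by (simp add: S det_def e_def)
  qed
  have zP: "P p x = 0" if "x \<notin> K" for p x using z[OF that] by (simp add: P_def)
  have zdP: "dir_deriv (P p) v x = 0" if "x \<notin> K" for p v x
    by (rule dir_deriv_eq_0_open[of "- K"]) (use that zP K compact_imp_closed in auto)
  have "integrable lebesgue (dir_deriv (P p) v)" for p v
  proof -
    have c: "continuous_on UNIV (dir_deriv (P p) v)" by (intro smooth_continuous smooth_dir_deriv sP)
    have "integrable lborel (dir_deriv (P p) v)"
      by (rule compact_support_continuous_integrable[OF c K zdP])
    then show ?thesis using borel_measurable_continuous_onI[OF c] by (simp add: integrable_completion)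
  qed
  moreover have "(LINT x|lebesgue. dir_deriv (P p) v x) = 0" for p v
    by (rule integral_derivative_eq_0[OF smooth_has_derivative[OF sP] _ K zP])
       (intro smooth_continuous smooth_dir_deriv sP)
  ultimately show ?thesis
    unfolding det by simp
qed

section \<open>Weak derivatives and mollification\<close>

lemma Lp_loc_1_iff:
  "f \<in> Lp_loc 1 \<Omega> \<longleftrightarrow> f \<in> borel_measurable (lebesgue_on \<Omega>) \<and>
     (\<forall>K. compact K \<and> K \<subseteq> \<Omega> \<longrightarrow> integrable (lebesgue_on K) f)"
proof -
  have "integrable (lebesgue_on K) (\<lambda>x. norm (f x)) \<longleftrightarrow> integrable (lebesgue_on K) f"
    if "f \<in> borel_measurable (lebesgue_on \<Omega>)" "K \<subseteq> \<Omega>" for K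
    using measurable_restrict_mono[OF that] by (rule integrable_norm_iff)
  then show ?thesis
    by (auto simp: Lp_loc_def one_ereal_def)
qed

text \<open>Functions that are only locally integrable on \<open>\<Omega>\<close> are extended by zero from a compact set, so that
  mollification makes sense on the whole space.\<close>

definition cutoff :: "'a set \<Rightarrow> ('a \<Rightarrow> 'b::real_vector) \<Rightarrow> 'a \<Rightarrow> 'b" where
  "cutoff K f = (\<lambda>x. indicator K x *\<^sub>R f x)"

lemma cutoff_in: "x \<in> K \<Longrightarrow> cutoff K f x = f x"
  by (simp add: cutoff_def)

lemma cutoff_notin: "x \<notin> K \<Longrightarrow> cutoff K f x = 0"
  by (simp add: cutoff_def)

lemma integrable_cutoff:
  fixes f :: "'a::euclidean_space \<Rightarrow> 'b::euclidean_space"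
  shows "K \<in> sets lebesgue \<Longrightarrow> integrable lebesgue (cutoff K f) \<longleftrightarrow> integrable (lebesgue_on K) f"
  by (simp add: cutoff_def integrable_restrict_space)

lemma Lp_loc_1_cutoff:
  "f \<in> Lp_loc 1 \<Omega> \<Longrightarrow> compact K \<Longrightarrow> K \<subseteq> \<Omega> \<Longrightarrow> integrable lebesgue (cutoff K f)"
  using lmeasurable_compact[of K] by (auto simp: Lp_loc_1_iff integrable_cutoff)

lemma lebesgue_on_integral_eq:
  fixes f :: "'a::euclidean_space \<Rightarrow> 'b::euclidean_space"
  assumes "S \<in> sets lebesgue" "\<And>x. x \<notin> S \<Longrightarrow> g x = 0" "\<And>x. x \<in> S \<Longrightarrow> g x = f x"
  shows "(LINT x|lebesgue_on S. f x) = (LINT x|lebesgue. g x)"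
  using assms by (simp add: integral_restrict_space)
    (intro Bochner_Integration.integral_cong refl, auto simp: indicator_def)

lemma compact_support_inI:
  assumes "compact K" "K \<subseteq> \<Omega>" "\<And>x. x \<notin> K \<Longrightarrow> f x = 0"
  shows "compact_support_in \<Omega> (f :: 'a::t2_space \<Rightarrow> _)"
proof -
  have "closure {x. f x \<noteq> 0} \<subseteq> K"
    using assms by (intro closure_minimal compact_imp_closed) auto
  moreover have "compact (closure {x. f x \<noteq> 0})"
    using compact_Int_closed[OF assms(1) closed_closure, of "{x. f x \<noteq> 0}"] calculation
    by (simp add: Int_absorb1)
  ultimately show ?thesis using assms by (auto simp: compact_support_in_def)
qed

lemma compact_thicken:
  fixes K :: "'a::euclidean_space set"
  assumes "compact K" "open \<Omega>" "K \<subseteq> \<Omega>"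
  obtains e K' where "e > 0" "compact K'" "K' \<subseteq> \<Omega>" "K \<subseteq> K'" "\<And>x. x \<in> K \<Longrightarrow> cball x e \<subseteq> K'"
proof -
  obtain e where e: "e > 0" "(\<Union>x\<in>K. cball x e) \<subseteq> \<Omega>"
    using compact_subset_open_imp_cball_epsilon_subset[OF assms] by blast
  have eq: "{x + y |x y. x \<in> K \<and> y \<in> cball 0 e} = (\<Union>x\<in>K. cball x e)"
  proof (intro set_eqI iffI)
    fix z assume "z \<in> (\<Union>x\<in>K. cball x e)"
    then obtain x where "x \<in> K" "dist x z \<le> e" by auto
    then show "z \<in> {x + y |x y. x \<in> K \<and> y \<in> cball 0 e}"
      by (intro CollectI exI[of _ x] exI[of _ "z - x"]) (auto simp: dist_norm norm_minus_commute)
  next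
    fix z assume "z \<in> {x + y |x y. x \<in> K \<and> y \<in> cball 0 e}"
    then obtain x y where "x \<in> K" "norm y \<le> e" "z = x + y" by auto
    then show "z \<in> (\<Union>x\<in>K. cball x e)" by (intro UN_I[of x]) (auto simp: dist_norm)
  qed
  have "compact (\<Union>x\<in>K. cball x e)"
    unfolding eq[symmetric] by (intro compact_sums assms) auto
  moreover have "K \<subseteq> (\<Union>x\<in>K. cball x e)"
    using e(1) by force
  ultimately show ?thesis
    using that[of e "\<Union>x\<in>K. cball x e"] e by blast
qed

lemma mollifier_test_function:
  fixes x :: "'a::euclidean_space"
  assumes "r > 0" "cball x r \<subseteq> \<Omega>"
  shows "(\<lambda>y. mollifier r (x - y)) \<in> Cinfc \<Omega>"
  unfolding Cinfc_iff
proof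
  show "smooth (\<lambda>y. mollifier r (x - y))" by (rule smooth_reflect[OF smooth_mollifier])
  show "compact_support_in \<Omega> (\<lambda>y. mollifier r (x - y))"
    by (rule compact_support_inI[of "cball x r"])
       (use assms kernel_mollifier[of r, where 'a='a] in \<open>auto simp: kernel_def dist_norm\<close>)
qed

lemma mollify_cutoff_eq:
  fixes w :: "'a::euclidean_space \<Rightarrow> 'b::euclidean_space"
  assumes "r > 0" "cball x r \<subseteq> K" "K \<subseteq> \<Omega>" "\<Omega> \<in> sets lebesgue"
  shows "mollify r (cutoff K w) x = (LINT y|lebesgue_on \<Omega>. mollifier r (x - y) *\<^sub>R w y)"
  unfolding mollify_def conv_def
proof (rule lebesgue_on_integral_eq[symmetric])
  have "mollifier r (x - y) = 0" if "y \<notin> K" for y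
  proof -
    have "y \<notin> cball x r" using that assms by blast
    then show ?thesis using kernel_mollifier[OF assms(1), where 'a='a] by (simp add: kernel_def dist_norm)
  qed
  then show "mollifier r (x - y) *\<^sub>R cutoff K w y = mollifier r (x - y) *\<^sub>R w y" for y
    by (cases "y \<in> K") (auto simp: cutoff_def)
  fix y assume "y \<notin> \<Omega>"
  then have "y \<notin> K" using assms by blast
  then show "mollifier r (x - y) *\<^sub>R cutoff K w y = 0" by (simp add: cutoff_notin)
qed (use assms in auto)

text \<open>The reflected mollifier centred at \<open>x\<close> is itself a test function on \<open>\<Omega>\<close>, because its support lies in \<open>K\<close>.\<close>

lemma mollify_weak_gradient:
  fixes f :: "real^'n \<Rightarrow> real"
  assumes wg: "has_weak_gradient f g \<Omega>" and \<Omega>: "open \<Omega>" and K: "compact K" "K \<subseteq> \<Omega>"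
    and r: "r > 0" "cball x r \<subseteq> K"
  shows "dir_deriv (mollify r (cutoff K f)) (axis j 1) x = mollify r (cutoff K g) x $ j"
proof -
  have fi: "integrable lebesgue (cutoff K f)" and gi: "integrable lebesgue (cutoff K g)"
    using wg K by (auto simp: has_weak_gradient_def intro!: Lp_loc_1_cutoff)
  have \<Omega>s: "\<Omega> \<in> sets lebesgue" using \<Omega> by (simp add: borel_open)
  let ?\<phi> = "\<lambda>y. mollifier r (x - y)" and ?e = "axis j 1 :: real^'n"
  have test: "?\<phi> \<in> Cinfc \<Omega>" using r K by (intro mollifier_test_function) auto
  have d\<phi>: "dir_deriv ?\<phi> v y = - dir_deriv (mollifier r) v (x - y)" for v y
  proof -
    have "((\<lambda>y. x - y) has_derivative (\<lambda>v. - v)) (at y)"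
      by (auto intro!: derivative_eq_intros)
    from has_derivative_compose[OF this smooth_has_derivative[OF smooth_mollifier]]
    have "dir_deriv ?\<phi> v y = dir_deriv (mollifier r) (- v) (x - y)" by (rule dir_deriv_eq)
    also have "\<dots> = - dir_deriv (mollifier r) v (x - y)"
      by (rule linear_neg[OF has_derivative_linear[OF smooth_has_derivative[OF smooth_mollifier]]])
    finally show ?thesis .
  qed
  have "dir_deriv (mollify r (cutoff K f)) ?e x = (LINT y|lebesgue. dir_deriv (mollifier r) ?e (x - y) *\<^sub>R cutoff K f y)"
    using fun_cong[OF conv_dir_deriv[OF kernel_mollifier[OF r(1)] fi, of ?e], of x] by (simp add: mollify_def conv_def)
  also have "\<dots> = (LINT y|lebesgue_on \<Omega>. - (f y * dir_deriv ?\<phi> ?e y))"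
  proof (rule lebesgue_on_integral_eq[OF \<Omega>s, symmetric])
    fix y
    have "dir_deriv (mollifier r) ?e (x - y) = 0" if "y \<notin> K"
    proof -
      have "y \<notin> cball x r" using that r by blast
      then show ?thesis using kernel_dir_deriv[OF kernel_mollifier[OF r(1)], of ?e] by (simp add: kernel_def dist_norm)
    qed
    then show "dir_deriv (mollifier r) ?e (x - y) *\<^sub>R cutoff K f y = - (f y * dir_deriv ?\<phi> ?e y)"
      by (cases "y \<in> K") (auto simp: cutoff_def d\<phi>)
    assume "y \<notin> \<Omega>"
    then have "y \<notin> K" using K by blast
    then show "dir_deriv (mollifier r) ?e (x - y) *\<^sub>R cutoff K f y = 0" by (simp add: cutoff_notin)
  qed
  also have "\<dots> = (LINT y|lebesgue_on \<Omega>. g y $ j * ?\<phi> y)"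
    using wg test by (simp add: has_weak_gradient_def)
  also have "\<dots> = (LINT y|lebesgue_on \<Omega>. ?\<phi> y *\<^sub>R (g y $ j))"
    by (simp add: mult.commute)
  also have "\<dots> = mollify r (cutoff K (\<lambda>y. g y $ j)) x"
    by (rule mollify_cutoff_eq[OF r K(2) \<Omega>s, symmetric])
  also have "cutoff K (\<lambda>y. g y $ j) = (\<lambda>y. cutoff K g y $ j)" by (simp add: cutoff_def)
  also have "mollify r (\<lambda>y. cutoff K g y $ j) x = mollify r (cutoff K g) x $ j"
    unfolding mollify_def by (rule conv_bounded_linear[OF kernel_mollifier[OF r(1)] gi bounded_linear_vec_nth])
  finally show ?thesis .
qed

section \<open>Almost everywhere on an open set\<close>

lemma AE_lebesgue_on_iff:
  "S \<in> sets lebesgue \<Longrightarrow> (AE x in lebesgue_on S. P x) \<longleftrightarrow> (AE x in lebesgue. x \<in> S \<longrightarrow> P x)"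
  by (rule AE_restrict_space_iff) simp

lemma AE_lebesgue_on_subset:
  "AE x in lebesgue_on S. P x \<Longrightarrow> T \<subseteq> S \<Longrightarrow> S \<in> sets lebesgue \<Longrightarrow> T \<in> sets lebesgue \<Longrightarrow> AE x in lebesgue_on T. P x"
  by (auto simp: AE_lebesgue_on_iff elim!: eventually_mono)

text \<open>Countably many of the balls cover \<open>\<Omega>\<close>.\<close>

lemma AE_local:
  fixes \<Omega> :: "'a::euclidean_space set"
  assumes \<Omega>: "open \<Omega>" and loc: "\<And>x. x \<in> \<Omega> \<Longrightarrow> \<exists>e>0. AE y in lebesgue_on (ball x e). P y"
  shows "AE x in lebesgue_on \<Omega>. P x"
proof -
  obtain e where e: "\<And>x. x \<in> \<Omega> \<Longrightarrow> e x > 0 \<and> (AE y in lebesgue_on (ball x (e x)). P y)"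
    using loc by metis
  obtain F where F: "F \<subseteq> (\<lambda>x. ball x (e x)) ` \<Omega>" "countable F" "\<Union>F = \<Union>((\<lambda>x. ball x (e x)) ` \<Omega>)"
    using Lindelof[of "(\<lambda>x. ball x (e x)) ` \<Omega>"] by auto
  have cov: "\<Omega> \<subseteq> \<Union>F" using F(3) e by force
  have "AE y in lebesgue. \<forall>B\<in>F. y \<in> B \<longrightarrow> P y"
  proof (subst AE_ball_countable[OF F(2)], intro ballI)
    fix B assume "B \<in> F"
    then obtain x where "x \<in> \<Omega>" "B = ball x (e x)" using F(1) by auto
    then show "AE y in lebesgue. y \<in> B \<longrightarrow> P y"
      using e[of x] AE_lebesgue_on_iff[of "ball x (e x)" P] by auto
  qed
  then have "AE y in lebesgue. y \<in> \<Omega> \<longrightarrow> P y"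
    by eventually_elim (use cov in blast)
  then show ?thesis using \<Omega> by (simp add: AE_lebesgue_on_iff borel_open)
qed

lemma AE_compact:
  fixes \<Omega> :: "'a::euclidean_space set"
  assumes \<Omega>: "open \<Omega>" and loc: "\<And>K. compact K \<Longrightarrow> K \<subseteq> \<Omega> \<Longrightarrow> AE y in lebesgue_on K. P y"
  shows "AE x in lebesgue_on \<Omega>. P x"
proof (rule AE_local[OF \<Omega>])
  fix x assume "x \<in> \<Omega>"
  then obtain e where "e > 0" "cball x e \<subseteq> \<Omega>" using \<Omega> open_contains_cball by metis
  then show "\<exists>e>0. AE y in lebesgue_on (ball x e). P y"
    using AE_lebesgue_on_subset[OF loc[of "cball x e"], of "ball x e"] by auto
qed

text \<open>The mollifications of \<open>w\<close> at points of a compact set are integrals of \<open>w\<close> against test functions, hence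
  vanish for small radii, and they converge to \<open>w\<close> almost everywhere along a subsequence.\<close>

lemma fundamental_lemma:
  fixes w :: "'a::euclidean_space \<Rightarrow> real"
  assumes w: "w \<in> Lp_loc 1 \<Omega>" and \<Omega>: "open \<Omega>"
    and z: "\<And>\<zeta>. \<zeta> \<in> Cinfc \<Omega> \<Longrightarrow> (LINT x|lebesgue_on \<Omega>. \<zeta> x * w x) = 0"
  shows "AE x in lebesgue_on \<Omega>. w x = 0"
proof (rule AE_compact[OF \<Omega>])
  fix K assume K: "compact K" "K \<subseteq> \<Omega>"
  obtain e K' where e: "e > 0" "compact K'" "K' \<subseteq> \<Omega>" "K \<subseteq> K'" "\<And>x. x \<in> K \<Longrightarrow> cball x e \<subseteq> K'"
    using compact_thicken[OF K(1) \<Omega> K(2)] by metis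
  have i: "integrable lebesgue (cutoff K' w)" by (rule Lp_loc_1_cutoff[OF w e(2,3)])
  have \<Omega>s: "\<Omega> \<in> sets lebesgue" using \<Omega> by (simp add: borel_open)
  have "\<forall>\<^sub>F k in sequentially. radius k < e" using e by (intro radius_eventually)
  then have ev: "\<forall>\<^sub>F k in sequentially. \<forall>x\<in>K. mollify (radius k) (cutoff K' w) x = 0"
  proof eventually_elim
    case (elim k)
    show ?case
    proof
      fix x assume "x \<in> K"
      then have c: "cball x (radius k) \<subseteq> K'" using e(5)[of x] elim by (auto simp: subset_iff)
      have "mollify (radius k) (cutoff K' w) x = (LINT y|lebesgue_on \<Omega>. mollifier (radius k) (x - y) *\<^sub>R w y)"
        by (rule mollify_cutoff_eq[OF radius_pos c e(3) \<Omega>s])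
      also have "\<dots> = 0"
        using z[OF mollifier_test_function[OF radius_pos, of x k]] c e(3) by simp
      finally show "mollify (radius k) (cutoff K' w) x = 0" .
    qed
  qed
  obtain s where s: "strict_mono s" "AE x in lebesgue_on K. (\<lambda>k. mollify (radius (s k)) (cutoff K' w) x) \<longlonglongrightarrow> cutoff K' w x"
    using mollify_AE_subsequence[OF i K(1)] by blast
  have "AE x in lebesgue_on K. x \<in> K"
    by (rule AE_I2) (simp add: space_restrict_space)
  with s(2) show "AE x in lebesgue_on K. w x = 0"
  proof eventually_elim
    case (elim x)
    have "\<forall>\<^sub>F k in sequentially. mollify (radius (s k)) (cutoff K' w) x = 0"
      using eventually_subseq[OF s(1) ev] by eventually_elim (use elim in blast)
    then have "(\<lambda>k. mollify (radius (s k)) (cutoff K' w) x) \<longlonglongrightarrow> 0" by (rule tendsto_eventually)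
    with elim have "cutoff K' w x = 0" using LIMSEQ_unique by blast
    then show ?case using elim e(4) by (auto simp: cutoff_in)
  qed
qed

section \<open>Cofactors\<close>

text \<open>Replacing the \<open>i\<close>-th gradient by \<open>a\<close> in the determinant: this turns a row of the cofactor matrix paired with
  the gradient of a test function into a determinant of gradients.\<close>

lemma cof_row_inner:
  "cof A $ i \<bullet> a = det (\<chi> k. if k = i then a else A $ k)" for A :: "real^'n^'n"
proof -
  have "cof A $ i \<bullet> a = (\<Sum>j\<in>UNIV. det (\<chi> k. if k = i then a $ j *s axis j 1 else A $ k))"
    by (simp add: inner_vec_def cof_eq_det_replace_row det_row_mul[of i "a $ _" "\<lambda>_. axis _ 1"] mult.commute)
  also have "\<dots> = det (\<chi> k. if k = i then (\<Sum>j\<in>UNIV. a $ j *s axis j 1) else A $ k)"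
    by (rule det_linear_row_sum[symmetric]) simp
  also have "(\<Sum>j\<in>UNIV. a $ j *s axis j 1) = a"
    by (rule basis_expansion)
  finally show ?thesis .
qed

lemma continuous_on_det:
  fixes M :: "'a::topological_space \<Rightarrow> real^'n^'n"
  assumes "continuous_on S M"
  shows "continuous_on S (\<lambda>x. det (M x))"
proof -
  have 1: "continuous_on S (\<lambda>x. M x $ i $ j)" for i j
    by (intro continuous_on_component assms)
  have 2: "continuous_on S (\<lambda>x. \<Prod>i\<in>UNIV. M x $ i $ p i)" for p
    by (rule continuous_on_prod[OF 1])
  have 3: "continuous_on S (\<lambda>x. of_int (sign p) * (\<Prod>i\<in>UNIV. M x $ i $ p i))" for p :: "'n \<Rightarrow> 'n"
    by (rule continuous_on_mult[OF continuous_on_const 2])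
  show ?thesis
  unfolding det_def by (rule continuous_on_sum[OF 3])
qed

lemma continuous_cof_row_inner:
  "continuous_on UNIV (\<lambda>z. cof (snd z) $ i \<bullet> fst z :: real)" for i :: "'n::finite"
proof -
  have "continuous_on UNIV (\<lambda>z::(real^'n) \<times> (real^'n^'n). \<chi> k. if k = i then fst z else snd z $ k)"
  proof (intro continuous_on_vec_lambda)
    fix k
    show "continuous_on UNIV (\<lambda>z::(real^'n) \<times> (real^'n^'n). if k = i then fst z else snd z $ k)"
      by (cases "k = i") (auto intro!: continuous_intros)
  qed
  then show ?thesis unfolding cof_row_inner by (rule continuous_on_det)
qed

lemma borel_measurable_cof_row_inner:
  fixes A :: "'a \<Rightarrow> real^'n^'n" and a :: "'a \<Rightarrow> real^'n"
  assumes "A \<in> borel_measurable M" "a \<in> borel_measurable M"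
  shows "(\<lambda>x. cof (A x) $ i \<bullet> a x) \<in> borel_measurable M"
proof -
  have "(\<lambda>x. (a x, A x)) \<in> borel_measurable M"
    using assms by (intro borel_measurable_Pair)
  from measurable_compose[OF this borel_measurable_continuous_onI[OF continuous_cof_row_inner[of i]]]
  show ?thesis by simp
qed

lemma borel_measurable_cof:
  fixes A :: "'a \<Rightarrow> real^'n^'n"
  assumes "A \<in> borel_measurable M"
  shows "(\<lambda>x. cof (A x) $ i) \<in> borel_measurable M"
proof -
  have "(\<lambda>x. cof (A x) $ i \<bullet> b) \<in> borel_measurable M" for b
    using assms by (intro borel_measurable_cof_row_inner) auto
  then show ?thesis by (subst borel_measurable_euclidean_space) blast
qed

lemma cof_row_inner_bound:
  fixes A :: "real^'n^'n"
  shows "\<bar>cof A $ i \<bullet> a\<bar> \<le> fact CARD('n) * norm a * norm A ^ (CARD('n) - 1)"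
proof -
  let ?M = "\<chi> k. if k = i then a else A $ k"
  let ?S = "{p. p permutes (UNIV :: 'n set)}"
  have ent: "\<bar>A $ k $ l\<bar> \<le> norm A" for k l
    by (rule order_trans[OF component_le_norm_cart Finite_Cartesian_Product.norm_nth_le])
  have "\<bar>det ?M\<bar> \<le> (\<Sum>p\<in>?S. \<bar>of_int (sign p) * (\<Prod>k\<in>UNIV. ?M $ k $ p k)\<bar>)"
    unfolding det_def by (rule sum_abs)
  also have "\<dots> \<le> (\<Sum>p\<in>?S. norm a * norm A ^ (CARD('n) - 1))"
  proof (rule sum_mono)
    fix p
    have "\<bar>of_int (sign p) * (\<Prod>k\<in>UNIV. ?M $ k $ p k)\<bar> = (\<Prod>k\<in>UNIV. \<bar>?M $ k $ p k\<bar>)"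
      by (simp add: abs_mult abs_prod sign_def)
    also have "\<dots> = \<bar>a $ p i\<bar> * (\<Prod>k\<in>UNIV - {i}. \<bar>A $ k $ p k\<bar>)"
      by (subst prod.remove[of _ i]) (auto intro!: prod.cong)
    also have "\<dots> \<le> norm a * (\<Prod>k\<in>UNIV - {i}. norm A)"
      by (intro mult_mono prod_mono component_le_norm_cart prod_nonneg) (auto simp: ent)
    also have "\<dots> = norm a * norm A ^ (CARD('n) - 1)" by simp
    finally show "\<bar>of_int (sign p) * (\<Prod>k\<in>UNIV. ?M $ k $ p k)\<bar> \<le> norm a * norm A ^ (CARD('n) - 1)" .
  qed
  also have "\<dots> = fact CARD('n) * norm a * norm A ^ (CARD('n) - 1)"
    by (simp add: card_permutations[OF refl])
  finally show ?thesis by (simp add: cof_row_inner)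
qed

text \<open>Apply the bound for the inner product to the row itself.\<close>

lemma norm_cof_row:
  fixes A :: "real^'n^'n"
  shows "norm (cof A $ i) \<le> fact CARD('n) * norm A ^ (CARD('n) - 1)"
proof (cases "cof A $ i = 0")
  case False
  have "norm (cof A $ i) * norm (cof A $ i) \<le> norm (cof A $ i) * (fact CARD('n) * norm A ^ (CARD('n) - 1))"
    using cof_row_inner_bound[of A i "cof A $ i"]
    by (simp add: power2_norm_eq_inner[symmetric] power2_eq_square mult.commute mult.left_commute)
  then show ?thesis using False by simp
qed simp

section \<open>Test functions and weak gradients\<close>

definition grad :: "(real^'n \<Rightarrow> real) \<Rightarrow> real^'n \<Rightarrow> real^'n" where
  "grad f x = (\<chi> j. dir_deriv f (axis j 1) x)"

lemma grad_nth: "grad f x $ j = dir_deriv f (axis j 1) x"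
  by (simp add: grad_def)

lemma continuous_grad: "smooth f \<Longrightarrow> continuous_on UNIV (grad f)"
  unfolding grad_def[abs_def] by (intro continuous_on_vec_lambda smooth_continuous smooth_dir_deriv)

lemma grad_mult: "smooth f \<Longrightarrow> smooth g \<Longrightarrow> grad (\<lambda>x. f x * g x) x = f x *\<^sub>R grad g x + g x *\<^sub>R grad f x"
proof -
  assume "smooth f" "smooth g"
  then have "dir_deriv (\<lambda>x. f x * g x) v x = f x * dir_deriv g v x + dir_deriv f v x * g x" for v
    by (intro dir_deriv_eq[OF has_derivative_mult] smooth_has_derivative)
  then show ?thesis by (simp add: vec_eq_iff grad_nth)
qed

lemma Cinfc_E:
  fixes \<zeta> :: "'a::euclidean_space \<Rightarrow> real"
  assumes "\<zeta> \<in> Cinfc \<Omega>"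
  obtains K where "compact K" "K \<subseteq> \<Omega>" "smooth \<zeta>" "\<And>x. x \<notin> K \<Longrightarrow> \<zeta> x = 0" "\<And>x v. x \<notin> K \<Longrightarrow> dir_deriv \<zeta> v x = 0"
proof
  let ?K = "closure {x. \<zeta> x \<noteq> 0}"
  show "compact ?K" "?K \<subseteq> \<Omega>" "smooth \<zeta>"
    using assms by (auto simp: Cinfc_iff compact_support_in_def)
  show z: "\<zeta> x = 0" if "x \<notin> ?K" for x
    using that closure_subset[of "{x. \<zeta> x \<noteq> 0}"] by auto
  show "dir_deriv \<zeta> v x = 0" if "x \<notin> ?K" for x v
  proof (rule dir_deriv_eq_0_open)
    show "open (- ?K)" by (rule open_Compl[OF closed_closure])
    show "x \<in> - ?K" using that by simp
    show "\<zeta> y = 0" if "y \<in> - ?K" for y using that by (intro z) simp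
  qed
qed

lemma compact_support_bounded:
  fixes f :: "'a::euclidean_space \<Rightarrow> 'b::euclidean_space"
  assumes "continuous_on UNIV f" "compact K" "\<And>x. x \<notin> K \<Longrightarrow> f x = 0"
  obtains B where "B \<ge> 0" "\<And>x. norm (f x) \<le> B"
proof -
  have "compact (f ` K)"
    by (intro compact_continuous_image continuous_on_subset[OF assms(1)] assms) auto
  then obtain B where B: "\<forall>y\<in>f ` K. norm y \<le> B"
    by (meson bounded_iff compact_imp_bounded)
  have "norm (f x) \<le> \<bar>B\<bar>" for x
    using B assms(3) by (cases "x \<in> K") force+
  then show ?thesis using that[of "\<bar>B\<bar>"] by auto
qed

lemma integrable_test_mult:
  fixes w \<zeta> :: "'a::euclidean_space \<Rightarrow> real"
  assumes w: "w \<in> Lp_loc 1 \<Omega>" and \<Omega>: "open \<Omega>" and \<zeta>: "continuous_on UNIV \<zeta>" and K: "compact K" "K \<subseteq> \<Omega>" "\<And>x. x \<notin> K \<Longrightarrow> \<zeta> x = 0"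
  shows "integrable (lebesgue_on \<Omega>) (\<lambda>x. \<zeta> x * w x)"
proof -
  obtain B where B: "B \<ge> 0" "\<And>x. norm (\<zeta> x) \<le> B" using compact_support_bounded[OF \<zeta> K(1,3)] by metis
  have wi: "integrable lebesgue (cutoff K w)" by (rule Lp_loc_1_cutoff[OF w K(1,2)])
  have [measurable]: "\<zeta> \<in> borel_measurable lebesgue" using \<zeta> by (rule continuous_borel_measurable_lebesgue)
  have "integrable lebesgue (\<lambda>x. \<zeta> x * cutoff K w x)"
    by (rule Bochner_Integration.integrable_bound[where f = "\<lambda>x. B * cutoff K w x"])
       (use wi B in \<open>auto simp: abs_mult intro!: mult_mono borel_measurable_times borel_measurable_integrable\<close>)
  moreover have "(\<lambda>x. \<zeta> x * cutoff K w x) = cutoff \<Omega> (\<lambda>x. \<zeta> x * w x)"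
    using K by (auto simp: fun_eq_iff cutoff_def indicator_def)
  ultimately show ?thesis
    using integrable_cutoff[of \<Omega> "\<lambda>x. \<zeta> x * w x"] \<Omega> by (simp add: borel_open)
qed

lemma lebesgue_on_support:
  fixes f :: "'a::euclidean_space \<Rightarrow> 'b::euclidean_space"
  assumes "open \<Omega>" "compact K" "K \<subseteq> \<Omega>" "\<And>x. x \<notin> K \<Longrightarrow> f x = 0"
  shows "(LINT x|lebesgue_on \<Omega>. f x) = (LINT x|lebesgue_on K. f x)"
proof -
  have "(LINT x|lebesgue_on \<Omega>. f x) = (LINT x|lebesgue. f x)"
    by (rule lebesgue_on_integral_eq) (use assms in \<open>auto simp: borel_open\<close>)
  also have "\<dots> = (LINT x|lebesgue_on K. f x)"
    by (rule lebesgue_on_integral_eq[symmetric]) (use assms lmeasurable_compact in auto)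
  finally show ?thesis .
qed

lemma Lp_loc_1_bounded_linear:
  fixes f :: "'a::euclidean_space \<Rightarrow> 'b::euclidean_space" and L :: "'b \<Rightarrow> 'c::euclidean_space"
  assumes "bounded_linear L" "f \<in> Lp_loc 1 \<Omega>"
  shows "(\<lambda>x. L (f x)) \<in> Lp_loc 1 \<Omega>"
  unfolding Lp_loc_1_iff
proof (intro conjI allI impI)
  have "L \<in> borel_measurable borel"
    by (intro borel_measurable_continuous_onI linear_continuous_on assms(1))
  moreover have "f \<in> borel_measurable (lebesgue_on \<Omega>)"
    using assms(2) by (simp add: Lp_loc_1_iff)
  ultimately show "(\<lambda>x. L (f x)) \<in> borel_measurable (lebesgue_on \<Omega>)"
    by (rule measurable_compose[rotated])
  fix K assume "compact K \<and> K \<subseteq> \<Omega>"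
  then show "integrable (lebesgue_on K) (\<lambda>x. L (f x))"
    using assms(2) by (intro integrable_bounded_linear[OF assms(1)]) (simp add: Lp_loc_1_iff)
qed

lemma Lp_loc_1_diff: "f \<in> Lp_loc 1 \<Omega> \<Longrightarrow> g \<in> Lp_loc 1 \<Omega> \<Longrightarrow> (\<lambda>x. f x - g x) \<in> Lp_loc 1 \<Omega>"
  by (auto simp: Lp_loc_1_iff)

lemma has_weak_gradientD:
  assumes "has_weak_gradient f g \<Omega>" "\<phi> \<in> Cinfc \<Omega>"
  shows "(LINT x|lebesgue_on \<Omega>. f x * dir_deriv \<phi> (axis j 1) x) = - (LINT x|lebesgue_on \<Omega>. g x $ j * \<phi> x)"
  using assms by (simp add: has_weak_gradient_def)

lemma weak_gradient_unique:
  fixes f :: "real^'n \<Rightarrow> real"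
  assumes g1: "has_weak_gradient f g1 \<Omega>" and g2: "has_weak_gradient f g2 \<Omega>" and \<Omega>: "open \<Omega>"
  shows "AE x in lebesgue_on \<Omega>. g1 x = g2 x"
proof -
  have L: "(\<lambda>x. g1 x $ j) \<in> Lp_loc 1 \<Omega>" "(\<lambda>x. g2 x $ j) \<in> Lp_loc 1 \<Omega>" for j
    using g1 g2 by (auto simp: has_weak_gradient_def intro: Lp_loc_1_bounded_linear bounded_linear_vec_nth)
  have "AE x in lebesgue_on \<Omega>. g1 x $ j - g2 x $ j = 0" for j
  proof (rule fundamental_lemma[OF Lp_loc_1_diff[OF L] \<Omega>])
    fix \<zeta> :: "real^'n \<Rightarrow> real" assume z: "\<zeta> \<in> Cinfc \<Omega>"
    then obtain K where K: "compact K" "K \<subseteq> \<Omega>" "smooth \<zeta>" "\<And>x. x \<notin> K \<Longrightarrow> \<zeta> x = 0" by (metis Cinfc_E)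
    have i: "integrable (lebesgue_on \<Omega>) (\<lambda>x. \<zeta> x * g1 x $ j)" "integrable (lebesgue_on \<Omega>) (\<lambda>x. \<zeta> x * g2 x $ j)"
      by (rule integrable_test_mult[OF L(1) \<Omega> smooth_continuous[OF K(3)] K(1,2,4)], assumption)
         (rule integrable_test_mult[OF L(2) \<Omega> smooth_continuous[OF K(3)] K(1,2,4)], assumption)
    have "- (LINT x|lebesgue_on \<Omega>. g1 x $ j * \<zeta> x) = - (LINT x|lebesgue_on \<Omega>. g2 x $ j * \<zeta> x)"
      unfolding has_weak_gradientD[OF g1 z, symmetric] has_weak_gradientD[OF g2 z, symmetric] ..
    then show "(LINT x|lebesgue_on \<Omega>. \<zeta> x * (g1 x $ j - g2 x $ j)) = 0"
      using i by (simp add: right_diff_distrib mult.commute)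
  qed
  then have "AE x in lebesgue_on \<Omega>. \<forall>j. g1 x $ j - g2 x $ j = 0"
    by (simp add: AE_all_countable)
  then show ?thesis by eventually_elim (simp add: vec_eq_iff)
qed

section \<open>The cofactor matrix is divergence free\<close>

lemma dir_deriv_cmult: "smooth f \<Longrightarrow> dir_deriv (\<lambda>x. c * f x) v = (\<lambda>x. c * dir_deriv f v x :: real)"
  by (rule ext, rule dir_deriv_eq) (auto intro!: derivative_eq_intros smooth_has_derivative)

lemma mollifier_second_derivative_symmetric: "dir_deriv (dir_deriv (mollifier r) v) w = dir_deriv (dir_deriv (mollifier r) w) v"
proof -
  have e: "mollifier r = (\<lambda>x::'a. inverse (LINT x|lborel. bump 0 r (x::'a)) * bump 0 r x)"
    by (simp add: fun_eq_iff mollifier_def divide_inverse mult.commute)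
  show ?thesis
    unfolding e dir_deriv_cmult[OF smooth_bump] dir_deriv_cmult[OF smooth_dir_deriv[OF smooth_bump]]
    by (simp add: fun_eq_iff bump_second_derivative_symmetric[where v = v and w = w])
qed

lemma mollify_second_derivative_symmetric:
  assumes r: "r > 0" and f: "integrable lebesgue f"
  shows "dir_deriv (dir_deriv (mollify r f) v) w = dir_deriv (dir_deriv (mollify r f) w) v"
  unfolding mollify_def conv_dir_deriv[OF kernel_mollifier[OF r] f] conv_dir_deriv[OF kernel_dir_deriv[OF kernel_mollifier[OF r]] f]
  by (simp only: mollifier_second_derivative_symmetric[of r v w])

lemma mollify_row:
  fixes G :: "real^'n \<Rightarrow> real^'n^'m"
  assumes "r > 0" "integrable lebesgue (cutoff K G)"
  shows "mollify r (cutoff K (\<lambda>x. G x $ k)) x = mollify r (cutoff K G) x $ k"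
proof -
  have "cutoff K (\<lambda>y. G y $ k) = (\<lambda>y. cutoff K G y $ k)" by (simp add: cutoff_def)
  then show ?thesis
    unfolding mollify_def using conv_bounded_linear[OF kernel_mollifier[OF assms(1)] assms(2) bounded_linear_vec_nth] by simp
qed

text \<open>For mollifications of \<open>u\<close> the integrand is the determinant of the gradients of the components of \<open>u\<close>, with the
  \<open>i\<close>-th component replaced by \<open>\<psi>\<close>. To pass to the limit, the cofactors of the mollified Jacobian are
  bounded by a constant times its norm to the power $n-1$, hence by the mollification of that power of \<open>norm \<circ> G\<close>.\<close>

lemma weak_piola:
  fixes u :: "real^'n \<Rightarrow> real^'n" and G :: "real^'n \<Rightarrow> real^'n^'n"
  assumes n: "CARD('n) \<ge> 2" and \<Omega>: "open \<Omega>" and G: "has_weak_jacobian u G \<Omega>" "G \<in> Lp_loc 1 \<Omega>"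
    and Gn: "(\<lambda>x. norm (G x) ^ (CARD('n) - 1)) \<in> Lp_loc 1 \<Omega>"
    and \<psi>: "\<psi> \<in> Cinfc \<Omega>"
  shows "(LINT x|lebesgue_on \<Omega>. cof (G x) $ i \<bullet> grad \<psi> x) = 0"
proof -
  obtain K where K: "compact K" "K \<subseteq> \<Omega>" "smooth \<psi>" "\<And>x. x \<notin> K \<Longrightarrow> \<psi> x = 0" "\<And>x v. x \<notin> K \<Longrightarrow> dir_deriv \<psi> v x = 0"
    using Cinfc_E[OF \<psi>] by metis
  obtain e K' where e: "e > 0" "compact K'" "K' \<subseteq> \<Omega>" "K \<subseteq> K'" "\<And>x. x \<in> K \<Longrightarrow> cball x e \<subseteq> K'"
    using compact_thicken[OF K(1) \<Omega> K(2)] by metis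
  have g0: "grad \<psi> x = 0" if "x \<notin> K" for x using K(5)[OF that] by (simp add: vec_eq_iff grad_nth)
  obtain B where B: "B \<ge> 0" "\<And>x. norm (grad \<psi> x) \<le> B"
    using compact_support_bounded[OF continuous_grad[OF K(3)] K(1) g0] by metis
  define N where "N = CARD('n) - 1"
  have N: "N \<ge> 1" using n by (simp add: N_def)
  define m where "m = cutoff K' G"
  have m: "integrable lebesgue m" unfolding m_def by (rule Lp_loc_1_cutoff[OF G(2) e(2,3)])
  have "(\<lambda>x. norm (m x) ^ N) = cutoff K' (\<lambda>x. norm (G x) ^ N)"
    using N by (auto simp: fun_eq_iff m_def cutoff_def indicator_def)
  then have mN: "integrable lebesgue (\<lambda>x. norm (m x) ^ N)"
    using Lp_loc_1_cutoff[OF Gn e(2,3)] by (simp add: N_def)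
  define C where "C = fact CARD('n) * B"
  have C: "C \<ge> 0" using B by (simp add: C_def)
  have ui: "integrable lebesgue (cutoff K' (\<lambda>x. u x $ k))" for k
    using G(1) by (intro Lp_loc_1_cutoff[OF _ e(2,3)]) (simp add: has_weak_jacobian_def has_weak_gradient_def)
  have "(LINT x|lebesgue_on K. cof (m x) $ i \<bullet> grad \<psi> x) = 0"
  proof (rule mollify_limit[OF m K(1), where T = "\<lambda>x A. cof A $ i \<bullet> grad \<psi> x" and F = "\<lambda>y. C * norm (m y) ^ N" and H = "\<lambda>_. 0"])
    have gm: "grad \<psi> \<in> borel_measurable (lebesgue_on K)"
      by (intro measurable_restrict_space1 continuous_borel_measurable_lebesgue continuous_grad K)
    show "(\<lambda>x. cof (m x) $ i \<bullet> grad \<psi> x) \<in> borel_measurable (lebesgue_on K)"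
      by (intro borel_measurable_cof_row_inner gm measurable_restrict_space1 borel_measurable_integrable m)
    show "(\<lambda>x. cof (mollify (radius k) m x) $ i \<bullet> grad \<psi> x) \<in> borel_measurable (lebesgue_on K)" for k
      by (intro borel_measurable_cof_row_inner gm measurable_restrict_space1 borel_measurable_integrable mollify_young m radius_pos)
    show "continuous_on UNIV (\<lambda>A. cof A $ i \<bullet> grad \<psi> x)" for x
      using continuous_on_compose2[OF continuous_cof_row_inner[of i], of UNIV "\<lambda>A. (grad \<psi> x, A)"]
      by (simp add: continuous_on_Pair)
    show "integrable lebesgue (\<lambda>y. C * norm (m y) ^ N)" using mN by simp
    show "AE x in lebesgue_on K. \<bar>cof (mollify (radius k) m x) $ i \<bullet> grad \<psi> x\<bar> \<le> mollify (radius k) (\<lambda>y. C * norm (m y) ^ N) x + 0" for k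
    proof (rule AE_I2)
      fix x
      have "\<bar>cof (mollify (radius k) m x) $ i \<bullet> grad \<psi> x\<bar> \<le> fact CARD('n) * norm (grad \<psi> x) * norm (mollify (radius k) m x) ^ N"
        unfolding N_def by (rule cof_row_inner_bound)
      also have "\<dots> \<le> C * mollify (radius k) (\<lambda>y. norm (m y) ^ N) x"
        unfolding C_def using B by (intro mult_mono mollify_jensen radius_pos m N mN) auto
      also have "\<dots> = mollify (radius k) (\<lambda>y. C * norm (m y) ^ N) x"
        unfolding mollify_def
        by (rule conv_bounded_linear[OF kernel_mollifier[OF radius_pos] mN bounded_linear_mult_right, symmetric])
      finally show "\<bar>cof (mollify (radius k) m x) $ i \<bullet> grad \<psi> x\<bar> \<le> mollify (radius k) (\<lambda>y. C * norm (m y) ^ N) x + 0"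
        by simp
    qed
    have "\<forall>\<^sub>F k in sequentially. radius k < e" by (rule radius_eventually[OF e(1)])
    then show "\<forall>\<^sub>F k in sequentially. (LINT x|lebesgue_on K. cof (mollify (radius k) m x) $ i \<bullet> grad \<psi> x) = 0"
    proof eventually_elim
      case (elim k)
      define w where "w = (\<lambda>l. if l = i then \<psi> else mollify (radius k) (cutoff K' (\<lambda>x. u x $ l)))"
      have "(LINT x|lebesgue_on K. cof (mollify (radius k) m x) $ i \<bullet> grad \<psi> x)
          = (LINT x|lebesgue. det (\<chi> l j. dir_deriv (w l) (axis j 1) x))"
      proof (rule lebesgue_on_integral_eq)
        fix x
        show "det (\<chi> l j. dir_deriv (w l) (axis j 1) x) = 0" if "x \<notin> K"
        proof (rule det_zero_row(1))
          have "dir_deriv (w i) v x = 0" for v using K(5)[OF that] by (simp add: w_def)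
          then show "row i (\<chi> l j. dir_deriv (w l) (axis j 1) x) = 0" by (simp add: row_def vec_eq_iff)
        qed
        assume "x \<in> K"
        then have c: "cball x (radius k) \<subseteq> K'" using e(5)[of x] elim by (auto simp: subset_iff)
        have "dir_deriv (w l) (axis j 1) x = mollify (radius k) m x $ l $ j" if "l \<noteq> i" for l j
        proof -
          have "has_weak_gradient (\<lambda>x. u x $ l) (\<lambda>x. G x $ l) \<Omega>"
            using G(1) by (simp add: has_weak_jacobian_def)
          from mollify_weak_gradient[OF this \<Omega> e(2,3) radius_pos c, of j]
          show ?thesis using that mollify_row[OF radius_pos m[unfolded m_def]] by (simp add: w_def m_def)
        qed
        then show "det (\<chi> l j. dir_deriv (w l) (axis j 1) x) = cof (mollify (radius k) m x) $ i \<bullet> grad \<psi> x"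
          unfolding cof_row_inner by (intro arg_cong[of _ _ det]) (auto simp: vec_eq_iff w_def grad_nth)
      qed (use lmeasurable_compact[OF K(1)] in auto)
      also have "\<dots> = 0"
      proof (rule integral_det_gradients_eq_0[where i = i, OF _ K(1)])
        show "smooth (w l)" for l by (auto simp: w_def K smooth_mollify radius_pos ui)
        show "dir_deriv (dir_deriv (w l) a) b x = dir_deriv (dir_deriv (w l) b) a x" if "l \<noteq> i" for l a b x
          using that fun_cong[OF mollify_second_derivative_symmetric[OF radius_pos ui]] by (simp add: w_def)
      qed (simp add: w_def K)
      finally show ?case .
    qed
  qed simp
  also have "(LINT x|lebesgue_on K. cof (m x) $ i \<bullet> grad \<psi> x) = (LINT x|lebesgue_on K. cof (G x) $ i \<bullet> grad \<psi> x)"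
    using e(4) by (intro Bochner_Integration.integral_cong refl) (auto simp: m_def cutoff_in space_restrict_space subset_iff)
  also have "\<dots> = (LINT x|lebesgue_on \<Omega>. cof (G x) $ i \<bullet> grad \<psi> x)"
    by (rule lebesgue_on_support[OF \<Omega> K(1,2), symmetric]) (simp add: g0)
  finally show ?thesis by simp
qed

section \<open>Product rule for divergence free fields\<close>

text \<open>Local integrability of the product of \<open>\<Phi>\<close> and \<open>V\<close> in a form that survives mollification of \<open>\<Phi>\<close>: since the
  bound separates the variables, averaging over \<open>y\<close> bounds the mollification of \<open>\<Phi>\<close> at \<open>x\<close> times \<open>V x\<close> by the
  mollification of \<open>F\<close> plus \<open>H\<close>. The predicate \<open>P\<close> excludes a null set.\<close>

definition locally_dominated ::
  "('a::euclidean_space \<Rightarrow> 'b::real_normed_vector) \<Rightarrow> ('a \<Rightarrow> 'c::real_normed_vector) \<Rightarrow> 'a set \<Rightarrow> bool" where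
  "locally_dominated \<Phi> V \<Omega> \<longleftrightarrow> (\<forall>K. compact K \<and> K \<subseteq> \<Omega> \<longrightarrow>
     (\<exists>F H P. integrable (lebesgue_on K) F \<and> integrable (lebesgue_on K) H \<and> (\<forall>x. F x \<ge> 0 \<and> H x \<ge> 0)
        \<and> (AE x in lebesgue_on K. P x)
        \<and> (\<forall>x\<in>K. \<forall>y\<in>K. P x \<longrightarrow> P y \<longrightarrow> norm (\<Phi> y) * norm (V x) \<le> F y + H x)))"

lemma locally_dominatedE:
  assumes "locally_dominated \<Phi> V \<Omega>" "compact K" "K \<subseteq> \<Omega>"
  obtains F H P where "integrable (lebesgue_on K) F" "integrable (lebesgue_on K) H"
    "\<And>x. F x \<ge> 0" "\<And>x. H x \<ge> 0" "AE x in lebesgue_on K. P x"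
    "\<And>x y. x \<in> K \<Longrightarrow> y \<in> K \<Longrightarrow> P x \<Longrightarrow> P y \<Longrightarrow> norm (\<Phi> y) * norm (V x) \<le> F y + H x"
proof -
  from assms(1) have "compact K \<and> K \<subseteq> \<Omega> \<longrightarrow>
     (\<exists>F H P. integrable (lebesgue_on K) F \<and> integrable (lebesgue_on K) H \<and> (\<forall>x. F x \<ge> 0 \<and> H x \<ge> 0)
        \<and> (AE x in lebesgue_on K. P x)
        \<and> (\<forall>x\<in>K. \<forall>y\<in>K. P x \<longrightarrow> P y \<longrightarrow> norm (\<Phi> y) * norm (V x) \<le> F y + H x))"
    unfolding locally_dominated_def by (rule spec)
  with assms(2,3) obtain F H P where "integrable (lebesgue_on K) F" "integrable (lebesgue_on K) H"
      "\<forall>x. F x \<ge> 0 \<and> H x \<ge> 0" "AE x in lebesgue_on K. P x"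
      "\<forall>x\<in>K. \<forall>y\<in>K. P x \<longrightarrow> P y \<longrightarrow> norm (\<Phi> y) * norm (V x) \<le> F y + H x"
    by blast
  then show ?thesis by (intro that[of F H P]) auto
qed

lemma locally_dominated_Pair:
  assumes f: "locally_dominated f V \<Omega>" and g: "locally_dominated g V \<Omega>"
  shows "locally_dominated (\<lambda>y. (f y, g y)) V \<Omega>"
  unfolding locally_dominated_def
proof (intro allI impI)
  fix K assume K: "compact K \<and> K \<subseteq> \<Omega>"
  obtain F1 H1 P1 where 1: "integrable (lebesgue_on K) F1" "integrable (lebesgue_on K) H1"
    "\<And>x. F1 x \<ge> 0" "\<And>x. H1 x \<ge> 0" "AE x in lebesgue_on K. P1 x"
    "\<And>x y. x \<in> K \<Longrightarrow> y \<in> K \<Longrightarrow> P1 x \<Longrightarrow> P1 y \<Longrightarrow> norm (f y) * norm (V x) \<le> F1 y + H1 x"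
    using locally_dominatedE[OF f] K by blast
  obtain F2 H2 P2 where 2: "integrable (lebesgue_on K) F2" "integrable (lebesgue_on K) H2"
    "\<And>x. F2 x \<ge> 0" "\<And>x. H2 x \<ge> 0" "AE x in lebesgue_on K. P2 x"
    "\<And>x y. x \<in> K \<Longrightarrow> y \<in> K \<Longrightarrow> P2 x \<Longrightarrow> P2 y \<Longrightarrow> norm (g y) * norm (V x) \<le> F2 y + H2 x"
    using locally_dominatedE[OF g] K by blast
  have "norm (f y, g y) * norm (V x) \<le> (F1 y + F2 y) + (H1 x + H2 x)"
    if "x \<in> K" "y \<in> K" "P1 x \<and> P2 x" "P1 y \<and> P2 y" for x y
  proof -
    have "norm (f y, g y) * norm (V x) \<le> (norm (f y) + norm (g y)) * norm (V x)"
      by (intro mult_right_mono norm_Pair_le) auto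
    then show ?thesis using 1(6)[of x y] 2(6)[of x y] that by (simp add: distrib_right)
  qed
  moreover have "AE x in lebesgue_on K. P1 x \<and> P2 x"
    using 1(5) 2(5) by eventually_elim simp
  ultimately show "\<exists>F H P. integrable (lebesgue_on K) F \<and> integrable (lebesgue_on K) H \<and> (\<forall>x. F x \<ge> 0 \<and> H x \<ge> 0)
        \<and> (AE x in lebesgue_on K. P x)
        \<and> (\<forall>x\<in>K. \<forall>y\<in>K. P x \<longrightarrow> P y \<longrightarrow> norm (f y, g y) * norm (V x) \<le> F y + H x)"
    using 1(1-4) 2(1-4)
    by (intro exI[of _ "\<lambda>y. F1 y + F2 y"] exI[of _ "\<lambda>y. H1 y + H2 y"] exI[of _ "\<lambda>x. P1 x \<and> P2 x"]) auto
qed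

lemma AE_in_lebesgue_on: "AE x in lebesgue_on S. x \<in> S"
  by (rule AE_I2) (simp add: space_restrict_space)

lemma locally_dominated_inner:
  fixes g V :: "'a::euclidean_space \<Rightarrow> 'b::euclidean_space"
  assumes d: "locally_dominated g V \<Omega>" and "g \<in> borel_measurable (lebesgue_on \<Omega>)" "V \<in> borel_measurable (lebesgue_on \<Omega>)"
  shows "(\<lambda>x. V x \<bullet> g x) \<in> Lp_loc 1 \<Omega>"
  unfolding Lp_loc_1_iff
proof (intro conjI allI impI)
  show m: "(\<lambda>x. V x \<bullet> g x) \<in> borel_measurable (lebesgue_on \<Omega>)"
    by (rule borel_measurable_inner[OF assms(3,2)])
  fix K assume K: "compact K \<and> K \<subseteq> \<Omega>"
  obtain F H P where 1: "integrable (lebesgue_on K) F" "integrable (lebesgue_on K) H"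
    "\<And>x. F x \<ge> 0" "\<And>x. H x \<ge> 0" "AE x in lebesgue_on K. P x"
    "\<And>x y. x \<in> K \<Longrightarrow> y \<in> K \<Longrightarrow> P x \<Longrightarrow> P y \<Longrightarrow> norm (g y) * norm (V x) \<le> F y + H x"
    using locally_dominatedE[OF d] K by blast
  show "integrable (lebesgue_on K) (\<lambda>x. V x \<bullet> g x)"
  proof (rule Bochner_Integration.integrable_bound[where f = "\<lambda>x. F x + H x"])
    show "AE x in lebesgue_on K. norm (V x \<bullet> g x) \<le> norm (F x + H x)"
      using 1(5) AE_in_lebesgue_on
    proof eventually_elim
      case (elim x)
      have "norm (V x \<bullet> g x) \<le> norm (g x) * norm (V x)"
        using Cauchy_Schwarz_ineq2[of "V x" "g x"] by (simp add: mult.commute)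
      also have "\<dots> \<le> F x + H x" using 1(6) elim by blast
      finally show ?case by simp
    qed
    show "integrable (lebesgue_on K) (\<lambda>x. F x + H x)" using 1(1,2) by simp
    show "(\<lambda>x. V x \<bullet> g x) \<in> borel_measurable (lebesgue_on K)"
      using measurable_restrict_mono[OF m] K by blast
  qed
qed

lemma mollify_cutoff_Pair:
  fixes f :: "'a::euclidean_space \<Rightarrow> 'b::euclidean_space" and g :: "'a \<Rightarrow> 'c::euclidean_space"
  assumes r: "r > 0" and f: "integrable lebesgue (cutoff K f)" and g: "integrable lebesgue (cutoff K g)"
  shows "mollify r (cutoff K (\<lambda>y. (f y, g y))) x = (mollify r (cutoff K f) x, mollify r (cutoff K g) x)"
    and "integrable lebesgue (cutoff K (\<lambda>y. (f y, g y)))"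
proof -
  have eq: "cutoff K (\<lambda>y. (f y, g y)) = (\<lambda>y. (cutoff K f y, cutoff K g y))"
    by (simp add: cutoff_def fun_eq_iff)
  show i: "integrable lebesgue (cutoff K (\<lambda>y. (f y, g y)))"
    unfolding eq using f g by (rule integrable_Pair)
  show "mollify r (cutoff K (\<lambda>y. (f y, g y))) x = (mollify r (cutoff K f) x, mollify r (cutoff K g) x)"
    using conv_bounded_linear[OF kernel_mollifier[OF r] i bounded_linear_fst, of x]
      conv_bounded_linear[OF kernel_mollifier[OF r] i bounded_linear_snd, of x]
    by (simp add: mollify_def eq prod_eq_iff)
qed

lemma mollify_grad:
  fixes f :: "real^'n \<Rightarrow> real"
  assumes "has_weak_gradient f g \<Omega>" "open \<Omega>" "compact K" "K \<subseteq> \<Omega>" "r > 0" "cball x r \<subseteq> K"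
  shows "grad (mollify r (cutoff K f)) x = mollify r (cutoff K g) x"
  using mollify_weak_gradient[OF assms] by (simp add: vec_eq_iff grad_nth)

lemma Cinfc_mult:
  fixes f \<zeta> :: "'a::euclidean_space \<Rightarrow> real"
  assumes "smooth f" "smooth \<zeta>" "compact K" "K \<subseteq> \<Omega>" "\<And>x. x \<notin> K \<Longrightarrow> \<zeta> x = 0"
  shows "(\<lambda>x. f x * \<zeta> x) \<in> Cinfc \<Omega>"
  unfolding Cinfc_iff using assms by (auto intro!: smooth_mult compact_support_inI[of K])

text \<open>Test the divergence free field \<open>V\<close> with the product of \<open>\<zeta>\<close> and a mollification of \<open>f\<close>.\<close>

lemma div_free_weak_product:
  fixes V g :: "real^'n \<Rightarrow> real^'n" and f :: "real^'n \<Rightarrow> real"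
  assumes \<Omega>: "open \<Omega>" and V: "V \<in> borel_measurable (lebesgue_on \<Omega>)"
    and div: "\<And>\<psi>. \<psi> \<in> Cinfc \<Omega> \<Longrightarrow> (LINT x|lebesgue_on \<Omega>. V x \<bullet> grad \<psi> x) = 0"
    and wg: "has_weak_gradient f g \<Omega>"
    and dom: "locally_dominated (\<lambda>y. (f y, g y)) V \<Omega>"
    and \<zeta>: "\<zeta> \<in> Cinfc \<Omega>"
  shows "(LINT x|lebesgue_on \<Omega>. V x \<bullet> (f x *\<^sub>R grad \<zeta> x + \<zeta> x *\<^sub>R g x)) = 0"
proof -
  obtain K where K: "compact K" "K \<subseteq> \<Omega>" "smooth \<zeta>" "\<And>x. x \<notin> K \<Longrightarrow> \<zeta> x = 0" "\<And>x v. x \<notin> K \<Longrightarrow> dir_deriv \<zeta> v x = 0"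
    using Cinfc_E[OF \<zeta>] by metis
  have g0: "grad \<zeta> x = 0" if "x \<notin> K" for x
    using K(5)[OF that] by (simp add: vec_eq_iff grad_nth)
  obtain e K' where e: "e > 0" "compact K'" "K' \<subseteq> \<Omega>" "K \<subseteq> K'" "\<And>x. x \<in> K \<Longrightarrow> cball x e \<subseteq> K'"
    using compact_thicken[OF K(1) \<Omega> K(2)] by metis
  obtain B1 where B1: "B1 \<ge> 0" "\<And>x. norm (grad \<zeta> x) \<le> B1"
    using compact_support_bounded[OF continuous_grad[OF K(3)] K(1) g0] by metis
  obtain B2 where B2: "B2 \<ge> 0" "\<And>x. norm (\<zeta> x) \<le> B2"
    using compact_support_bounded[OF smooth_continuous[OF K(3)] K(1,4)] by metis
  define B where "B = B1 + B2"
  have B: "B \<ge> 0" using B1 B2 by (simp add: B_def)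
  obtain F H P where d: "integrable (lebesgue_on K') F" "integrable (lebesgue_on K') H"
    "\<And>x. F x \<ge> 0" "\<And>x. H x \<ge> 0" "AE x in lebesgue_on K'. P x"
    "\<And>x y. x \<in> K' \<Longrightarrow> y \<in> K' \<Longrightarrow> P x \<Longrightarrow> P y \<Longrightarrow> norm (f y, g y) * norm (V x) \<le> F y + H x"
    using locally_dominatedE[OF dom e(2,3)] by blast
  have K's: "K' \<in> sets lebesgue" and Ks: "K \<in> sets lebesgue"
    using lmeasurable_compact[OF e(2)] lmeasurable_compact[OF K(1)] by auto
  have fi: "integrable lebesgue (cutoff K' f)" and gi: "integrable lebesgue (cutoff K' g)"
    using wg e by (auto simp: has_weak_gradient_def intro!: Lp_loc_1_cutoff)
  define m where "m = cutoff K' (\<lambda>y. (f y, g y))"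
  have m: "integrable lebesgue m"
    unfolding m_def by (rule mollify_cutoff_Pair(2)[OF radius_pos[of 0] fi gi])
  have mm: "mollify (radius k) m x = (mollify (radius k) (cutoff K' f) x, mollify (radius k) (cutoff K' g) x)" for k x
    unfolding m_def by (rule mollify_cutoff_Pair(1)[OF radius_pos fi gi])
  have Fi: "integrable lebesgue (cutoff K' F)" using d(1) by (simp add: integrable_cutoff K's)
  have "integrable lebesgue (cutoff K' H)" using d(2) by (simp add: integrable_cutoff K's)
  then have Hi: "integrable (lebesgue_on K) (cutoff K' H)" by (rule lebesgue_on_integrable[OF Ks])
  have Vm: "V \<in> borel_measurable (lebesgue_on K)" using measurable_restrict_mono[OF V K(2)] .
  define T where "T = (\<lambda>x (z :: real \<times> (real^'n)). V x \<bullet> (fst z *\<^sub>R grad \<zeta> x + \<zeta> x *\<^sub>R snd z))"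
  have Tm: "(\<lambda>x. T x (q x)) \<in> borel_measurable (lebesgue_on K)" if q: "integrable lebesgue q" for q
  proof -
    have "(\<lambda>x. fst (q x)) \<in> borel_measurable (lebesgue_on K)" "(\<lambda>x. snd (q x)) \<in> borel_measurable (lebesgue_on K)"
      by (intro measurable_restrict_space1 borel_measurable_integrable
          integrable_bounded_linear[OF bounded_linear_fst q] integrable_bounded_linear[OF bounded_linear_snd q])+
    moreover have "grad \<zeta> \<in> borel_measurable (lebesgue_on K)" "\<zeta> \<in> borel_measurable (lebesgue_on K)"
      by (intro measurable_restrict_space1 continuous_borel_measurable_lebesgue continuous_grad smooth_continuous K)+
    ultimately show ?thesis unfolding T_def using Vm by measurable
  qed
  have "(LINT x|lebesgue_on K. T x (m x)) = 0"
  proof (rule mollify_limit[OF m K(1), where F = "\<lambda>y. B * cutoff K' F y" and H = "\<lambda>x. B * cutoff K' H x"])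
    show "(\<lambda>x. T x (mollify (radius k) m x)) \<in> borel_measurable (lebesgue_on K)" for k
      by (intro Tm mollify_young radius_pos m)
    show "(\<lambda>x. T x (m x)) \<in> borel_measurable (lebesgue_on K)" by (rule Tm[OF m])
    show "continuous_on UNIV (T x)" for x unfolding T_def by (intro continuous_intros)
    show "integrable lebesgue (\<lambda>y. B * cutoff K' F y)" using Fi by simp
    show "integrable (lebesgue_on K) (\<lambda>x. B * cutoff K' H x)" using Hi by simp
    show "AE x in lebesgue_on K. \<bar>T x (mollify (radius k) m x)\<bar> \<le> mollify (radius k) (\<lambda>y. B * cutoff K' F y) x + B * cutoff K' H x" for k
    proof -
      have "AE x in lebesgue_on K. P x" by (rule AE_lebesgue_on_subset[OF d(5) e(4) K's Ks])
      then show ?thesis using AE_in_lebesgue_on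
      proof eventually_elim
        case (elim x)
        let ?z = "mollify (radius k) m x"
        have x: "x \<in> K'" using elim e(4) by auto
        have t1: "\<bar>T x ?z\<bar> \<le> norm (V x) * norm (fst ?z *\<^sub>R grad \<zeta> x + \<zeta> x *\<^sub>R snd ?z)"
          unfolding T_def by (rule Cauchy_Schwarz_ineq2)
        have t2: "norm (fst ?z *\<^sub>R grad \<zeta> x + \<zeta> x *\<^sub>R snd ?z) \<le> norm ?z * B1 + B2 * norm ?z"
        proof (rule order_trans[OF norm_triangle_ineq add_mono])
          show "norm (fst ?z *\<^sub>R grad \<zeta> x) \<le> norm ?z * B1"
            unfolding norm_scaleR using B1 norm_fst_le[of "fst ?z" "snd ?z"] by (intro mult_mono) auto
          show "norm (\<zeta> x *\<^sub>R snd ?z) \<le> B2 * norm ?z"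
            unfolding norm_scaleR using B2 norm_snd_le[of "snd ?z" "fst ?z"] by (intro mult_mono) auto
        qed
        have "\<bar>T x ?z\<bar> \<le> norm (V x) * (norm ?z * B1 + B2 * norm ?z)"
          by (rule order_trans[OF t1 mult_left_mono[OF t2 norm_ge_zero]])
        also have "\<dots> = B * (norm ?z * norm (V x))" by (simp add: B_def algebra_simps)
        finally have t3: "\<bar>T x ?z\<bar> \<le> B * (norm ?z * norm (V x))" .
        have t4: "norm ?z * norm (V x) \<le> mollify (radius k) (cutoff K' F) x + H x"
        proof (rule mollify_bound[OF radius_pos m Fi norm_ge_zero])
          have "AE y in lebesgue. y \<in> K' \<longrightarrow> P y" using d(5) by (simp add: AE_lebesgue_on_iff K's)
          then show "AE y in lebesgue. norm (m y) * norm (V x) \<le> cutoff K' F y + H x"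
          proof eventually_elim
            fix y assume y: "y \<in> K' \<longrightarrow> P y"
            show "norm (m y) * norm (V x) \<le> cutoff K' F y + H x"
              using d(6)[of x y] y x elim d(4)[of x] by (cases "y \<in> K'") (auto simp: m_def cutoff_in cutoff_notin)
          qed
        qed
        note t3
        also have "B * (norm ?z * norm (V x)) \<le> B * (mollify (radius k) (cutoff K' F) x + H x)"
          by (rule mult_left_mono[OF t4 B])
        also have "B * (mollify (radius k) (cutoff K' F) x + H x) = B * mollify (radius k) (cutoff K' F) x + B * cutoff K' H x"
          using x by (simp add: distrib_left cutoff_in)
        also have "B * mollify (radius k) (cutoff K' F) x = mollify (radius k) (\<lambda>y. B * cutoff K' F y) x"
          unfolding mollify_def
          by (rule conv_bounded_linear[OF kernel_mollifier[OF radius_pos] Fi bounded_linear_mult_right, symmetric])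
        finally show ?case .
      qed
    qed
    have "\<forall>\<^sub>F k in sequentially. radius k < e" by (rule radius_eventually[OF e(1)])
    then show "\<forall>\<^sub>F k in sequentially. (LINT x|lebesgue_on K. T x (mollify (radius k) m x)) = 0"
    proof eventually_elim
      case (elim k)
      let ?p = "mollify (radius k) (cutoff K' f)"
      have p: "smooth ?p" by (rule smooth_mollify[OF radius_pos fi])
      have "(LINT x|lebesgue_on K. T x (mollify (radius k) m x)) = (LINT x|lebesgue_on K. V x \<bullet> grad (\<lambda>x. ?p x * \<zeta> x) x)"
      proof (rule Bochner_Integration.integral_cong[OF refl])
        fix x assume "x \<in> space (lebesgue_on K)"
        then have "x \<in> K" by (simp add: space_restrict_space)
        then have c: "cball x (radius k) \<subseteq> K'" using e(5)[of x] elim by (auto simp: subset_iff)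
        show "T x (mollify (radius k) m x) = V x \<bullet> grad (\<lambda>x. ?p x * \<zeta> x) x"
          unfolding T_def mm grad_mult[OF p K(3)] mollify_grad[OF wg \<Omega> e(2,3) radius_pos c] by simp
      qed
      also have "\<dots> = (LINT x|lebesgue_on \<Omega>. V x \<bullet> grad (\<lambda>x. ?p x * \<zeta> x) x)"
        by (rule lebesgue_on_support[OF \<Omega> K(1,2), symmetric]) (simp add: grad_mult[OF p K(3)] g0 K(4))
      also have "\<dots> = 0"
        by (rule div[OF Cinfc_mult[OF p K(3,1,2,4)]])
      finally show ?case .
    qed
  qed
  also have "(LINT x|lebesgue_on K. T x (m x)) = (LINT x|lebesgue_on K. V x \<bullet> (f x *\<^sub>R grad \<zeta> x + \<zeta> x *\<^sub>R g x))"
    using e(4) by (intro Bochner_Integration.integral_cong refl) (auto simp: T_def m_def cutoff_in space_restrict_space subset_iff)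
  also have "\<dots> = (LINT x|lebesgue_on \<Omega>. V x \<bullet> (f x *\<^sub>R grad \<zeta> x + \<zeta> x *\<^sub>R g x))"
    by (rule lebesgue_on_support[OF \<Omega> K(1,2), symmetric]) (simp add: g0 K(4))
  finally show ?thesis by simp
qed

section \<open>Weak gradients vanish on level sets\<close>

text \<open>The product of \<open>\<zeta>\<close> with \<open>\<phi>\<close> composed with a mollification of \<open>f\<close> has compact support, so its partial
  derivative has integral zero; boundedness of \<open>\<phi>\<close> and \<open>\<phi>'\<close> dominates the limit.\<close>

lemma weak_chain_rule:
  fixes f :: "real^'n \<Rightarrow> real"
  assumes \<Omega>: "open \<Omega>" and wg: "has_weak_gradient f g \<Omega>"
    and \<phi>: "\<And>s. (\<phi> has_real_derivative \<phi>' s) (at s)" "continuous_on UNIV \<phi>'"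
      "\<And>s. \<bar>\<phi> s\<bar> \<le> B0" "\<And>s. \<bar>\<phi>' s\<bar> \<le> B1"
    and K: "compact K" "K \<subseteq> \<Omega>" "smooth \<zeta>" "\<And>x. x \<notin> K \<Longrightarrow> \<zeta> x = 0"
  shows "(LINT x|lebesgue_on K. \<phi> (f x) * dir_deriv \<zeta> (axis j 1) x + \<phi>' (f x) * g x $ j * \<zeta> x) = 0"
proof -
  let ?e = "axis j 1 :: real^'n"
  have dz: "dir_deriv \<zeta> v x = 0" if "x \<notin> K" for x v
    by (rule dir_deriv_eq_0_open[of "- K"]) (use that K compact_imp_closed in auto)
  obtain e K' where e: "e > 0" "compact K'" "K' \<subseteq> \<Omega>" "K \<subseteq> K'" "\<And>x. x \<in> K \<Longrightarrow> cball x e \<subseteq> K'"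
    using compact_thicken[OF K(1) \<Omega> K(2)] by metis
  obtain C1 where C1: "C1 \<ge> 0" "\<And>x. norm (dir_deriv \<zeta> ?e x) \<le> C1"
    using compact_support_bounded[OF smooth_continuous[OF smooth_dir_deriv[OF K(3)]] K(1) dz] by metis
  obtain C2 where C2: "C2 \<ge> 0" "\<And>x. norm (\<zeta> x) \<le> C2"
    using compact_support_bounded[OF smooth_continuous[OF K(3)] K(1,4)] by metis
  have B: "B0 \<ge> 0" "B1 \<ge> 0" using \<phi>(3,4)[of 0] by auto
  have fi: "integrable lebesgue (cutoff K' f)" and gi: "integrable lebesgue (cutoff K' g)"
    using wg e by (auto simp: has_weak_gradient_def intro!: Lp_loc_1_cutoff)
  define m where "m = cutoff K' (\<lambda>y. (f y, g y))"
  have m: "integrable lebesgue m"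
    unfolding m_def by (rule mollify_cutoff_Pair(2)[OF radius_pos[of 0] fi gi])
  have mm: "mollify (radius k) m x = (mollify (radius k) (cutoff K' f) x, mollify (radius k) (cutoff K' g) x)" for k x
    unfolding m_def by (rule mollify_cutoff_Pair(1)[OF radius_pos fi gi])
  have c\<phi>: "continuous_on UNIV \<phi>"
    by (rule continuous_at_imp_continuous_on) (use \<phi>(1) DERIV_isCont in blast)
  define T where "T = (\<lambda>x (z :: real \<times> (real^'n)). \<phi> (fst z) * dir_deriv \<zeta> ?e x + \<phi>' (fst z) * (snd z $ j) * \<zeta> x)"
  have Tm: "(\<lambda>x. T x (q x)) \<in> borel_measurable (lebesgue_on K)" if q: "integrable lebesgue q" for q
  proof -
    have 1[measurable]: "(\<lambda>x. fst (q x)) \<in> borel_measurable (lebesgue_on K)"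
      by (intro measurable_restrict_space1 borel_measurable_integrable integrable_bounded_linear[OF bounded_linear_fst q])
    have [measurable]: "(\<lambda>x. snd (q x) $ j) \<in> borel_measurable (lebesgue_on K)"
      by (intro measurable_restrict_space1 borel_measurable_integrable
          integrable_bounded_linear[OF bounded_linear_compose[OF bounded_linear_vec_nth bounded_linear_snd] q])
    have [measurable]: "dir_deriv \<zeta> ?e \<in> borel_measurable (lebesgue_on K)" "\<zeta> \<in> borel_measurable (lebesgue_on K)"
      by (intro measurable_restrict_space1 continuous_borel_measurable_lebesgue smooth_continuous smooth_dir_deriv K)+
    have [measurable]: "(\<lambda>x. \<phi> (fst (q x))) \<in> borel_measurable (lebesgue_on K)" "(\<lambda>x. \<phi>' (fst (q x))) \<in> borel_measurable (lebesgue_on K)"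
      using measurable_compose[OF 1 borel_measurable_continuous_onI[OF c\<phi>]] measurable_compose[OF 1 borel_measurable_continuous_onI[OF \<phi>(2)]]
      by simp_all
    show ?thesis unfolding T_def by measurable
  qed
  define B where "B = B1 * C2"
  have B': "B \<ge> 0" using B C2 by (simp add: B_def)
  have "(LINT x|lebesgue_on K. T x (m x)) = 0"
  proof (rule mollify_limit[OF m K(1), where F = "\<lambda>y. B * norm (m y)" and H = "\<lambda>x. B0 * C1"])
    show "(\<lambda>x. T x (mollify (radius k) m x)) \<in> borel_measurable (lebesgue_on K)" for k
      by (intro Tm mollify_young radius_pos m)
    show "(\<lambda>x. T x (m x)) \<in> borel_measurable (lebesgue_on K)" by (rule Tm[OF m])
    have "continuous_on UNIV (\<lambda>z :: real \<times> (real^'n). \<phi> (fst z))" "continuous_on UNIV (\<lambda>z :: real \<times> (real^'n). \<phi>' (fst z))"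
      using continuous_on_compose2[OF c\<phi>, of UNIV fst] continuous_on_compose2[OF \<phi>(2), of UNIV fst]
      by (auto simp: continuous_on_fst)
    then show "continuous_on UNIV (T x)" for x unfolding T_def
      by (intro continuous_on_add continuous_on_mult continuous_on_const
          linear_continuous_on[OF bounded_linear_compose[OF bounded_linear_vec_nth bounded_linear_snd]])
    show "integrable lebesgue (\<lambda>y. B * norm (m y))" using m by simp
    show "integrable (lebesgue_on K) (\<lambda>x. B0 * C1)"
      using lmeasurable_compact[OF K(1)]
      by (simp add: lmeasurable_iff_integrable_on finite_measure_lebesgue_on finite_measure.integrable_const)
    show "AE x in lebesgue_on K. \<bar>T x (mollify (radius k) m x)\<bar> \<le> mollify (radius k) (\<lambda>y. B * norm (m y)) x + B0 * C1" for k
    proof (rule AE_I2)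
      fix x
      let ?z = "mollify (radius k) m x"
      have "\<bar>\<phi>' (fst ?z) * (snd ?z $ j) * \<zeta> x\<bar> \<le> (B1 * norm ?z) * C2"
        unfolding abs_mult
      proof (intro mult_mono)
        show "\<bar>snd ?z $ j\<bar> \<le> norm ?z"
          using component_le_norm_cart[of "snd ?z" j] norm_snd_le[of "snd ?z" "fst ?z"] by simp
      qed (use B \<phi>(4) C2 in auto)
      moreover have "\<bar>\<phi> (fst ?z) * dir_deriv \<zeta> ?e x\<bar> \<le> B0 * C1"
        unfolding abs_mult using B \<phi>(3) C1 by (intro mult_mono) auto
      moreover have "B1 * norm ?z * C2 \<le> mollify (radius k) (\<lambda>y. B * norm (m y)) x"
      proof -
        have "norm ?z * B \<le> mollify (radius k) (\<lambda>y. B * norm (m y)) x + 0"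
          by (rule mollify_bound[OF radius_pos m _ B']) (use m in \<open>auto simp: mult.commute\<close>)
        then show ?thesis by (simp add: B_def ac_simps)
      qed
      ultimately show "\<bar>T x ?z\<bar> \<le> mollify (radius k) (\<lambda>y. B * norm (m y)) x + B0 * C1"
        unfolding T_def by linarith
    qed
    have "\<forall>\<^sub>F k in sequentially. radius k < e" by (rule radius_eventually[OF e(1)])
    then show "\<forall>\<^sub>F k in sequentially. (LINT x|lebesgue_on K. T x (mollify (radius k) m x)) = 0"
    proof eventually_elim
      case (elim k)
      let ?p = "mollify (radius k) (cutoff K' f)"
      have p: "smooth ?p" by (rule smooth_mollify[OF radius_pos fi])
      define D where "D = (\<lambda>x v. \<phi> (?p x) * dir_deriv \<zeta> v x + \<phi>' (?p x) * dir_deriv ?p v x * \<zeta> x)"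
      have D: "((\<lambda>x. \<phi> (?p x) * \<zeta> x) has_derivative D x) (at x)" for x
      proof -
        have "((\<lambda>x. \<phi> (?p x)) has_derivative (\<lambda>v. \<phi>' (?p x) * dir_deriv ?p v x)) (at x)"
          using has_derivative_compose[OF smooth_has_derivative[OF p] \<phi>(1)[unfolded has_field_derivative_def]] .
        from has_derivative_mult[OF this smooth_has_derivative[OF K(3)]]
        show ?thesis unfolding D_def .
      qed
      have cp: "continuous_on UNIV (\<lambda>x. \<phi> (?p x))" "continuous_on UNIV (\<lambda>x. \<phi>' (?p x))"
        by (rule continuous_on_compose2[OF c\<phi> smooth_continuous[OF p]] continuous_on_compose2[OF \<phi>(2) smooth_continuous[OF p]]; simp)+
      have "(LINT x|lebesgue_on K. T x (mollify (radius k) m x)) = (LINT x|lebesgue. D x ?e)"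
      proof (rule lebesgue_on_integral_eq)
        fix x
        show "D x ?e = 0" if "x \<notin> K" using that by (simp add: D_def dz K)
        assume "x \<in> K"
        then have c: "cball x (radius k) \<subseteq> K'" using e(5)[of x] elim by (auto simp: subset_iff)
        show "D x ?e = T x (mollify (radius k) m x)"
          unfolding T_def D_def mm mollify_weak_gradient[OF wg \<Omega> e(2,3) radius_pos c] by simp
      qed (use lmeasurable_compact[OF K(1)] in auto)
      also have "\<dots> = 0"
      proof (rule integral_derivative_eq_0[OF D _ K(1)])
        show "continuous_on UNIV (\<lambda>x. D x ?e)"
          unfolding D_def
          by (intro continuous_on_add continuous_on_mult cp smooth_continuous smooth_dir_deriv p K)
      qed (simp add: K)
      finally show ?case .
    qed
  qed
  also have "(LINT x|lebesgue_on K. T x (m x)) = (LINT x|lebesgue_on K. \<phi> (f x) * dir_deriv \<zeta> ?e x + \<phi>' (f x) * g x $ j * \<zeta> x)"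
    using e(4) by (intro Bochner_Integration.integral_cong refl) (auto simp: T_def m_def cutoff_in space_restrict_space subset_iff)
  finally show ?thesis .
qed

text \<open>The derivative of \<open>r * arctan (t / r)\<close> with respect to \<open>t\<close>, which concentrates at \<open>t = 0\<close> as \<open>r\<close> tends to \<open>0\<close>.\<close>

lemma smoothed_indicator_tendsto:
  "(\<lambda>k. inverse (1 + (t / radius k)\<^sup>2)) \<longlonglongrightarrow> (if t = 0 then 1 else 0)"
proof (cases "t = 0")
  case False
  have "(\<lambda>k. (radius k)\<^sup>2 / t\<^sup>2) \<longlonglongrightarrow> 0\<^sup>2 / t\<^sup>2"
    by (intro tendsto_intros radius_tendsto) (use False in auto)
  then have 1: "(\<lambda>k. (radius k)\<^sup>2 / t\<^sup>2) \<longlonglongrightarrow> 0" by simp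
  have 2: "norm (inverse (1 + (t / radius k)\<^sup>2)) \<le> (radius k)\<^sup>2 / t\<^sup>2" for k
  proof -
    have "inverse (1 + (t / radius k)\<^sup>2) \<le> inverse ((t / radius k)\<^sup>2)"
      using False radius_pos[of k] by (intro le_imp_inverse_le) (auto simp: zero_less_power2)
    also have "\<dots> = (radius k)\<^sup>2 / t\<^sup>2" by (simp add: power_divide)
    finally show ?thesis by (simp add: add_nonneg_nonneg)
  qed
  show ?thesis
    using False Lim_null_comparison[OF always_eventually[OF allI[OF 2]] 1] by simp
qed simp

text \<open>Apply the chain rule to \<open>\<phi> s = r * arctan ((s - c) / r)\<close>. As \<open>r\<close> tends to \<open>0\<close>, \<open>\<phi>\<close> tends to \<open>0\<close> uniformly while its
  derivative tends to the indicator of \<open>{c}\<close>, so the integral of \<open>\<zeta> * g\<close> over the level set vanishes for every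
  test function \<open>\<zeta>\<close>.\<close>

lemma weak_gradient_level_set:
  fixes f :: "real^'n \<Rightarrow> real"
  assumes \<Omega>: "open \<Omega>" and wg: "has_weak_gradient f g \<Omega>"
  shows "AE x in lebesgue_on \<Omega>. f x = c \<longrightarrow> g x = 0"
proof -
  have fm: "f \<in> borel_measurable (lebesgue_on \<Omega>)" and gm: "g \<in> borel_measurable (lebesgue_on \<Omega>)"
    and gL: "g \<in> Lp_loc 1 \<Omega>"
    using wg by (auto simp: has_weak_gradient_def Lp_loc_1_iff)
  have "AE x in lebesgue_on \<Omega>. (if f x = c then g x $ j else 0) = 0" for j
  proof (rule fundamental_lemma[OF _ \<Omega>])
    have gj: "(\<lambda>x. g x $ j) \<in> Lp_loc 1 \<Omega>" by (rule Lp_loc_1_bounded_linear[OF bounded_linear_vec_nth gL])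
    have gjm: "(\<lambda>x. g x $ j) \<in> borel_measurable (lebesgue_on \<Omega>)" using gj by (simp add: Lp_loc_1_iff)
    let ?w = "\<lambda>x. if f x = c then g x $ j else 0"
    have wm: "?w \<in> borel_measurable (lebesgue_on \<Omega>)"
    proof -
      have "(\<lambda>x. (indicator {c} (f x) :: real) * g x $ j) \<in> borel_measurable (lebesgue_on \<Omega>)"
        using measurable_compose[OF fm, of "indicator {c}" borel] gjm by (intro borel_measurable_times) auto
      moreover have "(\<lambda>x. (indicator {c} (f x) :: real) * g x $ j) = ?w" by (auto simp: fun_eq_iff indicator_def)
      ultimately show ?thesis by simp
    qed
    show w: "?w \<in> Lp_loc 1 \<Omega>"
      unfolding Lp_loc_1_iff
    proof (intro conjI allI impI wm)
      fix K assume K: "compact K \<and> K \<subseteq> \<Omega>"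
      then have "integrable (lebesgue_on K) (\<lambda>x. g x $ j)" using gj by (simp add: Lp_loc_1_iff)
      then show "integrable (lebesgue_on K) ?w"
        by (rule Bochner_Integration.integrable_bound)
           (use measurable_restrict_mono[OF wm] K in auto)
    qed
    fix \<zeta> :: "real^'n \<Rightarrow> real" assume "\<zeta> \<in> Cinfc \<Omega>"
    then obtain K where K: "compact K" "K \<subseteq> \<Omega>" "smooth \<zeta>" "\<And>x. x \<notin> K \<Longrightarrow> \<zeta> x = 0" "\<And>x v. x \<notin> K \<Longrightarrow> dir_deriv \<zeta> v x = 0"
      by (metis Cinfc_E)
    let ?e = "axis j 1 :: real^'n"
    define I where "I = (\<lambda>k x. radius k * arctan ((f x - c) / radius k) * dir_deriv \<zeta> ?e x
        + inverse (1 + ((f x - c) / radius k)\<^sup>2) * g x $ j * \<zeta> x)"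
    have I0: "(LINT x|lebesgue_on K. I k x) = 0" for k
      unfolding I_def
    proof (rule weak_chain_rule[OF \<Omega> wg, where ?B0.0 = 2 and ?B1.0 = 1, OF _ _ _ _ K(1,2,3,4)])
      show "((\<lambda>s. radius k * arctan ((s - c) / radius k)) has_real_derivative inverse (1 + ((s - c) / radius k)\<^sup>2)) (at s)" for s
        using radius_pos[of k] by (auto intro!: derivative_eq_intros)
      have "1 + ((s - c) / radius k)\<^sup>2 \<noteq> 0" for s
        using zero_le_power2[of "(s - c) / radius k"] by linarith
      then show "continuous_on UNIV (\<lambda>s. inverse (1 + ((s - c) / radius k)\<^sup>2))"
        using radius_pos[of k] by (intro continuous_intros) auto
      show "\<bar>inverse (1 + ((s - c) / radius k)\<^sup>2)\<bar> \<le> 1" for s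
        by (simp add: inverse_le_1_iff add_nonneg_nonneg)
      show "\<bar>radius k * arctan ((s - c) / radius k)\<bar> \<le> 2" for s
      proof -
        have "\<bar>arctan ((s - c) / radius k)\<bar> \<le> 2"
          using arctan_bounded[of "(s - c) / radius k"] pi_half_less_two by linarith
        moreover have "radius k \<le> 1" by (simp add: radius_def)
        ultimately have "\<bar>radius k\<bar> * \<bar>arctan ((s - c) / radius k)\<bar> \<le> 1 * 2"
          using radius_pos[of k] by (intro mult_mono) auto
        then show ?thesis by (simp add: abs_mult)
      qed
    qed
    have Ks: "K \<in> sets lebesgue" using lmeasurable_compact[OF K(1)] by auto
    have [measurable]: "f \<in> borel_measurable (lebesgue_on K)" "(\<lambda>x. g x $ j) \<in> borel_measurable (lebesgue_on K)"
       "?w \<in> borel_measurable (lebesgue_on K)"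
      using measurable_restrict_mono[OF fm K(2)] measurable_restrict_mono[OF gjm K(2)] measurable_restrict_mono[OF wm K(2)] .
    have [measurable]: "dir_deriv \<zeta> ?e \<in> borel_measurable (lebesgue_on K)" "\<zeta> \<in> borel_measurable (lebesgue_on K)"
      by (intro measurable_restrict_space1 continuous_borel_measurable_lebesgue smooth_continuous smooth_dir_deriv K)+
    obtain C1 where C1: "C1 \<ge> 0" "\<And>x. norm (dir_deriv \<zeta> ?e x) \<le> C1"
      using compact_support_bounded[OF smooth_continuous[OF smooth_dir_deriv[OF K(3)]] K(1,5)] by metis
    obtain C2 where C2: "C2 \<ge> 0" "\<And>x. norm (\<zeta> x) \<le> C2"
      using compact_support_bounded[OF smooth_continuous[OF K(3)] K(1,4)] by metis
    have "(\<lambda>k. LINT x|lebesgue_on K. I k x) \<longlonglongrightarrow> (LINT x|lebesgue_on K. \<zeta> x * ?w x)"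
    proof (rule integral_dominated_convergence[where w = "\<lambda>x. 2 * C1 + C2 * \<bar>g x $ j\<bar>"])
      show "(\<lambda>x. \<zeta> x * ?w x) \<in> borel_measurable (lebesgue_on K)" by (intro borel_measurable_times) auto
      show "I k \<in> borel_measurable (lebesgue_on K)" for k
      proof -
        have "arctan \<in> borel_measurable borel"
          by (intro borel_measurable_continuous_onI continuous_intros)
        then have [measurable]: "(\<lambda>x. arctan ((f x - c) / radius k)) \<in> borel_measurable (lebesgue_on K)"
          by (rule measurable_compose[rotated]) measurable
        show ?thesis unfolding I_def by measurable
      qed
      have "integrable (lebesgue_on K) (\<lambda>x. g x $ j)" using gj K by (simp add: Lp_loc_1_iff)
      moreover have "integrable (lebesgue_on K) (\<lambda>x. 2 * C1)"
        using lmeasurable_compact[OF K(1)]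
        by (simp add: lmeasurable_iff_integrable_on finite_measure_lebesgue_on finite_measure.integrable_const)
      ultimately show "integrable (lebesgue_on K) (\<lambda>x. 2 * C1 + C2 * \<bar>g x $ j\<bar>)" by simp
      show "AE x in lebesgue_on K. (\<lambda>k. I k x) \<longlonglongrightarrow> \<zeta> x * ?w x"
      proof (rule AE_I2)
        fix x
        have "(\<lambda>k. radius k * arctan ((f x - c) / radius k)) \<longlonglongrightarrow> 0"
        proof (rule Lim_null_comparison)
          show "(\<lambda>k. radius k * 2) \<longlonglongrightarrow> 0" using tendsto_mult_left_zero[OF radius_tendsto] .
          show "\<forall>\<^sub>F k in sequentially. norm (radius k * arctan ((f x - c) / radius k)) \<le> radius k * 2"
          proof (rule always_eventually, rule allI)
            fix k
            have "\<bar>arctan ((f x - c) / radius k)\<bar> \<le> 2"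
              using arctan_bounded[of "(f x - c) / radius k"] pi_half_less_two by linarith
            then show "norm (radius k * arctan ((f x - c) / radius k)) \<le> radius k * 2"
              using radius_pos[of k] by (simp add: abs_mult)
          qed
        qed
        then have "(\<lambda>k. I k x) \<longlonglongrightarrow> 0 * dir_deriv \<zeta> ?e x + (if f x - c = 0 then 1 else 0) * g x $ j * \<zeta> x"
          unfolding I_def
          by (intro tendsto_add tendsto_mult tendsto_const smoothed_indicator_tendsto)
        then show "(\<lambda>k. I k x) \<longlonglongrightarrow> \<zeta> x * ?w x" by (auto simp: mult.commute split: if_splits)
      qed
      show "AE x in lebesgue_on K. norm (I k x) \<le> 2 * C1 + C2 * \<bar>g x $ j\<bar>" for k
      proof (rule AE_I2)
        fix x
        have "\<bar>arctan ((f x - c) / radius k)\<bar> \<le> 2"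
          using arctan_bounded[of "(f x - c) / radius k"] pi_half_less_two by linarith
        moreover have "radius k \<le> 1" by (simp add: radius_def)
        ultimately have "\<bar>radius k * arctan ((f x - c) / radius k)\<bar> \<le> 1 * 2"
          unfolding abs_mult using radius_pos[of k] by (intro mult_mono) auto
        then have "\<bar>radius k * arctan ((f x - c) / radius k) * dir_deriv \<zeta> ?e x\<bar> \<le> 2 * C1"
          unfolding abs_mult[of "radius k * arctan ((f x - c) / radius k)"] using C1 by (intro mult_mono) auto
        moreover have "\<bar>inverse (1 + ((f x - c) / radius k)\<^sup>2) * g x $ j * \<zeta> x\<bar> \<le> 1 * \<bar>g x $ j\<bar> * C2"
          unfolding abs_mult using C2
          by (intro mult_mono) (auto simp: inverse_le_1_iff add_nonneg_nonneg)
        ultimately show "norm (I k x) \<le> 2 * C1 + C2 * \<bar>g x $ j\<bar>"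
          unfolding I_def real_norm_def by (simp add: mult.commute)
      qed
    qed
    then have "(LINT x|lebesgue_on K. \<zeta> x * ?w x) = 0" by (simp add: I0 LIMSEQ_const_iff)
    then show "(LINT x|lebesgue_on \<Omega>. \<zeta> x * ?w x) = 0"
      by (subst lebesgue_on_support[OF \<Omega> K(1,2)]) (auto simp: K(4))
  qed
  then have "AE x in lebesgue_on \<Omega>. \<forall>j. (if f x = c then g x $ j else 0) = 0"
    by (simp add: AE_all_countable)
  then show ?thesis by eventually_elim (auto simp: vec_eq_iff)
qed

section \<open>Vanishing weak gradient\<close>

lemma AE_open_obtains:
  fixes S :: "'a::euclidean_space set"
  assumes "open S" "S \<noteq> {}" "AE x in lebesgue_on S. P x"
  obtains x where "x \<in> S" "P x"
proof -
  have "\<exists>x\<in>S. P x"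
  proof (rule ccontr)
    assume "\<not> (\<exists>x\<in>S. P x)"
    then have "AE x in lebesgue. x \<notin> S"
      using assms by (auto simp: AE_lebesgue_on_iff borel_open elim!: eventually_mono)
    then have "S \<in> null_sets lebesgue"
      using assms(1) by (subst AE_iff_null_sets) (auto simp: borel_open)
    then show False using open_not_negligible[OF assms(1,2)] by (simp add: negligible_iff_null_sets)
  qed
  then show ?thesis using that by blast
qed

text \<open>Near \<open>x0\<close> the mollifications of \<open>f\<close> have zero derivative, so they are constant there, and so is their
  almost everywhere limit along a subsequence.\<close>

lemma weak_gradient_0_locally_constant:
  fixes f :: "real^'n \<Rightarrow> real"
  assumes \<Omega>: "open \<Omega>" and wg: "has_weak_gradient f g \<Omega>" and g0: "AE x in lebesgue_on \<Omega>. g x = 0"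
    and x0: "x0 \<in> \<Omega>"
  shows "\<exists>c e. e > 0 \<and> ball x0 e \<subseteq> \<Omega> \<and> (AE y in lebesgue_on (ball x0 e). f y = c)"
proof -
  obtain d where d: "d > 0" "cball x0 d \<subseteq> \<Omega>" using \<Omega> x0 open_contains_cball by metis
  define e where "e = d / 2"
  have e: "e > 0" "e + e = d" using d by (auto simp: e_def)
  define K' where "K' = cball x0 d"
  have K': "compact K'" "K' \<subseteq> \<Omega>" using d by (auto simp: K'_def)
  have K's: "K' \<in> sets lebesgue" using lmeasurable_compact[OF K'(1)] by auto
  have \<Omega>s: "\<Omega> \<in> sets lebesgue" using \<Omega> by (simp add: borel_open)
  have fi: "integrable lebesgue (cutoff K' f)"
    using wg K' by (auto simp: has_weak_gradient_def intro!: Lp_loc_1_cutoff)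
  have "AE x in lebesgue_on K'. g x = 0" by (rule AE_lebesgue_on_subset[OF g0 K'(2) \<Omega>s K's])
  then have c0: "AE x in lebesgue. cutoff K' g x = 0"
    by (auto simp: AE_lebesgue_on_iff K's cutoff_def elim!: eventually_mono)
  have mg: "mollify r (cutoff K' g) x = 0" for r x
    unfolding mollify_def conv_def
    by (rule integral_eq_zero_AE) (use c0 in \<open>auto elim!: eventually_mono\<close>)
  have const: "mollify (radius k) (cutoff K' f) x = mollify (radius k) (cutoff K' f) x0" if "radius k < e" "x \<in> ball x0 e" for k x
  proof -
    let ?p = "mollify (radius k) (cutoff K' f)"
    have p: "smooth ?p" by (rule smooth_mollify[OF radius_pos fi])
    have "\<exists>c. \<forall>y\<in>ball x0 e. ?p y = c"
    proof (rule has_derivative_zero_constant)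
      fix y assume y: "y \<in> ball x0 e"
      have c: "cball y (radius k) \<subseteq> K'"
      proof
        fix z assume "z \<in> cball y (radius k)"
        then show "z \<in> K'"
          using dist_triangle[of x0 z y] y that(1) e(2) by (simp add: K'_def)
      qed
      have ax: "dir_deriv ?p (axis j 1) y = 0" for j
        using mollify_weak_gradient[OF wg \<Omega> K' radius_pos c] mg by simp
      have lin: "linear (frechet_derivative ?p (at y))"
        by (rule has_derivative_linear[OF smooth_has_derivative[OF p]])
      have "frechet_derivative ?p (at y) = (\<lambda>h. 0)"
      proof
        fix h :: "real^'n"
        have "dir_deriv ?p h y = (\<Sum>b\<in>Basis. (h \<bullet> b) *\<^sub>R dir_deriv ?p b y)"
          by (rule linear_euclidean_expand[OF lin])
        also have "\<dots> = 0"
          by (rule sum.neutral) (auto simp: Basis_vec_def ax)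
        finally show "frechet_derivative ?p (at y) h = 0" .
      qed
      then show "(?p has_derivative (\<lambda>h. 0)) (at y within ball x0 e)"
        using smooth_has_derivative[OF p, of y] by (simp add: has_derivative_at_withinI)
    qed auto
    then show ?thesis using that(2) e(1) by auto
  qed
  obtain s where s: "strict_mono s" "AE x in lebesgue_on K'. (\<lambda>k. mollify (radius (s k)) (cutoff K' f) x) \<longlonglongrightarrow> cutoff K' f x"
    using mollify_AE_subsequence[OF fi K'(1)] by blast
  have bK: "ball x0 e \<subseteq> K'" using e by (auto simp: K'_def)
  have ev: "\<forall>\<^sub>F k in sequentially. radius (s k) < e"
    by (rule eventually_subseq[OF s(1) radius_eventually[OF e(1)]])
  have "AE x in lebesgue_on (ball x0 e). (\<lambda>k. mollify (radius (s k)) (cutoff K' f) x) \<longlonglongrightarrow> cutoff K' f x"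
    by (rule AE_lebesgue_on_subset[OF s(2) bK K's]) (simp add: borel_open)
  then have "AE x in lebesgue_on (ball x0 e). f x = lim (\<lambda>k. mollify (radius (s k)) (cutoff K' f) x0)"
    using AE_in_lebesgue_on
  proof eventually_elim
    case (elim x)
    have "\<forall>\<^sub>F k in sequentially. mollify (radius (s k)) (cutoff K' f) x = mollify (radius (s k)) (cutoff K' f) x0"
      using ev by eventually_elim (rule const, use elim in auto)
    then have "(\<lambda>k. mollify (radius (s k)) (cutoff K' f) x0) \<longlonglongrightarrow> cutoff K' f x"
      by (rule Lim_transform_eventually[OF elim(1)])
    then have "lim (\<lambda>k. mollify (radius (s k)) (cutoff K' f) x0) = cutoff K' f x" by (rule limI)
    also have "\<dots> = f x" using elim bK by (intro cutoff_in) auto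
    finally show ?case by simp
  qed
  moreover have "ball x0 e \<subseteq> \<Omega>" using bK K' by blast
  ultimately show ?thesis
    using e(1) by (intro exI conjI)
qed

text \<open>The local constants agree on overlapping balls, as these intersect in a set of positive measure, so they form a
  locally constant function on the connected set \<open>\<Omega>\<close>.\<close>

lemma weak_gradient_0_constant:
  fixes f :: "real^'n \<Rightarrow> real"
  assumes \<Omega>: "open \<Omega>" "connected \<Omega>" "\<Omega> \<noteq> {}"
    and wg: "has_weak_gradient f g \<Omega>" and g0: "AE x in lebesgue_on \<Omega>. g x = 0"
  shows "\<exists>c. AE x in lebesgue_on \<Omega>. f x = c"
proof -
  obtain c e where ce: "\<And>x. x \<in> \<Omega> \<Longrightarrow> e x > 0 \<and> ball x (e x) \<subseteq> \<Omega> \<and> (AE y in lebesgue_on (ball x (e x)). f y = c x)"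
    using weak_gradient_0_locally_constant[OF \<Omega>(1) wg g0] by metis
  have eq: "c x = c y" if x: "x \<in> \<Omega>" and y: "y \<in> ball x (e x)" for x y
  proof -
    have y': "y \<in> \<Omega>" using ce[OF x] y by blast
    let ?S = "ball x (e x) \<inter> ball y (e y)"
    have "AE z in lebesgue_on ?S. f z = c x"
      by (rule AE_lebesgue_on_subset[where S = "ball x (e x)"]) (use ce[OF x] in \<open>auto simp: borel_open\<close>)
    moreover have "AE z in lebesgue_on ?S. f z = c y"
      by (rule AE_lebesgue_on_subset[where S = "ball y (e y)"]) (use ce[OF y'] in \<open>auto simp: borel_open\<close>)
    ultimately have ae: "AE z in lebesgue_on ?S. f z = c x \<and> f z = c y" by eventually_elim simp
    have ne: "?S \<noteq> {}" using y ce[OF y'] by (auto intro!: exI[of _ y])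
    obtain z where "f z = c x \<and> f z = c y"
      using AE_open_obtains[OF open_Int[OF open_ball open_ball] ne ae] by blast
    then show ?thesis by simp
  qed
  obtain a where a: "a \<in> \<Omega>" using \<Omega>(3) by blast
  have ca: "c a = c x" if "x \<in> \<Omega>" for x
  proof (rule connected_local_const[OF \<Omega>(2) a that])
    show "\<forall>x\<in>\<Omega>. \<forall>\<^sub>F y in at x within \<Omega>. c x = c y"
    proof
      fix x assume x: "x \<in> \<Omega>"
      have "\<forall>\<^sub>F y in at x within \<Omega>. y \<in> ball x (e x)"
        unfolding eventually_at using ce[OF x] by (intro exI[of _ "e x"]) (auto simp: dist_commute)
      then show "\<forall>\<^sub>F y in at x within \<Omega>. c x = c y"
        by eventually_elim (rule eq[OF x])
    qed
  qed
  have "AE x in lebesgue_on \<Omega>. f x = c a"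
  proof (intro AE_local[OF \<Omega>(1)])
    fix x assume x: "x \<in> \<Omega>"
    show "\<exists>e>0. AE y in lebesgue_on (ball x e). f y = c a"
      unfolding ca[OF x] using ce[OF x] by blast
  qed
  then show ?thesis by blast
qed

section \<open>Conjugate exponents\<close>

lemma Lp_loc_measurable: "f \<in> Lp_loc p \<Omega> \<Longrightarrow> f \<in> borel_measurable (lebesgue_on \<Omega>)"
  by (simp add: Lp_loc_def)

lemma Lp_loc_infinityD:
  assumes "f \<in> Lp_loc \<infinity> \<Omega>" "compact K" "K \<subseteq> \<Omega>"
  obtains C where "C \<ge> 0" "AE x in lebesgue_on K. norm (f x) \<le> C"
proof -
  obtain C where "AE x in lebesgue_on K. norm (f x) \<le> C" using assms by (auto simp: Lp_loc_def)
  then have "AE x in lebesgue_on K. norm (f x) \<le> max C 0" by eventually_elim auto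
  then show ?thesis using that[of "max C 0"] by auto
qed

lemma Lp_loc_finiteD:
  "f \<in> Lp_loc (ereal q) \<Omega> \<Longrightarrow> compact K \<Longrightarrow> K \<subseteq> \<Omega> \<Longrightarrow> integrable (lebesgue_on K) (\<lambda>x. norm (f x) powr q)"
  by (auto simp: Lp_loc_def)

lemma integrable_const_compact:
  "compact K \<Longrightarrow> integrable (lebesgue_on K) (\<lambda>x::'a::euclidean_space. c :: real)"
  using lmeasurable_compact[of K]
  by (simp add: lmeasurable_iff_integrable_on finite_measure_lebesgue_on finite_measure.integrable_const)

lemma Lp_loc_norm_power:
  fixes G :: "'a::euclidean_space \<Rightarrow> 'b::euclidean_space"
  assumes G: "G \<in> Lp_loc p \<Omega>" and p: "p \<ge> ereal (real m)" and m: "m \<ge> 1"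
  shows "(\<lambda>x. norm (G x) ^ m) \<in> Lp_loc 1 \<Omega>"
  unfolding Lp_loc_1_iff
proof (intro conjI allI impI)
  have Gm: "G \<in> borel_measurable (lebesgue_on \<Omega>)" by (rule Lp_loc_measurable[OF G])
  then show meas: "(\<lambda>x. norm (G x) ^ m) \<in> borel_measurable (lebesgue_on \<Omega>)"
    by measurable
  fix K assume "compact K \<and> K \<subseteq> \<Omega>"
  then have K: "compact K" "K \<subseteq> \<Omega>" by auto
  have mK: "(\<lambda>x. norm (G x) ^ m) \<in> borel_measurable (lebesgue_on K)"
    using measurable_restrict_mono[OF meas K(2)] .
  show "integrable (lebesgue_on K) (\<lambda>x. norm (G x) ^ m)"
  proof (cases p)
    case PInf
    then obtain C where C: "C \<ge> 0" "AE x in lebesgue_on K. norm (G x) \<le> C"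
      using Lp_loc_infinityD[OF _ K] G by blast
    show ?thesis
      by (rule Bochner_Integration.integrable_bound[OF integrable_const_compact[OF K(1), of "C ^ m"] mK])
         (use C in \<open>auto intro!: power_mono elim!: eventually_mono\<close>)
  next
    case MInf
    then show ?thesis using p by simp
  next
    case (real q)
    have qm: "real m \<le> q" using p real by simp
    have "integrable (lebesgue_on K) (\<lambda>x. norm (G x) powr q)"
      by (rule Lp_loc_finiteD[OF _ K]) (use G real in simp)
    then have i: "integrable (lebesgue_on K) (\<lambda>x. 1 + norm (G x) powr q)"
      by (intro Bochner_Integration.integrable_add integrable_const_compact K)
    have b: "norm (G x) ^ m \<le> 1 + norm (G x) powr q" for x
    proof (cases "norm (G x) \<le> 1")
      case True
      then have "norm (G x) ^ m \<le> 1" by (intro power_le_one) auto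
      then show ?thesis by (smt (verit) powr_ge_zero)
    next
      case False
      then have "norm (G x) ^ m = norm (G x) powr real m" by (subst powr_realpow) auto
      also have "\<dots> \<le> norm (G x) powr q" using False qm by (intro powr_mono) auto
      finally show ?thesis by simp
    qed
    show ?thesis
      by (rule Bochner_Integration.integrable_bound[OF i mK])
         (use b in \<open>auto intro!: AE_I2 order_trans[OF _ abs_ge_self]\<close>)
  qed
qed

text \<open>Young's inequality for the conjugate exponents \<open>q / (q - m)\<close> and \<open>q / m\<close> of \<open>s\<close> and \<open>t powr m\<close>. The cruder form
  with constants \<open>1\<close> follows by comparing \<open>s\<close> with \<open>t powr (q - m)\<close>.\<close>

lemma young_conjugate:
  fixes s t m q :: real
  assumes "s \<ge> 0" "t \<ge> 0" "m \<ge> 1" "q > m"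
  shows "s * t powr m \<le> s powr (q / (q - m)) + t powr q"
proof (cases "s \<le> t powr (q - m)")
  case True
  then have "s * t powr m \<le> t powr (q - m) * t powr m" by (intro mult_right_mono) auto
  also have "\<dots> = t powr q" by (simp flip: powr_add)
  finally show ?thesis by (smt (verit) powr_ge_zero)
next
  case False
  have s: "s > 0" using False by (smt (verit) powr_ge_zero)
  have "t powr m = (t powr (q - m)) powr (m / (q - m))"
    using assms by (simp add: powr_powr)
  also have "\<dots> \<le> s powr (m / (q - m))"
    using False assms by (intro powr_mono2) auto
  finally have "s * t powr m \<le> s * s powr (m / (q - m))"
    using assms by (intro mult_left_mono) auto
  also have "\<dots> = s powr (1 + m / (q - m))" using s by (simp add: powr_add)
  also have "1 + m / (q - m) = q / (q - m)" using assms by (simp add: field_simps)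
  finally show ?thesis by (smt (verit) powr_ge_zero)
qed

text \<open>If \<open>p\<close> is infinite then \<open>V\<close> is locally bounded, and if \<open>p = n - 1\<close> then \<open>\<Phi>\<close> is; in both cases one of the two
  dominating functions can be zero. In between, Young's inequality separates the variables.\<close>

lemma locally_dominated_conjugate:
  fixes G :: "'a::euclidean_space \<Rightarrow> 'b::euclidean_space" and \<Phi> :: "'a \<Rightarrow> 'c::euclidean_space"
    and V :: "'a \<Rightarrow> 'd::euclidean_space"
  assumes n: "n \<ge> 2" and p: "p \<ge> ereal (real n - 1)"
    and G: "G \<in> Lp_loc p \<Omega>" and \<Phi>: "\<Phi> \<in> Lp_loc (pbar n p) \<Omega>"
    and V: "\<And>x. norm (V x) \<le> C * norm (G x) ^ (n - 1)" and C: "C \<ge> 0"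
  shows "locally_dominated \<Phi> V \<Omega>"
  unfolding locally_dominated_def
proof (intro allI impI)
  fix K assume "compact K \<and> K \<subseteq> \<Omega>"
  then have K: "compact K" "K \<subseteq> \<Omega>" by auto
  have n1: "real (n - 1) = real n - 1" "n - 1 \<ge> 1" using n by auto
  have Gn: "integrable (lebesgue_on K) (\<lambda>x. norm (G x) ^ (n - 1))"
    using Lp_loc_norm_power[OF G _ n1(2)] p n1(1) K by (simp add: Lp_loc_1_iff)
  let ?thesis = "\<exists>F H P. integrable (lebesgue_on K) F \<and> integrable (lebesgue_on K) H \<and> (\<forall>x. F x \<ge> 0 \<and> H x \<ge> 0)
        \<and> (AE x in lebesgue_on K. P x)
        \<and> (\<forall>x\<in>K. \<forall>y\<in>K. P x \<longrightarrow> P y \<longrightarrow> norm (\<Phi> y) * norm (V x) \<le> F y + H x)"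
  consider "p = \<infinity>" | "p = ereal (real n - 1)" | q where "p = ereal q" "q > real n - 1"
    using p by (cases p) (auto simp: order.order_iff_strict)
  then show ?thesis
  proof cases
    case 1
    have "\<Phi> \<in> Lp_loc 1 \<Omega>" using \<Phi> 1 by (simp add: pbar_def)
    then have i: "integrable (lebesgue_on K) (\<lambda>x. norm (\<Phi> x))"
      using K by (auto simp: Lp_loc_1_iff)
    obtain c where c: "c \<ge> 0" "AE x in lebesgue_on K. norm (G x) \<le> c"
      using Lp_loc_infinityD[OF _ K] G 1 by blast
    show ?thesis
    proof (intro exI conjI)
      show "integrable (lebesgue_on K) (\<lambda>y. (C * c ^ (n - 1)) * norm (\<Phi> y))" using i by simp
      show "integrable (lebesgue_on K) (\<lambda>x. 0)" by simp
      show "AE x in lebesgue_on K. norm (G x) \<le> c" by (rule c)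
      show "\<forall>x. C * c ^ (n - 1) * norm (\<Phi> x) \<ge> 0 \<and> (0::real) \<ge> 0" using C c by simp
      show "\<forall>x\<in>K. \<forall>y\<in>K. norm (G x) \<le> c \<longrightarrow> norm (G y) \<le> c \<longrightarrow>
          norm (\<Phi> y) * norm (V x) \<le> C * c ^ (n - 1) * norm (\<Phi> y) + 0"
      proof (intro ballI impI)
        fix x y assume "norm (G x) \<le> c"
        then have "C * norm (G x) ^ (n - 1) \<le> C * c ^ (n - 1)"
          using C by (intro mult_left_mono power_mono) auto
        then have "norm (V x) \<le> C * c ^ (n - 1)" using V[of x] by linarith
        then have "norm (\<Phi> y) * norm (V x) \<le> norm (\<Phi> y) * (C * c ^ (n - 1))"
          by (intro mult_left_mono) auto
        then show "norm (\<Phi> y) * norm (V x) \<le> C * c ^ (n - 1) * norm (\<Phi> y) + 0"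
          by (simp add: mult.commute)
      qed
    qed
  next
    case 2
    then have "\<Phi> \<in> Lp_loc \<infinity> \<Omega>" using \<Phi> by (simp add: pbar_def)
    then obtain c where c: "c \<ge> 0" "AE x in lebesgue_on K. norm (\<Phi> x) \<le> c"
      using Lp_loc_infinityD[OF _ K] by blast
    show ?thesis
    proof (intro exI conjI)
      show "integrable (lebesgue_on K) (\<lambda>x. 0)" by simp
      show "integrable (lebesgue_on K) (\<lambda>x. c * (C * norm (G x) ^ (n - 1)))" using Gn by simp
      show "AE x in lebesgue_on K. norm (\<Phi> x) \<le> c" by (rule c)
      show "\<forall>x. (0::real) \<ge> 0 \<and> c * (C * norm (G x) ^ (n - 1)) \<ge> 0" using C c by simp
      show "\<forall>x\<in>K. \<forall>y\<in>K. norm (\<Phi> x) \<le> c \<longrightarrow> norm (\<Phi> y) \<le> c \<longrightarrow>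
          norm (\<Phi> y) * norm (V x) \<le> 0 + c * (C * norm (G x) ^ (n - 1))"
        using V c(1) by (auto intro!: mult_mono)
    qed
  next
    case 3
    define a where "a = q / (q + 1 - real n)"
    have "pbar n p = ereal a"
      using 3 by (simp add: pbar_def a_def one_ereal_def)
    then have Fi: "integrable (lebesgue_on K) (\<lambda>x. norm (\<Phi> x) powr a)"
      using Lp_loc_finiteD[OF _ K] \<Phi> by auto
    have Hi: "integrable (lebesgue_on K) (\<lambda>x. norm (G x) powr q)"
      using Lp_loc_finiteD[OF _ K] G 3 by auto
    show ?thesis
    proof (intro exI conjI)
      show "integrable (lebesgue_on K) (\<lambda>x. C * norm (\<Phi> x) powr a)" using Fi by simp
      show "integrable (lebesgue_on K) (\<lambda>x. C * norm (G x) powr q)" using Hi by simp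
      show "AE x in lebesgue_on K. True" by simp
      show "\<forall>x. C * norm (\<Phi> x) powr a \<ge> 0 \<and> C * norm (G x) powr q \<ge> 0" using C by simp
      show "\<forall>x\<in>K. \<forall>y\<in>K. True \<longrightarrow> True \<longrightarrow>
          norm (\<Phi> y) * norm (V x) \<le> C * norm (\<Phi> y) powr a + C * norm (G x) powr q"
      proof (intro ballI impI)
        fix x y
        have pw: "norm (G x) ^ (n - 1) = norm (G x) powr (real n - 1)"
          using n1 by (subst n1(1)[symmetric], subst powr_realpow') auto
        have "norm (\<Phi> y) * norm (V x) \<le> norm (\<Phi> y) * (C * norm (G x) ^ (n - 1))"
          using V by (intro mult_left_mono) auto
        also have "\<dots> = C * (norm (\<Phi> y) * norm (G x) powr (real n - 1))" unfolding pw by simp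
        also have "\<dots> \<le> C * (norm (\<Phi> y) powr (q / (q - (real n - 1))) + norm (G x) powr q)"
          using 3 n C by (intro mult_left_mono young_conjugate) auto
        also have "q / (q - (real n - 1)) = a" by (simp add: a_def algebra_simps)
        finally show "norm (\<Phi> y) * norm (V x) \<le> C * norm (\<Phi> y) powr a + C * norm (G x) powr q"
          by (simp add: distrib_left)
      qed
    qed
  qed
qed

section \<open>Weak solutions\<close>

lemma weak_jacobian_unique:
  fixes u :: "real^'n \<Rightarrow> real^'m"
  assumes "has_weak_jacobian u G1 \<Omega>" "has_weak_jacobian u G2 \<Omega>" "open \<Omega>"
  shows "AE x in lebesgue_on \<Omega>. G1 x = G2 x"
proof -
  have "AE x in lebesgue_on \<Omega>. G1 x $ i = G2 x $ i" for i
    using weak_gradient_unique[OF _ _ assms(3), of "\<lambda>x. u x $ i" "\<lambda>x. G1 x $ i" "\<lambda>x. G2 x $ i"] assms(1,2)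
    by (simp add: has_weak_jacobian_def)
  then have "AE x in lebesgue_on \<Omega>. \<forall>i. G1 x $ i = G2 x $ i" by (simp add: AE_all_countable)
  then show ?thesis by eventually_elim (simp add: vec_eq_iff)
qed

text \<open>Vector fields with a single nonzero component test one row of the system at a time.\<close>

lemma axis_test_function:
  fixes \<zeta> :: "real^'n \<Rightarrow> real"
  assumes "\<zeta> \<in> Cinfc \<Omega>"
  shows "(\<lambda>x. \<zeta> x *\<^sub>R axis i 1 :: real^'m) \<in> C1c \<Omega>"
    and "jacobian (\<lambda>x. \<zeta> x *\<^sub>R axis i 1 :: real^'m) x = (\<chi> k. if k = i then grad \<zeta> x else 0)"
proof -
  obtain K where K: "compact K" "K \<subseteq> \<Omega>" "smooth \<zeta>" "\<And>x. x \<notin> K \<Longrightarrow> \<zeta> x = 0"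
    using Cinfc_E[OF assms] by metis
  have "Ck 1 (\<lambda>x. \<zeta> x *\<^sub>R axis i 1 :: real^'m)"
    using smooth_scaleR[OF K(3) smooth_const[of "axis i 1 :: real^'m"]] by (simp add: smooth_def)
  moreover have "compact_support_in \<Omega> (\<lambda>x. \<zeta> x *\<^sub>R axis i 1 :: real^'m)"
    by (rule compact_support_inI[OF K(1,2)]) (simp add: K(4))
  ultimately show "(\<lambda>x. \<zeta> x *\<^sub>R axis i 1 :: real^'m) \<in> C1c \<Omega>" by (simp add: C1c_def)
  have "((\<lambda>x. \<zeta> x *\<^sub>R axis i 1 :: real^'m) has_derivative (\<lambda>v. dir_deriv \<zeta> v x *\<^sub>R axis i 1)) (at x)"
    by (rule has_derivative_scaleR_left[OF smooth_has_derivative[OF K(3)]])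
  then have "frechet_derivative (\<lambda>x. \<zeta> x *\<^sub>R axis i 1 :: real^'m) (at x) = (\<lambda>v. dir_deriv \<zeta> v x *\<^sub>R axis i 1)"
    by (metis frechet_derivative_at)
  then show "jacobian (\<lambda>x. \<zeta> x *\<^sub>R axis i 1 :: real^'m) x = (\<chi> k. if k = i then grad \<zeta> x else 0)"
    by (simp add: jacobian_def matrix_def vec_eq_iff grad_nth axis_def)
qed

lemma inner_single_row: "A \<bullet> (\<chi> k. if k = i then a else 0) = A $ i \<bullet> a" for A :: "real^'n^'m"
proof -
  have "A \<bullet> (\<chi> k. if k = i then a else 0) = (\<Sum>k\<in>UNIV. if k = i then A $ i \<bullet> a else 0)"
    unfolding inner_vec_def by (rule sum.cong) auto
  then show ?thesis by simp
qed

text \<open>The definition of a weak solution speaks of some representative of the weak Jacobian; it equals \<open>G\<close> almost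
  everywhere.\<close>

lemma weak_solution_row:
  fixes u :: "real^'n \<Rightarrow> real^'n" and G :: "real^'n \<Rightarrow> real^'n^'n"
  assumes ws: "weak_solution h \<Omega> u" and \<Omega>: "open \<Omega>" and G: "has_weak_jacobian u G \<Omega>"
    and f: "AE x in lebesgue_on \<Omega>. f x = h (det (G x))"
    and m: "(\<lambda>x. f x *\<^sub>R cof (G x) $ i) \<in> borel_measurable (lebesgue_on \<Omega>)"
  shows "\<zeta> \<in> Cinfc \<Omega> \<Longrightarrow> (LINT x|lebesgue_on \<Omega>. (f x *\<^sub>R cof (G x) $ i) \<bullet> grad \<zeta> x) = 0"
    and "(\<lambda>x. f x *\<^sub>R cof (G x) $ i) \<in> Lp_loc 1 \<Omega>"
proof -
  obtain D where D: "has_weak_jacobian u D \<Omega>" "(\<lambda>x. h (det (D x)) *\<^sub>R cof (D x)) \<in> Lp_loc 1 \<Omega>"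
    "\<And>Z. Z \<in> C1c \<Omega> \<Longrightarrow> (LINT x|lebesgue_on \<Omega>. (h (det (D x)) *\<^sub>R cof (D x)) \<bullet> jacobian Z x) = 0"
    using ws unfolding weak_solution_def by blast
  have \<Omega>s: "\<Omega> \<in> sets lebesgue" using \<Omega> by (simp add: borel_open)
  have ae: "AE x in lebesgue_on \<Omega>. (h (det (D x)) *\<^sub>R cof (D x)) $ i = f x *\<^sub>R cof (G x) $ i"
    using weak_jacobian_unique[OF D(1) G \<Omega>] f by eventually_elim simp
  have Di: "(\<lambda>x. (h (det (D x)) *\<^sub>R cof (D x)) $ i) \<in> Lp_loc 1 \<Omega>"
    by (rule Lp_loc_1_bounded_linear[OF bounded_linear_vec_nth D(2)])
  then have Dm: "(\<lambda>x. (h (det (D x)) *\<^sub>R cof (D x)) $ i) \<in> borel_measurable (lebesgue_on \<Omega>)"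
    by (rule Lp_loc_measurable)
  show "(LINT x|lebesgue_on \<Omega>. (f x *\<^sub>R cof (G x) $ i) \<bullet> grad \<zeta> x) = 0" if \<zeta>: "\<zeta> \<in> Cinfc \<Omega>"
  proof -
    have K: "smooth \<zeta>" using \<zeta> by (simp add: Cinfc_iff)
    have gm: "grad \<zeta> \<in> borel_measurable (lebesgue_on \<Omega>)"
      by (intro measurable_restrict_space1 continuous_borel_measurable_lebesgue continuous_grad K)
    have "(LINT x|lebesgue_on \<Omega>. (f x *\<^sub>R cof (G x) $ i) \<bullet> grad \<zeta> x)
        = (LINT x|lebesgue_on \<Omega>. (h (det (D x)) *\<^sub>R cof (D x)) $ i \<bullet> grad \<zeta> x)"
      by (rule integral_cong_AE[OF borel_measurable_inner[OF m gm] borel_measurable_inner[OF Dm gm]])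
         (use ae in eventually_elim, simp)
    also have "\<dots> = 0"
      using D(3)[OF axis_test_function(1)[OF \<zeta>, of i]]
      by (simp only: axis_test_function(2)[OF \<zeta>] inner_single_row)
    finally show ?thesis .
  qed
  show "(\<lambda>x. f x *\<^sub>R cof (G x) $ i) \<in> Lp_loc 1 \<Omega>"
    unfolding Lp_loc_1_iff
  proof (intro conjI allI impI m)
    fix K assume "compact K \<and> K \<subseteq> \<Omega>"
    then have K: "compact K" "K \<subseteq> \<Omega>" by auto
    have Ks: "K \<in> sets lebesgue" using lmeasurable_compact[OF K(1)] by auto
    have "integrable (lebesgue_on K) (\<lambda>x. (h (det (D x)) *\<^sub>R cof (D x)) $ i)"
      using Di K by (simp add: Lp_loc_1_iff)
    then show "integrable (lebesgue_on K) (\<lambda>x. f x *\<^sub>R cof (G x) $ i)"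
      by (rule integrable_cong_AE_imp)
         (use measurable_restrict_mono[OF m K(2)] AE_lebesgue_on_subset[OF ae K(2) \<Omega>s Ks] in \<open>auto elim!: eventually_mono\<close>)
  qed
qed

text \<open>Multiply \<open>cof A *v v = 0\<close> by the transpose of \<open>A\<close>.\<close>

lemma det_scaleR_eq_0:
  fixes A :: "real^'n^'n"
  assumes "\<And>i. cof A $ i \<bullet> v = 0"
  shows "det A *\<^sub>R v = 0"
proof -
  have "cof A *v v = 0"
    using assms by (simp add: vec_eq_iff matrix_vector_mult_def inner_vec_def)
  then have "(transpose A ** cof A) *v v = 0"
    by (simp flip: matrix_vector_mul_assoc)
  moreover have "mat (det A) *v v = det A *\<^sub>R v"
    by (simp add: vec_eq_iff matrix_vector_mult_def mat_def if_distrib if_distribR cong: if_cong)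
  ultimately show ?thesis by (simp add: transpose_mult_cof)
qed

theorem proposition2p4:
  fixes \<Omega> :: "(real^'n) set"
    and h :: "real \<Rightarrow> real"
    and p :: ereal
    and u :: "real^'n \<Rightarrow> real^'n"
    and Du :: "real^'n \<Rightarrow> real^'n^'n"
  assumes "CARD('n) \<ge> 2"
    and "open \<Omega>" and "connected \<Omega>" and "\<Omega> \<noteq> {}" and "bounded \<Omega>"
    and "continuous_on UNIV h"
    and "p \<ge> ereal (real CARD('n) - 1)"
    and "u \<in> W1p_loc_vec p \<Omega>"
    and "has_weak_jacobian u Du \<Omega>"
    and "weak_solution h \<Omega> u"
    and "(\<lambda>x. h (det (Du x))) \<in> W1p_loc (pbar CARD('n) p) \<Omega>"
  shows "\<exists>c. AE x in lebesgue_on \<Omega>. h (det (Du x)) = c"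
proof -
  note n = assms(1) and \<Omega> = assms(2) and p = assms(7) and Du = assms(9) and ws = assms(10)
  have \<Omega>s: "\<Omega> \<in> sets lebesgue" using \<Omega> by (simp add: borel_open)
  let ?f = "\<lambda>x. h (det (Du x))"
  \<comment> \<open>the representative \<open>G\<close> of the weak Jacobian carries the integrability, the given \<open>Du\<close> the function \<open>f\<close>\<close>
  obtain G where G: "G \<in> Lp_loc p \<Omega>" "has_weak_jacobian u G \<Omega>"
    using assms(8) by (auto simp: W1p_loc_vec_def)
  have ae: "AE x in lebesgue_on \<Omega>. Du x = G x" by (rule weak_jacobian_unique[OF Du G(2) \<Omega>])
  obtain g where fL: "?f \<in> Lp_loc (pbar CARD('n) p) \<Omega>" and gL: "g \<in> Lp_loc (pbar CARD('n) p) \<Omega>"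
    and wg: "has_weak_gradient ?f g \<Omega>"
    using assms(11) by (auto simp: W1p_loc_def)
  have fae: "AE x in lebesgue_on \<Omega>. ?f x = h (det (G x))" using ae by eventually_elim simp
  have Gm: "G \<in> borel_measurable (lebesgue_on \<Omega>)" by (rule Lp_loc_measurable[OF G(1)])
  have fm: "?f \<in> borel_measurable (lebesgue_on \<Omega>)" by (rule Lp_loc_measurable[OF fL])
  have gm: "g \<in> borel_measurable (lebesgue_on \<Omega>)" by (rule Lp_loc_measurable[OF gL])
  have p': "p \<ge> ereal (real (CARD('n) - 1))" using p n by (simp add: of_nat_diff)
  have Gn: "(\<lambda>x. norm (G x) ^ (CARD('n) - 1)) \<in> Lp_loc 1 \<Omega>"
    by (rule Lp_loc_norm_power[OF G(1) p']) (use n in simp)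
  have "p \<ge> ereal (real 1)"
    by (rule order_trans[OF _ p']) (use n in simp)
  from Lp_loc_norm_power[OF G(1) this] have "(\<lambda>x. norm (G x)) \<in> Lp_loc 1 \<Omega>" by simp
  then have GL: "G \<in> Lp_loc 1 \<Omega>"
    using Gm integrable_norm_iff[OF measurable_restrict_mono[OF Gm]] by (auto simp: Lp_loc_1_iff)
  have Vg: "AE x in lebesgue_on \<Omega>. cof (G x) $ i \<bullet> g x = 0" for i
  proof (rule fundamental_lemma[OF _ \<Omega>])
    let ?V = "\<lambda>x. cof (G x) $ i"
    have Vm: "?V \<in> borel_measurable (lebesgue_on \<Omega>)" by (rule borel_measurable_cof[OF Gm])
    have df: "locally_dominated ?f ?V \<Omega>" and dg: "locally_dominated g ?V \<Omega>"
      by (rule locally_dominated_conjugate[OF n p G(1) fL norm_cof_row], simp)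
         (rule locally_dominated_conjugate[OF n p G(1) gL norm_cof_row], simp)
    show Vg1: "(\<lambda>x. ?V x \<bullet> g x) \<in> Lp_loc 1 \<Omega>" by (rule locally_dominated_inner[OF dg gm Vm])
    note row = weak_solution_row[OF ws \<Omega> G(2) fae borel_measurable_scaleR[OF fm Vm]]
    fix \<zeta> :: "real^'n \<Rightarrow> real" assume \<zeta>: "\<zeta> \<in> Cinfc \<Omega>"
    obtain K where K: "compact K" "K \<subseteq> \<Omega>" "smooth \<zeta>" "\<And>x. x \<notin> K \<Longrightarrow> \<zeta> x = 0" "\<And>x v. x \<notin> K \<Longrightarrow> dir_deriv \<zeta> v x = 0"
      using Cinfc_E[OF \<zeta>] by metis
    have i1: "integrable (lebesgue_on \<Omega>) (\<lambda>x. (?f x *\<^sub>R ?V x) \<bullet> grad \<zeta> x)"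
    proof -
      have "integrable (lebesgue_on \<Omega>) (\<lambda>x. dir_deriv \<zeta> (axis j 1) x * (?f x *\<^sub>R ?V x) $ j)" for j
        by (rule integrable_test_mult[OF Lp_loc_1_bounded_linear[OF bounded_linear_vec_nth row(2)]
              \<Omega> smooth_continuous[OF smooth_dir_deriv[OF K(3)]] K(1,2,5)])
      then have "integrable (lebesgue_on \<Omega>) (\<lambda>x. \<Sum>j\<in>UNIV. dir_deriv \<zeta> (axis j 1) x * (?f x *\<^sub>R ?V x) $ j)"
        by (rule Bochner_Integration.integrable_sum)
      then show ?thesis by (simp add: inner_vec_def grad_nth mult.commute)
    qed
    have i2: "integrable (lebesgue_on \<Omega>) (\<lambda>x. \<zeta> x * (?V x \<bullet> g x))"
      by (rule integrable_test_mult[OF Vg1 \<Omega> smooth_continuous[OF K(3)] K(1,2,4)])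
    have "0 = (LINT x|lebesgue_on \<Omega>. ?V x \<bullet> (?f x *\<^sub>R grad \<zeta> x + \<zeta> x *\<^sub>R g x))"
      by (rule div_free_weak_product[OF \<Omega> Vm weak_piola[OF n \<Omega> G(2) GL Gn] wg locally_dominated_Pair[OF df dg] \<zeta>, symmetric])
    also have "\<dots> = (LINT x|lebesgue_on \<Omega>. (?f x *\<^sub>R ?V x) \<bullet> grad \<zeta> x + \<zeta> x * (?V x \<bullet> g x))"
      by (simp add: inner_add_right)
    also have "\<dots> = (LINT x|lebesgue_on \<Omega>. \<zeta> x * (?V x \<bullet> g x))"
      unfolding Bochner_Integration.integral_add[OF i1 i2] row(1)[OF \<zeta>] by simp
    finally show "(LINT x|lebesgue_on \<Omega>. \<zeta> x * (?V x \<bullet> g x)) = 0" by simp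
  qed
  have "AE x in lebesgue_on \<Omega>. \<forall>i. cof (G x) $ i \<bullet> g x = 0"
    using Vg by (simp add: AE_all_countable)
  \<comment> \<open>off the zero set of the determinant \<open>g\<close> vanishes algebraically, on it because \<open>f = h 0\<close> there\<close>
  with fae weak_gradient_level_set[OF \<Omega> wg, of "h 0"] have "AE x in lebesgue_on \<Omega>. g x = 0"
  proof eventually_elim
    case (elim x)
    then have "det (G x) *\<^sub>R g x = 0" by (intro det_scaleR_eq_0) auto
    then show ?case using elim by (cases "det (G x) = 0") auto
  qed
  then show ?thesis
    by (rule weak_gradient_0_constant[OF \<Omega> assms(3,4) wg])
qed

end
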